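(* Let $0<p_1\le\infty$, $0<\theta\le\infty$, $0<p_2\le\infty$, $v_1,v_2\in\mathcal W(\mathbb{R}^n)$ and $\omega\in{}^c\Omega_\theta$. Write $I:=\|\mathrm{Id}\|_{L_{p_1}(\mathbb{R}^n,v_1)\to {}^cLM_{p_2\theta,\omega}(\mathbb{R}^n,v_2)}$. Then, uniformly in $\omega\in{}^c\Omega_\theta$: (i) if $p_2<p_1\le\theta<\infty$: $I\approx \sup_{t>0}\|\omega\|_{\theta,(0,t)}\,\big\|v_1^{-1/p_1}v_2^{1/p_2}\big\|_{\frac{p_1p_2}{p_1-p_2},{}^cB(0,t)}$; (ii) if $p_2<p_1<\infty$ and $0<\theta<p_1$: $I\approx \Big\|\,\|\omega\|_{\theta,(0,t)}^{\theta/p_1}\big\|v_1^{-1/p_1}v_2^{1/p_2}\big\|_{\frac{p_1p_2}{p_1-p_2},{}^cB(0,t)}\Big\|_{\frac{\theta p_1}{p_1-\theta},(0,\infty),\omega^\theta}$ (outer norm in $t$); (iii) if $p_2<p_1<\infty$ and $\theta=\infty$: $I\approx \sup_{t>0}\|\omega\|_{\theta,(0,t)}\,\big\|v_1^{-1/p_1}v_2^{1/p_2}\big\|_{\frac{p_1p_2}{p_1-p_2},{}^cB(0,t)}$; (iv) if $p_1=\theta=\infty$ and $0<p_2<\infty$: $I\approx\sup_{t>0}\|\omega\|_{\theta,(0,t)}\,\big\|v_1^{-1}v_2^{1/p_2}\big\|_{p_2,{}^cB(0,t)}$; (v) if $p_1=\infty$, $0<p_2<\infty$, $0<\theta<\infty$: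 $I\approx\Big\|\omega(t)\,\big\|v_1^{-1}v_2^{1/p_2}\big\|_{p_2,{}^cB(0,t)}\Big\|_{\theta,(0,\infty)}$; (vi) if $p=p_1=p_2\le\theta<\infty$: $I\approx\sup_{t>0}\|\omega\|_{\theta,(0,t)}\,\big\|v_1^{-1/p}v_2^{1/p}\big\|_{\infty,{}^cB(0,t)}$; (vii) if $0<p:=p_1=p_2<\infty$ and $0<\theta<p$: $I\approx\Big\|\,\|\omega\|_{\theta,(0,t)}^{\theta/p}\big\|v_1^{-1/p}v_2^{1/p}\big\|_{\infty,{}^cB(0,t)}\Big\|_{\frac{\theta p}{p-\theta},(0,\infty),\omega^\theta}$; (viii) if $0<p:=p_1=p_2<\infty$ and $\theta=\infty$: $I\approx\sup_{t>0}\|\omega\|_{\theta,(0,t)}\,\big\|v_1^{-1/p}v_2^{1/p}\big\|_{\infty,{}^cB(0,t)}$; (ix) if $p:=p_1=p_2=\infty$ and $0<\theta<\infty$: $I\approx\Big\|\omega(t)\,\big\|v_1^{-1}v_2\big\|_{\infty,{}^cB(0,t)}\Big\|_{\theta,(0,\infty)}$. (Both sides may equal $+\infty$.)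
   Context: $B(0,r)$ is the open ball in $\mathbb{R}^n$ centered at $0$ of radius $r$ and ${}^cB(0,r):=\mathbb{R}^n\setminus B(0,r)$. For a measurable set $A$, $0<p\le\infty$ and measurable $w\ge0$ on $A$: $\|f\|_{p,A,w}:=(\int_A|f|^pw)^{1/p}$ if $p<\infty$, $\operatorname{ess\,sup}_A|f|w$ if $p=\infty$; $\|f\|_{p,A}:=\|f\|_{p,A,1}$. $\mathcal W(\mathbb{R}^n)$ is the set of measurable functions on $\mathbb{R}^n$ positive and finite a.e. Conventions: $0/0=0$, $0\cdot(\pm\infty)=0$, $1/(\pm\infty)=0$. $L_p(\mathbb{R}^n,v)$ is the set of measurable $f$ with $\|f\|_{p,\mathbb{R}^n,v}<\infty$. For $0<p,\theta\le\infty$, measurable $\omega\ge0$ on $(0,\infty)$ and $v\in\mathcal W(\mathbb{R}^n)$, the weighted complementary local Morrey-type space ${}^cLM_{p\theta,\omega}(\mathbb{R}^n,v)$ is the set of $f$ with $f\in L_p({}^cB(0,t),v)$ for all $t>0$ and $\|f\|_{{}^cLM_{p\theta,\omega}(\mathbb{R}^n,v)}:=\big\|\omega(r)\|f\|_{p,{}^cB(0,r),v}\big\|_{\theta,(0,\infty)}<\infty$. ${}^c\Omega_\theta$ is the set of measurable $\omega\ge0$ on $(0,\infty)$ with $0<\|\omega\|_{\theta,(0,t)}<\infty$ for all $t>0$. $\|\mathrm{Id}\|_{X\to Y}:=\sup_{f\in X,\,f\not\sim0}\|f\|_Y/\|f\|_X\in[0,\infty]$. "$A(\omega)\approx B(\omega)$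 uniformly in $\omega\in{}^c\Omega_\theta$" means there are constants $0<c\le C$, which may depend on $n,p_1,p_2,\theta,v_1,v_2$ but not on $\omega$, with $cA(\omega)\le B(\omega)\le CA(\omega)$ for all such $\omega$. *)

theory Defs
  imports "HOL-Analysis.Analysis"
begin

text \<open>Power of an extended nonnegative real with a positive real exponent
  (only used with positive exponents): \<open>\<infinity>^a = \<infinity>\<close>, \<open>0^a = 0\<close>.\<close>
definition enn_powr :: "ennreal \<Rightarrow> real \<Rightarrow> ennreal" where
  "enn_powr x a = (if x = \<infinity> then \<infinity> else ennreal (enn2real x powr a))"

definition ess_sup_on :: "'a measure \<Rightarrow> 'a set \<Rightarrow> ('a \<Rightarrow> ennreal) \<Rightarrow> ennreal" where
  "ess_sup_on M A g = Inf {C. AE x in M. x \<in> A \<longrightarrow> g x \<le> C}"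

definition wnorm :: "'a measure \<Rightarrow> ereal \<Rightarrow> 'a set \<Rightarrow> ('a \<Rightarrow> ennreal) \<Rightarrow> ('a \<Rightarrow> ennreal) \<Rightarrow> ennreal" where
  "wnorm M p A w f =
     (if p = \<infinity> then ess_sup_on M A (\<lambda>x. f x * w x)
      else enn_powr (\<integral>\<^sup>+x\<in>A. enn_powr (f x) (real_of_ereal p) * w x \<partial>M) (1 / real_of_ereal p))"

definition unorm :: "'a measure \<Rightarrow> ereal \<Rightarrow> 'a set \<Rightarrow> ('a \<Rightarrow> ennreal) \<Rightarrow> ennreal" where
  "unorm M p A f = wnorm M p A (\<lambda>_. 1) f"

definition cball0 :: "real \<Rightarrow> 'a::euclidean_space set" where
  "cball0 r = UNIV - ball 0 r"

definition Wset :: "('a::euclidean_space \<Rightarrow> real) set" where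
  "Wset = {v. v \<in> borel_measurable lebesgue \<and> (AE x in lebesgue. 0 < v x)}"

definition Lp_norm :: "ereal \<Rightarrow> ('a::euclidean_space \<Rightarrow> real) \<Rightarrow> ('a \<Rightarrow> real) \<Rightarrow> ennreal" where
  "Lp_norm p v f = wnorm lebesgue p UNIV (\<lambda>x. ennreal (v x)) (\<lambda>x. ennreal \<bar>f x\<bar>)"

definition cLM_norm :: "ereal \<Rightarrow> ereal \<Rightarrow> (real \<Rightarrow> real) \<Rightarrow> ('a::euclidean_space \<Rightarrow> real)
    \<Rightarrow> ('a \<Rightarrow> real) \<Rightarrow> ennreal" where
  "cLM_norm p \<theta> \<omega> v f =
     unorm lebesgue \<theta> {0<..}
       (\<lambda>r. ennreal (\<omega> r) * wnorm lebesgue p (cball0 r) (\<lambda>x. ennreal (v x)) (\<lambda>x. ennreal \<bar>f x\<bar>))"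

definition cOmega :: "ereal \<Rightarrow> (real \<Rightarrow> real) set" where
  "cOmega \<theta> = {\<omega>. \<omega> \<in> borel_measurable (restrict_space lebesgue {0<..}) \<and> (\<forall>t>0. 0 \<le> \<omega> t) \<and>
      (\<forall>t>0. 0 < unorm lebesgue \<theta> {0<..<t} (\<lambda>s. ennreal (\<omega> s))
             \<and> unorm lebesgue \<theta> {0<..<t} (\<lambda>s. ennreal (\<omega> s)) < \<infinity>)}"

definition Id_norm :: "ereal \<Rightarrow> ('a::euclidean_space \<Rightarrow> real) \<Rightarrow> ereal \<Rightarrow> ereal \<Rightarrow> (real \<Rightarrow> real)
    \<Rightarrow> ('a \<Rightarrow> real) \<Rightarrow> ennreal" where
  "Id_norm p1 v1 p2 \<theta> \<omega> v2 =
     (SUP f\<in>{f. f \<in> borel_measurable lebesgue \<and> Lp_norm p1 v1 f < \<infinity>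
                \<and> \<not> (AE x in lebesgue. f x = 0)}.
        cLM_norm p2 \<theta> \<omega> v2 f / Lp_norm p1 v1 f)"

definition unif_equiv :: "('b \<Rightarrow> bool) \<Rightarrow> ('b \<Rightarrow> ennreal) \<Rightarrow> ('b \<Rightarrow> ennreal) \<Rightarrow> bool" where
  "unif_equiv S A B \<longleftrightarrow>
     (\<exists>c C::real. 0 < c \<and> c \<le> C \<and>
        (\<forall>\<omega>. S \<omega> \<longrightarrow> ennreal c * A \<omega> \<le> B \<omega> \<and> B \<omega> \<le> ennreal C * A \<omega>))"

end

theory Submission
  imports Defs
begin

text \<open>
  Write \<open>N(A,f)\<close> for the norm of \<open>f\<close> in \<open>L_{p_2}(A, v_2)\<close> and \<open>V(A)\<close> for the norm of
  \<open>v_1^{-1/p_1} v_2^{1/p_2}\<close> over \<open>A\<close>. By Hoelder's inequality and its converse, \<open>V(A)\<close> is the best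
  constant in \<open>N(A,f) \<le> C \<parallel>f\<parallel>_{p_1,v_1}\<close>. For \<open>\<theta> = \<infinity>\<close> or \<open>p_1 = \<infinity>\<close> this gives the operator norm
  directly. Otherwise the half line is cut at the points where \<open>F(t) = \<integral>_0^t \<omega>^\<theta>\<close> takes the values
  \<open>2^k\<close>; with \<open>X_k = {x. 2^k \<le> F(|x|)}\<close> and \<open>Y_k = X_k - X_{k+1}\<close> a discrete Hardy inequality gives
  \<open>\<parallel>f\<parallel>^\<theta> \<approx> \<Sum>_k 2^k N(X_k,f)^\<theta> \<approx> \<Sum>_k 2^k N(Y_k,f)^\<theta>\<close> for the Morrey norm of \<open>f\<close>. The upper bounds
  follow by Hoelder's inequality on each annulus \<open>Y_k\<close> and then in \<open>k\<close>. For the lower bounds one tests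
  with a near extremal function of a single complement of a ball if \<open>p_1 \<le> \<theta>\<close>, and with an
  \<open>\<ell>^{p_1}\<close>-combination of near extremal functions of finitely many \<open>X_k\<close> if \<open>\<theta> < p_1\<close>.
\<close>

section \<open>Powers of extended nonnegative reals\<close>

text \<open>Every exponent may be smaller than 1 and either side may be infinite, so neither the
  triangle inequality nor duality of Lebesgue spaces is available, and all estimates are carried out
  in \<open>ennreal\<close>. For finite exponents \<open>N\<close> is a power of an integral, hence
  additive over annuli before the outer power is taken. Cutting at values of F rather than at
  prescribed radii makes the mass of \<omega>^\<theta> on an annulus comparable to 2^k whatever
  \<omega> is, up to two degeneracies. F may be constant on intervals, so a cut point is the least
  radius with the given value. F may be bounded, so high levels are empty and the last annulus may
  carry hardly any mass; lower estimates therefore compare each level with the annulus preceding it.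
  In the lower bound for \<theta> < p_1 the near extremal functions overlap. The p_1-th root of a
  sum of p_1-th powers dominates each summand, and its p_1-th power is integrated term by term. The
  quantity to be bounded then appears on both sides and has to be cancelled, so it must first be
  known to be finite.\<close>

lemma enn_powr_ennreal: "0 \<le> x \<Longrightarrow> enn_powr (ennreal x) a = ennreal (x powr a)"
  by (simp add: enn_powr_def)

lemma enn_powr_top [simp]: "enn_powr top a = top"
  by (simp add: enn_powr_def)

lemma enn_powr_0 [simp]: "enn_powr 0 a = 0"
  by (simp add: enn_powr_def)

lemma enn_powr_1 [simp]: "enn_powr 1 a = 1"
  by (simp add: enn_powr_def)

lemma enn_powr_one [simp]: "enn_powr x 1 = x"
  by (cases x) (auto simp: enn_powr_def)

lemma enn_powr_eq_0_iff [simp]: "enn_powr x a = 0 \<longleftrightarrow> x = 0"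
  by (cases x) (auto simp: enn_powr_def)

lemma enn_powr_eq_top_iff [simp]: "enn_powr x a = top \<longleftrightarrow> x = top"
  by (cases x) (auto simp: enn_powr_def)

text \<open>0 and infinity are fixed by \<open>enn_powr\<close> for every exponent, so the rule
  respects 0 * infinity = 0 and holds for \<open>a\<close> of any sign.\<close>

lemma enn_powr_mult: "enn_powr (x * y) a = enn_powr x a * enn_powr y a"
proof (cases "x = top \<or> y = top")
  case True
  then show ?thesis
    by (auto simp: ennreal_top_mult ennreal_mult_top)
next
  case False
  then obtain r s where "x = ennreal r" "y = ennreal s" "0 \<le> r" "0 \<le> s"
    by (metis ennreal_cases)
  then show ?thesis
    by (simp add: enn_powr_ennreal powr_mult ennreal_mult[symmetric])
qed

lemma enn_powr_mono: "x \<le> y \<Longrightarrow> 0 \<le> a \<Longrightarrow> enn_powr x a \<le> enn_powr y a"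
  by (cases x; cases y) (auto simp: enn_powr_ennreal powr_mono2 top_unique)

lemma enn_powr_powr: "enn_powr (enn_powr x a) b = enn_powr x (a * b)"
  by (cases x) (auto simp: enn_powr_ennreal powr_powr)

lemma enn_powr_inv: "a \<noteq> 0 \<Longrightarrow> enn_powr (enn_powr x a) (1 / a) = x"
  "a \<noteq> 0 \<Longrightarrow> enn_powr (enn_powr x (1 / a)) a = x"
  by (simp_all add: enn_powr_powr)

lemma enn_powr_add: "enn_powr x (a + b) = enn_powr x a * enn_powr x b"
  by (cases x) (auto simp: enn_powr_ennreal powr_add ennreal_mult)

lemma enn_powr_le_iff: "0 < a \<Longrightarrow> enn_powr x a \<le> enn_powr y a \<longleftrightarrow> x \<le> y"
  by (metis enn_powr_inv(1) enn_powr_mono less_eq_real_def order_less_irrefl zero_le_divide_1_iff)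

lemma enn_powr_le_swap: "0 < a \<Longrightarrow> enn_powr x a \<le> y \<longleftrightarrow> x \<le> enn_powr y (1 / a)"
  by (metis enn_powr_inv(2) enn_powr_le_iff less_irrefl)

text \<open>For positive \<open>a\<close> the power is an order automorphism of
  \<open>ennreal\<close> with inverse exponent \<open>1 / a\<close>, so it commutes with arbitrary
  suprema, the empty one included because 0 is mapped to 0.\<close>

lemma enn_powr_SUP: "0 < a \<Longrightarrow> enn_powr (SUP i\<in>I. f i) a = (SUP i\<in>I. enn_powr (f i) a)"
proof (rule antisym)
  assume a: "0 < a"
  have "f i \<le> enn_powr (SUP i\<in>I. enn_powr (f i) a) (1 / a)" if "i \<in> I" for i
    using that a by (subst enn_powr_le_swap[symmetric]) (auto intro: SUP_upper)
  then show "enn_powr (SUP i\<in>I. f i) a \<le> (SUP i\<in>I. enn_powr (f i) a)"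
    using a by (simp add: enn_powr_le_swap SUP_least)
qed (auto intro!: SUP_least enn_powr_mono SUP_upper)

lemma measurable_enn_powr [measurable]:
  "f \<in> borel_measurable M \<Longrightarrow> (\<lambda>x. enn_powr (f x) a) \<in> borel_measurable M"
proof -
  assume [measurable]: "f \<in> borel_measurable M"
  have "enn_powr y a = (if top \<le> y then top else ennreal (enn2real y powr a))" for y
    by (simp add: enn_powr_def top_unique)
  then show ?thesis by simp
qed

text \<open>Weighted arithmetic-geometric mean inequality for g/x and h/y, multiplied by x^a y^b.
  The parameters x and y are to be set to the two integrals in Hoelder's inequality; the right-hand
  side then integrates to exactly x^a y^b.\<close>

lemma enn_powr_mult_le_Young:
  assumes "0 < a" "0 < b" "a + b = 1" "0 < x" "0 < y"
  shows "enn_powr g a * enn_powr h b \<le>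
    ennreal (x powr a * y powr b) * (ennreal (a / x) * g + ennreal (b / y) * h)"
proof (cases "g = 0 \<or> h = 0 \<or> g = top \<or> h = top")
  case True
  then show ?thesis using assms by (auto simp: ennreal_mult_top)
next
  case False
  then obtain r s where g: "g = ennreal r" "h = ennreal s" "0 < r" "0 < s"
    by (metis ennreal_cases ennreal_0 less_eq_real_def)
  have "(r / x) powr a * (s / y) powr b \<le> a * (r / x) + b * (s / y)"
    by (rule Youngs_inequality_0) (use assms g in auto)
  then have "r powr a * s powr b \<le> x powr a * y powr b * (a / x * r + b / y * s)"
    using assms g by (simp add: powr_divide field_simps)
  then show ?thesis
    using assms g
    by (simp add: enn_powr_ennreal ennreal_leI flip: ennreal_mult ennreal_plus)
qed

text \<open>With exponents a + b = 1 on the integrals instead of conjugate norms, one form serves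
  for integrals over the space and for sums over the levels, and only ratios of exponents have to
  lie below 1.\<close>

lemma nn_integral_Holder:
  assumes [measurable]: "G \<in> borel_measurable M" "H \<in> borel_measurable M"
    and ab: "0 < a" "0 < b" "a + b = 1"
  shows "(\<integral>\<^sup>+x. enn_powr (G x) a * enn_powr (H x) b \<partial>M)
    \<le> enn_powr (\<integral>\<^sup>+x. G x \<partial>M) a * enn_powr (\<integral>\<^sup>+x. H x \<partial>M) b"
    (is "?L \<le> enn_powr ?X a * enn_powr ?Y b")
proof -
  consider "?X = 0 \<or> ?Y = 0" | "?X \<noteq> 0" "?Y \<noteq> 0" "?X = top \<or> ?Y = top"
    | "?X \<noteq> 0" "?Y \<noteq> 0" "?X \<noteq> top" "?Y \<noteq> top" by blast
  then show ?thesis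
  proof cases
    \<comment> \<open>A vanishing integral makes one factor vanish almost everywhere, and 0 *
      infinity = 0 disposes of the other.\<close>
    case 1
    then have "(AE x in M. G x = 0) \<or> (AE x in M. H x = 0)"
      by (auto simp: nn_integral_0_iff_AE)
    then have "AE x in M. enn_powr (G x) a * enn_powr (H x) b = 0" by auto
    then have "?L = 0" by (subst nn_integral_0_iff_AE) auto
    then show ?thesis by simp
  next
    case 2
    then show ?thesis by (auto simp: ennreal_top_mult ennreal_mult_top)
  next
    case 3
    then obtain x y where xy: "?X = ennreal x" "?Y = ennreal y" "0 < x" "0 < y"
      by (metis ennreal_cases ennreal_0 less_eq_real_def)
    have "?L \<le> (\<integral>\<^sup>+z. ennreal (x powr a * y powr b) *
        (ennreal (a / x) * G z + ennreal (b / y) * H z) \<partial>M)"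
      by (intro nn_integral_mono enn_powr_mult_le_Young ab xy)
    also have "\<dots> = ennreal (x powr a * y powr b) * (ennreal (a / x) * ?X + ennreal (b / y) * ?Y)"
      by (simp add: nn_integral_cmult nn_integral_add)
    also have "\<dots> = ennreal (x powr a * y powr b)"
      using xy ab by (simp flip: ennreal_mult ennreal_plus)
    also have "\<dots> = enn_powr ?X a * enn_powr ?Y b"
      using xy by (simp add: enn_powr_ennreal ennreal_mult)
    finally show ?thesis .
  qed
qed

section \<open>Sums over the integers: geometric tails and Hardy's inequality\<close>

lemma ennreal_geometric:
  assumes "0 < d"
  shows "(\<integral>\<^sup>+j\<in>{k..}. ennreal (2 powr (- (d * real_of_int j))) \<partial>count_space UNIV)
    = ennreal (1 / (1 - 2 powr (- d))) * ennreal (2 powr (- (d * k)))"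
    (is "?L = _")
proof -
  have "?L = (\<integral>\<^sup>+j. ennreal (2 powr (- (d * real_of_int j))) \<partial>count_space {k..})"
    by (simp add: nn_integral_count_space_indicator)
  also have "\<dots> = (\<integral>\<^sup>+n. ennreal (2 powr (- (d * real_of_int (k + int n)))) \<partial>count_space UNIV)"
    by (rule nn_integral_bij_count_space[symmetric])
      (auto simp: bij_betw_def inj_on_def image_iff intro!: exI[of _ "nat (_ - k)"])
  also have "\<dots> = (\<Sum>n. ennreal ((2 powr (- d)) ^ n * 2 powr (- (d * k))))"
    by (simp add: nn_integral_count_space_nat powr_power algebra_simps flip: powr_add)
  also have "\<dots> = (\<Sum>n. ennreal ((2 powr (- d)) ^ n) * ennreal (2 powr (- (d * k))))"
    by (simp add: ennreal_mult)
  also have "\<dots> = (\<Sum>n. ennreal ((2 powr (- d)) ^ n)) * ennreal (2 powr (- (d * k)))"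
    by simp
  also have "(\<Sum>n. ennreal ((2 powr (- d)) ^ n)) = ennreal (1 / (1 - 2 powr (- d)))"
    using assms by (intro suminf_ennreal_eq geometric_sums) (auto simp: powr_minus_divide)
  finally show ?thesis .
qed

text \<open>Geometric growth of the weight lets a tail sum cost no more than its terms. The constant
  is obtained before \<open>a\<close> is given, so it depends on \<open>m\<close> alone, as
  uniformity in \<omega> demands.\<close>

lemma discrete_Hardy:
  assumes m: "0 < m"
  obtains C :: real where "0 < C"
    "\<And>a :: int \<Rightarrow> ennreal. (\<integral>\<^sup>+k. ennreal (2 powr k) *
        enn_powr (\<integral>\<^sup>+j\<in>{k..}. a j \<partial>count_space UNIV) m \<partial>count_space UNIV)
      \<le> ennreal C * (\<integral>\<^sup>+k. ennreal (2 powr k) * enn_powr (a k) m \<partial>count_space UNIV)"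
proof -
  \<comment> \<open>The weight 2^j is split evenly. One factor 2^(j/2), after an m-th root, is the
    decay 2^(-d j) that makes the inner sum geometric, with constant \<open>C1\<close>. The factor
    2^(k/2) left over from 2^k sums over k \<le> j to \<open>C2\<close> times 2^(j/2).\<close>
  define d where "d = 1 / (2 * m)"
  define C1 where "C1 = (1 / (1 - 2 powr (- d))) powr m"
  define C2 :: real where "C2 = 1 / (1 - 2 powr (- (1/2)))"
  have d: "0 < d" using m by (simp add: d_def)
  have "2 powr (- d) < 1" using d by (simp add: powr_minus_divide)
  then have C1: "0 < C1" using d by (simp add: C1_def)
  have "2 powr (- (1/2)::real) < 1" by (simp add: powr_minus_divide)
  then have C2: "0 < C2" by (simp add: C2_def)
  show thesis
  proof (rule that[of "C1 * C2"])
    show "0 < C1 * C2" using C1 C2 by simp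
    fix a :: "int \<Rightarrow> ennreal"
    define T where "T k = (\<integral>\<^sup>+j\<in>{k..}. ennreal (2 powr (j / 2)) * enn_powr (a j) m \<partial>count_space UNIV)"
      for k :: int
    \<comment> \<open>the weighted tail sum \<open>T k\<close> dominates each later \<open>a j\<close>, which settles all exponents
      \<open>m > 0\<close> without distinguishing \<open>m \<le> 1\<close> and \<open>m > 1\<close>\<close>
    have a_le: "a j \<le> ennreal (2 powr (- (d * j))) * enn_powr (T k) (1 / m)" if "k \<le> j" for j k
    proof -
      have "ennreal (2 powr (j / 2)) * enn_powr (a j) m
          = (\<integral>\<^sup>+i. ennreal (2 powr (i / 2)) * enn_powr (a i) m * indicator {j} i \<partial>count_space UNIV)"
        by (subst nn_integral_count_space'[of "{j}"]) auto
      also have "\<dots> \<le> T k"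
        unfolding T_def using that by (intro nn_integral_mono) (auto split: split_indicator)
      finally have "ennreal (2 powr (- (j / 2))) * (ennreal (2 powr (j / 2)) * enn_powr (a j) m)
          \<le> ennreal (2 powr (- (j / 2))) * T k"
        by (rule mult_left_mono) simp
      then have "enn_powr (a j) m \<le> ennreal (2 powr (- (j / 2))) * T k"
        by (simp add: mult.assoc[symmetric] flip: ennreal_mult powr_add)
      then have "a j \<le> enn_powr (ennreal (2 powr (- (j / 2))) * T k) (1 / m)"
        using m by (simp add: enn_powr_le_swap)
      then show ?thesis
        using m by (simp add: enn_powr_mult enn_powr_ennreal powr_powr d_def field_simps)
    qed
    have inner: "enn_powr (\<integral>\<^sup>+j\<in>{k..}. a j \<partial>count_space UNIV) m
        \<le> ennreal C1 * ennreal (2 powr (- (k / 2))) * T k" for k :: int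
    proof -
      have "(\<integral>\<^sup>+j\<in>{k..}. a j \<partial>count_space UNIV) \<le>
          (\<integral>\<^sup>+j. ennreal (2 powr (- (d * j))) * indicator {k..} j * enn_powr (T k) (1 / m) \<partial>count_space UNIV)"
        by (intro nn_integral_mono) (auto split: split_indicator intro: a_le)
      also have "\<dots> = ennreal (1 / (1 - 2 powr (- d))) * ennreal (2 powr (- (d * k))) * enn_powr (T k) (1 / m)"
        by (simp add: nn_integral_multc ennreal_geometric[OF d])
      finally have "enn_powr (\<integral>\<^sup>+j\<in>{k..}. a j \<partial>count_space UNIV) m \<le>
         enn_powr (ennreal (1 / (1 - 2 powr (- d))) * ennreal (2 powr (- (d * k))) * enn_powr (T k) (1 / m)) m"
        using m by (intro enn_powr_mono) auto
      also have "\<dots> = ennreal C1 * ennreal (2 powr (- (k / 2))) * T k"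
        using m \<open>2 powr (- d) < 1\<close>
        by (simp add: enn_powr_mult enn_powr_inv enn_powr_ennreal powr_powr C1_def d_def)
      finally show ?thesis .
    qed
    have "(\<integral>\<^sup>+k. ennreal (2 powr k) *
        enn_powr (\<integral>\<^sup>+j\<in>{k..}. a j \<partial>count_space UNIV) m \<partial>count_space UNIV)
      \<le> (\<integral>\<^sup>+k. ennreal (2 powr real_of_int k) *
        (ennreal C1 * ennreal (2 powr (- (k / 2))) * T k) \<partial>count_space UNIV)"
      by (intro nn_integral_mono mult_left_mono inner) auto
    also have "\<dots> = (\<integral>\<^sup>+k. ennreal C1 * (ennreal (2 powr (real_of_int k / 2)) * T k) \<partial>count_space UNIV)"
    proof (intro nn_integral_cong)
      fix k :: int
      have "ennreal (2 powr real_of_int k) * ennreal (2 powr (- (k / 2))) = ennreal (2 powr (real_of_int k / 2))"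
        by (simp flip: ennreal_mult powr_add)
      then show "ennreal (2 powr real_of_int k) * (ennreal C1 * ennreal (2 powr (- (k / 2))) * T k)
        = ennreal C1 * (ennreal (2 powr (real_of_int k / 2)) * T k)"
        by (metis mult.assoc mult.commute)
    qed
    also have "\<dots> = ennreal C1 * (\<integral>\<^sup>+k. \<integral>\<^sup>+j. ennreal (2 powr (real_of_int k / 2)) *
        (ennreal (2 powr (real_of_int j / 2)) * enn_powr (a j) m * indicator {k..} j) \<partial>count_space UNIV \<partial>count_space UNIV)"
      by (simp add: nn_integral_cmult T_def)
    also have "\<dots> = ennreal C1 * (\<integral>\<^sup>+j. \<integral>\<^sup>+k. ennreal (2 powr (real_of_int k / 2)) *
        (ennreal (2 powr (real_of_int j / 2)) * enn_powr (a j) m * indicator {k..} j) \<partial>count_space UNIV \<partial>count_space UNIV)"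
      by (subst nn_integral_count_space_nn_integral) auto
    also have "\<dots> = ennreal C1 * (\<integral>\<^sup>+j. ennreal C2 * (ennreal (2 powr j) * enn_powr (a j) m) \<partial>count_space UNIV)"
    proof (intro arg_cong[where f = "\<lambda>x. ennreal C1 * x"] nn_integral_cong)
      fix j :: int
      have "(\<integral>\<^sup>+k. ennreal (2 powr (real_of_int k / 2)) *
          (ennreal (2 powr (real_of_int j / 2)) * enn_powr (a j) m * indicator {k..} j) \<partial>count_space UNIV)
        = (\<integral>\<^sup>+k. ennreal (2 powr (real_of_int k / 2)) * indicator {..j} k *
          (ennreal (2 powr (real_of_int j / 2)) * enn_powr (a j) m) \<partial>count_space UNIV)"
        by (intro nn_integral_cong) (auto split: split_indicator)
      also have "\<dots> = (\<integral>\<^sup>+k. ennreal (2 powr (real_of_int k / 2)) * indicator {..j} k \<partial>count_space UNIV) *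
          (ennreal (2 powr (real_of_int j / 2)) * enn_powr (a j) m)"
        by (simp add: nn_integral_multc)
      also have "(\<integral>\<^sup>+k. ennreal (2 powr (real_of_int k / 2)) * indicator {..j} k \<partial>count_space UNIV)
          = (\<integral>\<^sup>+k. ennreal (2 powr (real_of_int k / 2)) \<partial>count_space {..j})"
        by (simp add: nn_integral_count_space_indicator)
      \<comment> \<open>The reflection of k to -k turns the sum over k \<le> j into a geometric tail
        starting at -j.\<close>
      also have "\<dots> = (\<integral>\<^sup>+k. ennreal (2 powr (real_of_int (- k) / 2)) \<partial>count_space {- j..})"
        by (rule nn_integral_bij_count_space[symmetric])
          (auto simp: bij_betw_def inj_on_def image_iff intro!: exI[of _ "- _"])
      also have "\<dots> = (\<integral>\<^sup>+k\<in>{- j..}. ennreal (2 powr (- (1 / 2 * real_of_int k))) \<partial>count_space UNIV)"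
        by (simp add: nn_integral_count_space_indicator)
      also have "\<dots> = ennreal C2 * ennreal (2 powr (j / 2))"
        by (subst ennreal_geometric) (auto simp: C2_def)
      also have "\<dots> * (ennreal (2 powr (real_of_int j / 2)) * enn_powr (a j) m) =
          ennreal C2 * (ennreal (2 powr (j / 2)) * ennreal (2 powr (real_of_int j / 2)) * enn_powr (a j) m)"
        by (simp add: mult.assoc)
      also have "ennreal (2 powr (j / 2)) * ennreal (2 powr (real_of_int j / 2)) = ennreal (2 powr j)"
        by (simp flip: ennreal_mult powr_add)
      finally show "(\<integral>\<^sup>+k. ennreal (2 powr (real_of_int k / 2)) *
          (ennreal (2 powr (real_of_int j / 2)) * enn_powr (a j) m * indicator {k..} j) \<partial>count_space UNIV)
        = ennreal C2 * (ennreal (2 powr j) * enn_powr (a j) m)" .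
    qed
    also have "\<dots> = ennreal (C1 * C2) * (\<integral>\<^sup>+k. ennreal (2 powr real_of_int k) * enn_powr (a k) m \<partial>count_space UNIV)"
      using C1 C2 by (simp add: nn_integral_cmult ennreal_mult mult.assoc)
    finally show "(\<integral>\<^sup>+k. ennreal (2 powr k) *
        enn_powr (\<integral>\<^sup>+j\<in>{k..}. a j \<partial>count_space UNIV) m \<partial>count_space UNIV)
      \<le> ennreal (C1 * C2) * (\<integral>\<^sup>+k. ennreal (2 powr k) * enn_powr (a k) m \<partial>count_space UNIV)" .
  qed
qed

section \<open>Weighted norms\<close>

lemma ess_sup_on_leI: "(AE x in M. x \<in> A \<longrightarrow> g x \<le> C) \<Longrightarrow> ess_sup_on M A g \<le> C"
  unfolding ess_sup_on_def by (rule Inf_lower) simp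

text \<open>The infimum of all essential bounds is already the infimum of countably many of them,
  and countably many exceptional null sets have a null union; so the infimum is itself an essential
  bound.\<close>

lemma AE_le_ess_sup_on: "AE x in M. x \<in> A \<longrightarrow> g x \<le> ess_sup_on M A g"
proof -
  let ?S = "{C. AE x in M. x \<in> A \<longrightarrow> g x \<le> C}"
  have "top \<in> ?S" by simp
  then have "?S \<noteq> {}" by blast
  then obtain f :: "nat \<Rightarrow> ennreal" where f: "range f \<subseteq> ?S" "Inf ?S = (INF i. f i)"
    using ennreal_Inf_countable_INF[of ?S] by blast
  then have "AE x in M. x \<in> A \<longrightarrow> g x \<le> f i" for i
    by auto
  then have "AE x in M. \<forall>i. x \<in> A \<longrightarrow> g x \<le> f i"
    by (subst AE_all_countable) (rule allI)
  then show ?thesis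
    unfolding ess_sup_on_def f(2) by eventually_elim (auto intro: INF_greatest)
qed

lemma wnorm_ereal: "wnorm M (ereal p) A w f =
    enn_powr (\<integral>\<^sup>+x\<in>A. enn_powr (f x) p * w x \<partial>M) (1 / p)"
  by (simp add: wnorm_def)

lemma wnorm_infinity: "wnorm M \<infinity> A w f = ess_sup_on M A (\<lambda>x. f x * w x)"
  by (simp add: wnorm_def)

lemma unorm_ereal: "unorm M (ereal p) A f = enn_powr (\<integral>\<^sup>+x\<in>A. enn_powr (f x) p \<partial>M) (1 / p)"
  by (simp add: unorm_def wnorm_ereal)

lemma unorm_infinity: "unorm M \<infinity> A f = ess_sup_on M A f"
  by (simp add: unorm_def wnorm_infinity)

lemma pos_ereal_cases:
  assumes "0 < (p::ereal)"
  obtains (real) q where "p = ereal q" "0 < q" | (infinity) "p = \<infinity>"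
  using assms by (cases p) auto

lemma wnorm_mono:
  assumes "0 < p" "AE x in M. x \<in> A \<longrightarrow> x \<in> B \<and> f x \<le> g x"
  shows "wnorm M p A w f \<le> wnorm M p B w g"
  using assms(1)
proof (cases p rule: pos_ereal_cases)
  case (real q)
  have "AE x in M. enn_powr (f x) q * w x * indicator A x \<le> enn_powr (g x) q * w x * indicator B x"
    using assms(2) by eventually_elim
      (use real in \<open>auto split: split_indicator intro!: mult_right_mono enn_powr_mono\<close>)
  then show ?thesis unfolding real wnorm_ereal
    using real by (intro enn_powr_mono nn_integral_mono_AE) auto
next
  case infinity
  have "AE x in M. x \<in> A \<longrightarrow> f x * w x \<le> ess_sup_on M B (\<lambda>x. g x * w x)"
    using assms(2) AE_le_ess_sup_on[of B "\<lambda>x. g x * w x" M]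
    by eventually_elim (meson mult_right_mono order_trans zero_le)
  then show ?thesis unfolding infinity wnorm_infinity by (rule ess_sup_on_leI)
qed

lemma unorm_mono:
  assumes "0 < p" "AE x in M. x \<in> A \<longrightarrow> x \<in> B \<and> f x \<le> g x"
  shows "unorm M p A f \<le> unorm M p B g"
  using assms unfolding unorm_def by (rule wnorm_mono)

lemma wnorm_zero:
  assumes "0 < p" "AE x in M. x \<in> A \<longrightarrow> f x = 0"
  shows "wnorm M p A w f = 0"
  using assms(1)
proof (cases p rule: pos_ereal_cases)
  case (real q)
  have "AE x in M. enn_powr (f x) q * w x * indicator A x = 0"
    using assms(2) by eventually_elim (auto split: split_indicator)
  then have "(\<integral>\<^sup>+x\<in>A. enn_powr (f x) q * w x \<partial>M) = (\<integral>\<^sup>+x. 0 \<partial>M)"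
    by (rule nn_integral_cong_AE)
  then show ?thesis unfolding real wnorm_ereal by simp
next
  case infinity
  have "ess_sup_on M A (\<lambda>x. f x * w x) \<le> 0"
    using assms(2) by (intro ess_sup_on_leI, eventually_elim) auto
  then show ?thesis unfolding infinity wnorm_infinity by simp
qed

lemma unorm_zero: "0 < p \<Longrightarrow> (AE x in M. x \<in> A \<longrightarrow> f x = 0) \<Longrightarrow> unorm M p A f = 0"
  unfolding unorm_def by (rule wnorm_zero)

lemma unorm_empty [simp]: "0 < p \<Longrightarrow> unorm M p {} f = 0"
  by (rule unorm_zero) auto

text \<open>Covers every \<open>c\<close>, including 0 and infinity, and asks for measurability on
  \<open>A\<close> only, since a weight \<omega> is given on the half line alone.\<close>

lemma unorm_cmult_ge:
  assumes "0 < p" and "(\<lambda>x. g x * indicator A x) \<in> borel_measurable M"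
  shows "c * unorm M p A g \<le> unorm M p A (\<lambda>x. c * g x)"
  using assms(1)
proof (cases p rule: pos_ereal_cases)
  case (real q)
  have "(\<integral>\<^sup>+x\<in>A. enn_powr (c * g x) q \<partial>M) =
      (\<integral>\<^sup>+x. enn_powr c q * enn_powr (g x * indicator A x) q \<partial>M)"
    by (intro nn_integral_cong) (auto simp: enn_powr_mult split: split_indicator)
  also have "\<dots> = enn_powr c q * (\<integral>\<^sup>+x. enn_powr (g x * indicator A x) q \<partial>M)"
    using assms(2) by (intro nn_integral_cmult measurable_enn_powr)
  also have "(\<integral>\<^sup>+x. enn_powr (g x * indicator A x) q \<partial>M) = (\<integral>\<^sup>+x\<in>A. enn_powr (g x) q \<partial>M)"
    by (intro nn_integral_cong) (auto split: split_indicator)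
  finally show ?thesis
    using real by (simp add: unorm_ereal enn_powr_mult enn_powr_inv)
next
  case infinity
  let ?E = "ess_sup_on M A (\<lambda>x. c * g x)"
  have *: "AE x in M. x \<in> A \<longrightarrow> c * g x \<le> ?E" by (rule AE_le_ess_sup_on)
  consider "c = 0" | "?E = top" | "c = top" "?E \<noteq> top" | "c \<noteq> 0" "c \<noteq> top" by blast
  then have "c * ess_sup_on M A g \<le> ?E"
  proof cases
    \<comment> \<open>Where \<open>g\<close> is positive, \<open>top * g x\<close> is infinite; a
      finite essential bound thus forces \<open>g\<close> to vanish almost everywhere on
      \<open>A\<close>.\<close>
    case 3
    have "ess_sup_on M A g \<le> 0"
      using * by (intro ess_sup_on_leI, eventually_elim)
        (use 3 in \<open>auto simp: ennreal_top_mult top_unique split: if_splits\<close>)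
    then show ?thesis by simp
  next
    case 4
    have "ess_sup_on M A g \<le> ?E / c"
      using * by (intro ess_sup_on_leI, eventually_elim)
        (use 4 in \<open>metis divide_right_mono_ennreal mult.commute mult_divide_eq_ennreal\<close>)
    then have "c * ess_sup_on M A g \<le> c * (?E / c)" by (rule mult_left_mono) simp
    also have "\<dots> = ?E" using 4 by (simp add: ennreal_times_divide mult.commute[of c] mult_divide_eq_ennreal)
    finally show ?thesis .
  qed auto
  then show ?thesis unfolding infinity unorm_infinity .
qed

text \<open>This is \<open>unorm_cmult_ge\<close> for the factor \<open>inverse c\<close> and the
  function c g, hence the restriction to \<open>c\<close> different from 0 and infinity.\<close>

lemma unorm_cmult_le:
  assumes "0 < p" "c \<noteq> 0" "c \<noteq> top" and "(\<lambda>x. c * g x * indicator A x) \<in> borel_measurable M"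
  shows "unorm M p A (\<lambda>x. c * g x) \<le> c * unorm M p A g"
proof -
  have "inverse c * unorm M p A (\<lambda>x. c * g x) \<le> unorm M p A (\<lambda>x. inverse c * (c * g x))"
    using assms by (intro unorm_cmult_ge) auto
  also have "(\<lambda>x. inverse c * (c * g x)) = g"
    using assms by (auto simp: mult.assoc[symmetric] ennreal_inverse_mult mult.commute[of "inverse c"]
      divide_ennreal_def[symmetric] top.not_eq_extremum)
  finally have "c * (inverse c * unorm M p A (\<lambda>x. c * g x)) \<le> c * unorm M p A g"
    by (rule mult_left_mono) simp
  then show ?thesis
    using assms by (simp add: mult.assoc[symmetric] divide_ennreal_def[symmetric] top.not_eq_extremum)
qed

text \<open>Continuity from below, for two purposes: exhausting a set by bounded truncations, and
  letting the radius of a complement of a ball decrease to its limit.\<close>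

lemma unorm_UN:
  assumes p: "0 < p" and A: "incseq A" "\<And>n. A n \<in> sets M" and f: "f \<in> borel_measurable M"
  shows "unorm M p (\<Union>n. A n) f = (SUP n::nat. unorm M p (A n) f)"
  using p
proof (cases p rule: pos_ereal_cases)
  case (real q)
  note [measurable] = A(2) f
  have "indicator (\<Union>n. A n) x = (SUP n. indicator (A n) x :: ennreal)" for x
  proof (cases "x \<in> (\<Union>n. A n)")
    case True
    then obtain n where "x \<in> A n" by blast
    then have "1 \<le> (SUP n. indicator (A n) x :: ennreal)"
      by (intro SUP_upper2[of n]) auto
    with True show ?thesis
      by (intro antisym SUP_least) (auto split: split_indicator)
  qed (simp add: SUP_eq_const)
  then have "enn_powr (f x) q * indicator (\<Union>n. A n) x = (SUP n. enn_powr (f x) q * indicator (A n) x)" for x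
    by (simp add: SUP_mult_left_ennreal)
  then have "(\<integral>\<^sup>+x\<in>(\<Union>n. A n). enn_powr (f x) q \<partial>M) = (\<integral>\<^sup>+x. (SUP n. enn_powr (f x) q * indicator (A n) x) \<partial>M)"
    by simp
  also have "\<dots> = (SUP n. \<integral>\<^sup>+x\<in>A n. enn_powr (f x) q \<partial>M)"
    using A(1) by (intro nn_integral_monotone_convergence_SUP)
      (auto simp: incseq_def le_fun_def split: split_indicator)
  finally show ?thesis unfolding real unorm_ereal using real by (simp add: enn_powr_SUP)
next
  case infinity
  show ?thesis unfolding infinity unorm_infinity
  proof (rule antisym)
    have "AE x in M. \<forall>n. x \<in> A n \<longrightarrow> f x \<le> ess_sup_on M (A n) f"
      by (subst AE_all_countable) (simp add: AE_le_ess_sup_on)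
    then show "ess_sup_on M (\<Union>n. A n) f \<le> (SUP n. ess_sup_on M (A n) f)"
      by (intro ess_sup_on_leI, eventually_elim) (auto intro: SUP_upper2)
    show "(SUP n. ess_sup_on M (A n) f) \<le> ess_sup_on M (\<Union>n. A n) f"
      using unorm_mono[of \<infinity> _ "\<Union>n. A n" f f M]
      by (auto intro!: SUP_least simp: unorm_infinity)
  qed
qed

section \<open>Complements of balls\<close>

lemma cball0_sets [measurable]: "cball0 r \<in> sets lebesgue"
proof -
  have "closed (cball0 r)" unfolding cball0_def by (simp add: closed_Compl Diff_eq)
  then show ?thesis
    by (metis borel_closed sets_completionI_sets sets_lborel)
qed

lemma in_cball0_iff: "x \<in> cball0 r \<longleftrightarrow> r \<le> norm x"
  by (auto simp: cball0_def)

lemma cball0_mono: "r \<le> t \<Longrightarrow> cball0 t \<subseteq> cball0 r"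
  by (auto simp: in_cball0_iff)

text \<open>The complements of the larger balls exhaust the complement of the closed ball of radius
  r, which differs from \<open>cball0 r\<close> by a sphere, a null set. Right continuity permits
  moving a radius slightly outwards when \<theta> = \<infinity>.\<close>

lemma unorm_cball0_right_continuous:
  fixes f :: "'a::euclidean_space \<Rightarrow> ennreal"
  assumes p: "0 < p" and f: "f \<in> borel_measurable lebesgue"
  shows "unorm lebesgue p (cball0 r) f = (SUP n. unorm lebesgue p (cball0 (r + 1 / Suc n)) f)"
proof -
  have eq: "(\<Union>n. cball0 (r + 1 / Suc n)) = {x::'a. r < norm x}"
  proof (safe; clarsimp simp: in_cball0_iff)
    fix x :: 'a
    { fix n assume "r + 1 / (1 + real n) \<le> norm x"
      moreover have "0 < 1 / (1 + real n)" by simp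
      ultimately show "r < norm x" by linarith }
    assume "r < norm x"
    then obtain n where "inverse (real (Suc n)) < norm x - r"
      using reals_Archimedean[of "norm x - r"] by auto
    then show "\<exists>n. r + 1 / (1 + real n) \<le> norm x"
      by (intro exI[of _ n]) (simp add: inverse_eq_divide)
  qed
  have "sphere (0::'a) r \<in> null_sets lebesgue"
    using negligible_sphere negligible_iff_null_sets by blast
  then have "AE x in lebesgue. x \<notin> sphere (0::'a) r" by (rule AE_not_in)
  then have "AE x in lebesgue. x \<in> cball0 r \<longrightarrow> x \<in> {x::'a. r < norm x} \<and> f x \<le> f x"
    by eventually_elim (auto simp: in_cball0_iff)
  then have "unorm lebesgue p (cball0 r) f \<le> unorm lebesgue p {x. r < norm x} f"
    using p by (intro unorm_mono)
  also have "\<dots> = (SUP n. unorm lebesgue p (cball0 (r + 1 / Suc n)) f)"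
    unfolding eq[symmetric] by (intro unorm_UN p f)
     (auto simp: incseq_def intro!: cball0_mono frac_le)
  finally show ?thesis
    using p by (intro antisym SUP_least unorm_mono) (auto simp: in_cball0_iff intro!: AE_I2 elim!: order_trans[rotated])
qed

section \<open>The operator norm of the identity\<close>

lemma Lp_norm_eq_0_iff:
  assumes "0 < p" "v \<in> Wset" and [measurable]: "f \<in> borel_measurable lebesgue"
  shows "Lp_norm p v f = 0 \<longleftrightarrow> (AE x in lebesgue. f x = 0)"
proof
  assume *: "Lp_norm p v f = 0"
  have [measurable]: "v \<in> borel_measurable lebesgue" and v: "AE x in lebesgue. 0 < v x"
    using assms(2) by (auto simp: Wset_def)
  from assms(1) have "AE x in lebesgue. ennreal \<bar>f x\<bar> * ennreal (v x) = 0"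
  proof (cases p rule: pos_ereal_cases)
    case (real q)
    then have "AE x in lebesgue. enn_powr (ennreal \<bar>f x\<bar>) q * ennreal (v x) = 0"
      using * by (simp add: Lp_norm_def wnorm_ereal nn_integral_0_iff_AE)
    then show ?thesis by eventually_elim auto
  next
    case infinity
    then show ?thesis
      using * AE_le_ess_sup_on[of UNIV "\<lambda>x. ennreal \<bar>f x\<bar> * ennreal (v x)" lebesgue]
      by (simp add: Lp_norm_def wnorm_infinity)
  qed
  with v show "AE x in lebesgue. f x = 0"
    by eventually_elim (auto simp: ennreal_eq_0_iff)
qed (use assms(1) in \<open>auto simp: Lp_norm_def intro!: wnorm_zero\<close>)

lemma Id_norm_leI:
  assumes "0 < p1" "v1 \<in> Wset"
    and le: "\<And>f. f \<in> borel_measurable lebesgue \<Longrightarrow> 0 < Lp_norm p1 v1 f \<Longrightarrow> Lp_norm p1 v1 f < \<infinity> \<Longrightarrow>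
      cLM_norm p2 \<theta> \<omega> v2 f \<le> K * Lp_norm p1 v1 f"
  shows "Id_norm p1 v1 p2 \<theta> \<omega> v2 \<le> K"
  unfolding Id_norm_def
proof (rule SUP_least, clarify)
  fix f :: "'a \<Rightarrow> real"
  assume f: "f \<in> borel_measurable lebesgue" "Lp_norm p1 v1 f < \<infinity>" "\<not> (AE x in lebesgue. f x = 0)"
  then have pos: "0 < Lp_norm p1 v1 f"
    using Lp_norm_eq_0_iff[OF assms(1,2) f(1)] by (simp add: zero_less_iff_neq_zero)
  with le[OF f(1) pos f(2)] show "cLM_norm p2 \<theta> \<omega> v2 f / Lp_norm p1 v1 f \<le> K"
    by (intro divide_le_posI_ennreal) (simp_all add: mult.commute)
qed

text \<open>Also covers functions vanishing almost everywhere, which the supremum in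
  \<open>Id_norm\<close> omits: there the left side is 0. For the others the norm is neither 0 nor
  infinite, so the quotient can be cleared.\<close>

lemma cLM_norm_le_Id_norm:
  fixes v1 v2 f :: "'a::euclidean_space \<Rightarrow> real"
  assumes "0 < p1" "0 < p2" "0 < \<theta>" "v1 \<in> Wset"
    and f: "f \<in> borel_measurable lebesgue" "Lp_norm p1 v1 f < \<infinity>"
  shows "cLM_norm p2 \<theta> \<omega> v2 f \<le> Id_norm p1 v1 p2 \<theta> \<omega> v2 * Lp_norm p1 v1 f"
proof (cases "AE x in lebesgue. f x = 0")
  case True
  have "wnorm lebesgue p2 A (\<lambda>x. ennreal (v2 x)) (\<lambda>x. ennreal \<bar>f x\<bar>) = 0" for A
    using True by (intro wnorm_zero assms) auto
  then have "cLM_norm p2 \<theta> \<omega> v2 f = 0"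
    using assms(3) by (simp add: cLM_norm_def unorm_zero)
  then show ?thesis by simp
next
  case False
  then have nz: "Lp_norm p1 v1 f \<noteq> 0"
    using Lp_norm_eq_0_iff[OF assms(1,4) f(1)] by simp
  have "cLM_norm p2 \<theta> \<omega> v2 f / Lp_norm p1 v1 f \<le> Id_norm p1 v1 p2 \<theta> \<omega> v2"
    unfolding Id_norm_def by (rule SUP_upper) (use f False in auto)
  then have "cLM_norm p2 \<theta> \<omega> v2 f / Lp_norm p1 v1 f * Lp_norm p1 v1 f
      \<le> Id_norm p1 v1 p2 \<theta> \<omega> v2 * Lp_norm p1 v1 f"
    by (rule mult_right_mono) simp
  then show ?thesis
    using nz f(2) by (simp add: ennreal_divide_times top.not_eq_extremum)
qed

section \<open>Uniform equivalence and measurability of radial weights\<close>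

lemma unif_equivI:
  assumes "0 < C" "0 < D" "\<And>\<omega>. S \<omega> \<Longrightarrow> A \<omega> \<le> ennreal C * B \<omega>" "\<And>\<omega>. S \<omega> \<Longrightarrow> B \<omega> \<le> ennreal D * A \<omega>"
  shows "unif_equiv S A B"
  unfolding unif_equiv_def
\<comment> \<open>The minimum with \<open>D\<close> secures \<open>c \<le> C\<close> in
  \<open>unif_equiv\<close>.\<close>
proof (rule exI[of _ "min (1 / C) D"], rule exI[of _ D], intro conjI allI impI)
  fix \<omega> assume S: "S \<omega>"
  have "ennreal (min (1 / C) D) * A \<omega> \<le> ennreal (1 / C) * (ennreal C * B \<omega>)"
    by (intro mult_mono ennreal_leI assms S) auto
  also have "\<dots> = B \<omega>"
    using assms(1) by (simp add: mult.assoc[symmetric] flip: ennreal_mult)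
  finally show "ennreal (min (1 / C) D) * A \<omega> \<le> B \<omega>" .
qed (use assms in auto)

lemma cOmega_measurable:
  assumes "\<omega> \<in> cOmega \<theta>" "A \<in> sets lebesgue" "A \<subseteq> {0<..}"
  shows "(\<lambda>s. ennreal (\<omega> s) * indicator A s) \<in> borel_measurable lebesgue"
proof -
  have "\<omega> \<in> borel_measurable (restrict_space lebesgue {0<..})"
    using assms(1) by (auto simp: cOmega_def)
  then have "(\<lambda>s. ennreal (\<omega> s)) \<in> borel_measurable (restrict_space lebesgue {0<..})"
    by (rule measurable_compose[OF _ measurable_ennreal])
  then have [measurable]: "(\<lambda>s. ennreal (\<omega> s) * indicator {0<..} s) \<in> borel_measurable lebesgue"
    by (subst (asm) borel_measurable_restrict_space_iff_ennreal) auto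
  have "(\<lambda>s. ennreal (\<omega> s) * indicator {0<..} s * indicator A s) \<in> borel_measurable lebesgue"
    using assms(2) by measurable
  also have "(\<lambda>s. ennreal (\<omega> s) * indicator {0<..} s * indicator A s) = (\<lambda>s. ennreal (\<omega> s) * indicator A s)"
    using assms(3) by (intro ext) (auto simp: indicator_def)
  finally show ?thesis .
qed

text \<open>Superlevel sets of a decreasing function are intervals. The application is to V(cball0
  t) as a function of t.\<close>

lemma borel_measurable_antimono_ennreal:
  fixes h :: "real \<Rightarrow> ennreal"
  assumes "antimono h"
  shows "h \<in> borel_measurable lebesgue"
proof -
  have "h \<in> borel_measurable borel"
  proof (rule borel_measurableI_greater)
    fix y
    have "is_interval {x. y < h x}"
      unfolding is_interval_1 using assms by (auto simp: antimono_def intro: less_le_trans)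
    then show "{x \<in> space borel. y < h x} \<in> sets borel"
      by (simp add: is_interval_convex_1[symmetric] real_interval_borel_measurable)
  qed
  then show ?thesis
    by (simp add: measurable_completion)
qed

section \<open>Weights with sharp Hoelder inequality\<close>

text \<open>Interface between the weights and the operator norm. The instances are s = p1 p2 / (p1 -
  p2) for p2 < p1 < \<infinity>, s = \<infinity> for p1 = p2 < \<infinity>, and s = p2 for p1 =
  \<infinity>, with \<open>u\<close> the quotient weight of the respective case. Sharpness is stated
  through numbers c below the bound, because the bound may be infinite and extremal functions need
  not exist.\<close>

locale sharp_Holder =
  fixes p1 p2 s :: ereal and v1 v2 u :: "'a::euclidean_space \<Rightarrow> real"
  assumes pos: "0 < p1" "0 < p2" "0 < s"
    and v1: "v1 \<in> Wset" and v2: "v2 \<in> Wset"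
    and u_measurable [measurable]: "u \<in> borel_measurable lebesgue"
    and Holder: "\<And>f A. f \<in> borel_measurable lebesgue \<Longrightarrow> Lp_norm p1 v1 f < \<infinity> \<Longrightarrow> A \<in> sets lebesgue \<Longrightarrow>
      wnorm lebesgue p2 A (\<lambda>x. ennreal (v2 x)) (\<lambda>x. ennreal \<bar>f x\<bar>)
        \<le> Lp_norm p1 v1 f * unorm lebesgue s A (\<lambda>x. ennreal (u x))"
    and sharp: "\<And>A c. A \<in> sets lebesgue \<Longrightarrow> c < unorm lebesgue s A (\<lambda>x. ennreal (u x)) \<Longrightarrow>
      \<exists>f \<in> borel_measurable lebesgue. Lp_norm p1 v1 f \<le> 1 \<and>
        c \<le> wnorm lebesgue p2 A (\<lambda>x. ennreal (v2 x)) (\<lambda>x. ennreal \<bar>f x\<bar>)"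
begin

abbreviation N :: "'a set \<Rightarrow> ('a \<Rightarrow> real) \<Rightarrow> ennreal" where
  "N A f \<equiv> wnorm lebesgue p2 A (\<lambda>x. ennreal (v2 x)) (\<lambda>x. ennreal \<bar>f x\<bar>)"

abbreviation V :: "'a set \<Rightarrow> ennreal" where
  "V A \<equiv> unorm lebesgue s A (\<lambda>x. ennreal (u x))"

abbreviation W :: "ereal \<Rightarrow> (real \<Rightarrow> real) \<Rightarrow> real \<Rightarrow> ennreal" where
  "W \<theta> \<omega> t \<equiv> unorm lebesgue \<theta> {0<..<t} (\<lambda>s. ennreal (\<omega> s))"

lemma v1_measurable [measurable]: "v1 \<in> borel_measurable lebesgue"
  and v2_measurable [measurable]: "v2 \<in> borel_measurable lebesgue"
  using v1 v2 by (auto simp: Wset_def)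

lemma N_mono: "A \<subseteq> B \<Longrightarrow> N A f \<le> N B f"
  by (intro wnorm_mono pos) auto

lemma V_mono: "A \<subseteq> B \<Longrightarrow> V A \<le> V B"
  by (intro unorm_mono pos) auto

text \<open>For r < t the norm over \<open>cball0 r\<close> is at least the one over
  \<open>cball0 t\<close>, which is a constant factor in the outer norm restricted to (0,t).\<close>

lemma W_times_N_le_cLM_norm:
  assumes "0 < \<theta>" "\<omega> \<in> cOmega \<theta>"
  shows "W \<theta> \<omega> t * N (cball0 t) f \<le> cLM_norm p2 \<theta> \<omega> v2 f"
proof -
  have "N (cball0 t) f * W \<theta> \<omega> t \<le> unorm lebesgue \<theta> {0<..<t} (\<lambda>r. N (cball0 t) f * ennreal (\<omega> r))"
    by (intro unorm_cmult_ge assms cOmega_measurable[OF assms(2)]) auto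
  also have "\<dots> \<le> unorm lebesgue \<theta> {0<..} (\<lambda>r. ennreal (\<omega> r) * N (cball0 r) f)"
  proof (intro unorm_mono assms AE_I2 impI conjI)
    fix r assume "r \<in> {0<..<t}"
    then have "N (cball0 t) f \<le> N (cball0 r) f"
      by (intro N_mono cball0_mono) auto
    then show "N (cball0 t) f * ennreal (\<omega> r) \<le> ennreal (\<omega> r) * N (cball0 r) f"
      by (simp add: mult.commute mult_left_mono)
  qed auto
  finally show ?thesis
    by (simp add: cLM_norm_def mult.commute)
qed

lemma W_times_V_le_Id_norm:
  assumes "0 < \<theta>" "\<omega> \<in> cOmega \<theta>"
  shows "W \<theta> \<omega> t * V (cball0 t) \<le> Id_norm p1 v1 p2 \<theta> \<omega> v2"
proof -
  have "W \<theta> \<omega> t * c \<le> Id_norm p1 v1 p2 \<theta> \<omega> v2" if c: "c < V (cball0 t)" for c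
  proof -
    obtain f where f: "f \<in> borel_measurable lebesgue" "Lp_norm p1 v1 f \<le> 1" "c \<le> N (cball0 t) f"
      using sharp[OF cball0_sets c] by blast
    have "W \<theta> \<omega> t * c \<le> W \<theta> \<omega> t * N (cball0 t) f"
      using f(3) by (rule mult_left_mono) simp
    also have "\<dots> \<le> cLM_norm p2 \<theta> \<omega> v2 f"
      by (rule W_times_N_le_cLM_norm) fact+
    also have "\<dots> \<le> Id_norm p1 v1 p2 \<theta> \<omega> v2 * Lp_norm p1 v1 f"
      using f(2) by (intro cLM_norm_le_Id_norm pos assms v1 f(1)) (auto simp: order_le_less_trans)
    also have "\<dots> \<le> Id_norm p1 v1 p2 \<theta> \<omega> v2 * 1"
      using f(2) by (rule mult_left_mono) simp
    finally show ?thesis by simp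
  qed
  then have "(SUP c\<in>{..<V (cball0 t)}. W \<theta> \<omega> t * c) \<le> Id_norm p1 v1 p2 \<theta> \<omega> v2"
    by (intro SUP_least) auto
  \<comment> \<open>Letting c increase to V recovers the product also when V is infinite; when V = 0
    the index set is empty and both sides are 0.\<close>
  also have "(SUP c\<in>{..<V (cball0 t)}. W \<theta> \<omega> t * c) = W \<theta> \<omega> t * V (cball0 t)"
    by (simp add: SUP_mult_left_ennreal[symmetric])
  finally show ?thesis .
qed

text \<open>Both inequalities hold with constant 1. The upper one needs \<omega>(r) \<le> W(t) for
  almost every r and some t slightly above r, but the exceptional null set depends on t. Restricting
  t to the rationals leaves a single null set, and right continuity of V closes the gap between r
  and t.\<close>

lemma Id_norm_infinity:
  "unif_equiv (\<lambda>\<omega>. \<omega> \<in> cOmega \<infinity>) (\<lambda>\<omega>. Id_norm p1 v1 p2 \<infinity> \<omega> v2)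
     (\<lambda>\<omega>. SUP t\<in>{0<..}. W \<infinity> \<omega> t * V (cball0 t))"
proof (rule unif_equivI[of 1 1])
  fix \<omega> assume \<omega>: "\<omega> \<in> cOmega \<infinity>"
  show "(SUP t\<in>{0<..}. W \<infinity> \<omega> t * V (cball0 t)) \<le> ennreal 1 * Id_norm p1 v1 p2 \<infinity> \<omega> v2"
    using \<omega> by (auto intro!: SUP_least W_times_V_le_Id_norm)
  let ?A = "SUP t\<in>{0<..}. W \<infinity> \<omega> t * V (cball0 t)"
  have "AE r in lebesgue. \<forall>q::rat. r \<in> {0<..<real_of_rat q} \<longrightarrow> ennreal (\<omega> r) \<le> W \<infinity> \<omega> (real_of_rat q)"
    unfolding AE_all_countable unorm_infinity by (intro allI AE_le_ess_sup_on)
  then have AE: "AE r in lebesgue. 0 < r \<longrightarrow> ennreal (\<omega> r) * V (cball0 r) \<le> ?A"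
  proof (eventually_elim, intro impI)
    fix r :: real
    assume *: "\<forall>q::rat. r \<in> {0<..<real_of_rat q} \<longrightarrow> ennreal (\<omega> r) \<le> W \<infinity> \<omega> (real_of_rat q)"
      and r: "0 < r"
    have "ennreal (\<omega> r) * V (cball0 (r + 1 / Suc n)) \<le> ?A" for n
    proof -
      obtain q :: rat where q: "r < of_rat q" "of_rat q < r + 1 / Suc n"
        using of_rat_dense[of r "r + 1 / Suc n"] by auto
      then have q0: "0 < real_of_rat q" using r by linarith
      have "ennreal (\<omega> r) * V (cball0 (r + 1 / Suc n)) \<le> W \<infinity> \<omega> (of_rat q) * V (cball0 (of_rat q))"
        using * q r by (intro mult_mono V_mono cball0_mono) auto
      also have "\<dots> \<le> ?A"
        using q0 by (intro SUP_upper) auto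
      finally show ?thesis .
    qed
    then show "ennreal (\<omega> r) * V (cball0 r) \<le> ?A"
      by (subst unorm_cball0_right_continuous[OF pos(3)])
        (auto simp: SUP_mult_left_ennreal simp del: of_nat_Suc intro!: SUP_least)
  qed
  show "Id_norm p1 v1 p2 \<infinity> \<omega> v2 \<le> ennreal 1 * ?A"
  proof (rule Id_norm_leI)
    fix f :: "'a \<Rightarrow> real"
    assume f: "f \<in> borel_measurable lebesgue" "Lp_norm p1 v1 f < \<infinity>"
    have "AE r in lebesgue. r \<in> {0<..} \<longrightarrow> ennreal (\<omega> r) * N (cball0 r) f \<le> ennreal 1 * ?A * Lp_norm p1 v1 f"
      using AE
    proof eventually_elim
      case (elim r)
      show ?case
      proof
        assume r: "r \<in> {0<..}"
        have "ennreal (\<omega> r) * N (cball0 r) f \<le> ennreal (\<omega> r) * (Lp_norm p1 v1 f * V (cball0 r))"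
          by (intro mult_left_mono Holder f cball0_sets) auto
        also have "\<dots> = ennreal (\<omega> r) * V (cball0 r) * Lp_norm p1 v1 f"
          by (simp add: mult_ac)
        also have "\<dots> \<le> ?A * Lp_norm p1 v1 f"
          using elim r by (intro mult_right_mono) auto
        finally show "ennreal (\<omega> r) * N (cball0 r) f \<le> ennreal 1 * ?A * Lp_norm p1 v1 f"
          by simp
      qed
    qed
    then show "cLM_norm p2 \<infinity> \<omega> v2 f \<le> ennreal 1 * ?A * Lp_norm p1 v1 f"
      unfolding cLM_norm_def unorm_infinity by (rule ess_sup_on_leI)
  qed (fact pos v1)+
qed auto

text \<open>A single \<open>g\<close> is extremal for all sets at once, as 1/v_1 is when p_1 =
  \<infinity>. Its Morrey norm then bounds the right-hand side directly, no discretization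
  intervenes, and the equivalence is an equality.\<close>

lemma Id_norm_attained:
  assumes th: "0 < th" and g: "g \<in> borel_measurable lebesgue" "Lp_norm p1 v1 g \<le> 1" "\<And>A. V A \<le> N A g"
  shows "unif_equiv (\<lambda>\<omega>. \<omega> \<in> cOmega (ereal th)) (\<lambda>\<omega>. Id_norm p1 v1 p2 (ereal th) \<omega> v2)
     (\<lambda>\<omega>. unorm lebesgue (ereal th) {0<..} (\<lambda>t. ennreal (\<omega> t) * V (cball0 t)))"
proof (rule unif_equivI[of 1 1])
  fix \<omega> assume \<omega>: "\<omega> \<in> cOmega (ereal th)"
  let ?A = "unorm lebesgue (ereal th) {0<..} (\<lambda>t. ennreal (\<omega> t) * V (cball0 t))"
  have "?A \<le> cLM_norm p2 (ereal th) \<omega> v2 g"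
    unfolding cLM_norm_def using th by (intro unorm_mono) (auto intro!: mult_left_mono g)
  also have "\<dots> \<le> Id_norm p1 v1 p2 (ereal th) \<omega> v2 * Lp_norm p1 v1 g"
    using g(2) th by (intro cLM_norm_le_Id_norm pos v1 g(1)) (auto simp: order_le_less_trans)
  also have "\<dots> \<le> Id_norm p1 v1 p2 (ereal th) \<omega> v2 * 1"
    using g(2) by (rule mult_left_mono) simp
  finally show "?A \<le> ennreal 1 * Id_norm p1 v1 p2 (ereal th) \<omega> v2" by simp
  show "Id_norm p1 v1 p2 (ereal th) \<omega> v2 \<le> ennreal 1 * ?A"
  proof (rule Id_norm_leI)
    fix f :: "'a \<Rightarrow> real"
    assume f: "f \<in> borel_measurable lebesgue" "Lp_norm p1 v1 f < \<infinity>" "0 < Lp_norm p1 v1 f"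
    have "cLM_norm p2 (ereal th) \<omega> v2 f \<le>
      unorm lebesgue (ereal th) {0<..} (\<lambda>t. Lp_norm p1 v1 f * (ennreal (\<omega> t) * V (cball0 t)))"
      unfolding cLM_norm_def
    proof (intro unorm_mono AE_I2 impI conjI)
      fix t
      show "ennreal (\<omega> t) * N (cball0 t) f \<le> Lp_norm p1 v1 f * (ennreal (\<omega> t) * V (cball0 t))"
        using mult_left_mono[OF Holder[OF f(1,2) cball0_sets, of t], of "ennreal (\<omega> t)"]
        by (simp add: mult_ac)
    qed (use th in auto)
    also have "\<dots> \<le> Lp_norm p1 v1 f * ?A"
    proof (rule unorm_cmult_le)
      have [measurable]: "(\<lambda>t. V (cball0 t)) \<in> borel_measurable lebesgue"
        by (intro borel_measurable_antimono_ennreal antimonoI V_mono cball0_mono)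
      have [measurable]: "(\<lambda>t. ennreal (\<omega> t) * indicator {0<..} t) \<in> borel_measurable lebesgue"
        by (rule cOmega_measurable[OF \<omega>]) auto
      have "(\<lambda>t. Lp_norm p1 v1 f * V (cball0 t) * (ennreal (\<omega> t) * indicator {0<..} t)) \<in> borel_measurable lebesgue"
        by measurable
      then show "(\<lambda>t. Lp_norm p1 v1 f * (ennreal (\<omega> t) * V (cball0 t)) * indicator {0<..} t) \<in> borel_measurable lebesgue"
        by (simp add: mult_ac)
    qed (use th f in auto)
    finally show "cLM_norm p2 (ereal th) \<omega> v2 f \<le> ennreal 1 * ?A * Lp_norm p1 v1 f"
      by (simp add: mult.commute)
  qed (fact pos v1)+
qed auto

end

section \<open>Dyadic levels of the weight\<close>

text \<open>The infimum of the set is attained by compactness, and the intermediate value theorem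
  forces the value c there even when F is constant on intervals. So the end point of the half line
  carries exactly the value c.\<close>

lemma increasing_threshold:
  fixes F :: "real \<Rightarrow> real"
  assumes mono: "\<And>x y. 0 \<le> x \<Longrightarrow> x \<le> y \<Longrightarrow> F x \<le> F y" and cont: "\<And>b. continuous_on {0..b} F"
    and F0: "F 0 < c" and r: "0 < r" "c \<le> F r"
  obtains t where "0 < t" "F t = c" "{x. 0 < x \<and> c \<le> F x} = {t..}"
proof -
  let ?K = "{0..r} \<inter> F -` {c..}"
  have "compact ?K"
    by (intro compact_Int_closed[of "{0..r}" ?K, simplified Int_left_absorb] compact_Icc
        continuous_closed_preimage cont) auto
  moreover have "r \<in> ?K" using r by simp
  then have "?K \<noteq> {}" by blast
  ultimately obtain t where t: "t \<in> ?K" "\<And>x. x \<in> ?K \<Longrightarrow> t \<le> x"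
    using compact_attains_inf[of ?K] by blast
  obtain t' where t': "0 \<le> t'" "t' \<le> r" "F t' = c"
    using IVT'[of F 0 c r] F0 r cont[of r] by auto
  have "F t = c"
    using t(1) t(2)[of t'] t' mono[of t t'] by auto
  moreover have "0 < t"
    using t(1) F0 by (cases "t = 0") auto
  moreover have "{x. 0 < x \<and> c \<le> F x} = {t..}"
  proof (intro equalityI subsetI; clarsimp)
    fix x assume x: "0 < x" "c \<le> F x"
    show "t \<le> x"
    proof (cases "x \<le> r")
      case True
      with x t(2)[of x] show ?thesis by auto
    next
      case False
      with t(1) show ?thesis by auto
    qed
  next
    fix x assume "t \<le> x"
    then show "0 < x \<and> c \<le> F x"
      using \<open>0 < t\<close> mono[of t x] \<open>F t = c\<close> by auto
  qed
  ultimately show thesis by (intro that)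
qed

text \<open>The primitive is taken as a gauge integral, whose indefinite integral is continuous.
  Finiteness and positivity on each (0,t) are the two bounds in \<open>cOmega\<close>.\<close>

lemma cOmega_primitive:
  assumes th: "0 < th" and \<omega>: "\<omega> \<in> cOmega (ereal th)"
  obtains F :: "real \<Rightarrow> real" where
    "\<And>t. 0 < t \<Longrightarrow> (\<integral>\<^sup>+r\<in>{0<..<t}. ennreal (\<omega> r powr th) \<partial>lebesgue) = ennreal (F t)"
    "\<And>t. 0 < t \<Longrightarrow> unorm lebesgue (ereal th) {0<..<t} (\<lambda>s. ennreal (\<omega> s)) = ennreal (F t powr (1 / th))"
    "\<And>t. 0 < t \<Longrightarrow> 0 < F t" "F 0 = 0"
    "\<And>x y. 0 \<le> x \<Longrightarrow> x \<le> y \<Longrightarrow> F x \<le> F y" "\<And>b. continuous_on {0..b} F"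
proof -
  let ?g = "\<lambda>r. \<omega> r powr th"
  define F where "F t = integral {0..t} ?g" for t
  have nn: "0 \<le> \<omega> r" if "0 < r" for r
    using \<omega> that by (auto simp: cOmega_def)
  have unorm: "unorm lebesgue (ereal th) {0<..<t} (\<lambda>s. ennreal (\<omega> s)) =
      enn_powr (\<integral>\<^sup>+r\<in>{0<..<t}. ennreal (?g r) \<partial>lebesgue) (1 / th)" for t
    unfolding unorm_ereal
    by (intro arg_cong[where f = "\<lambda>x. enn_powr x _"] nn_integral_cong)
      (auto simp: enn_powr_ennreal nn split: split_indicator)
  have pos_fin: "0 < (\<integral>\<^sup>+r\<in>{0<..<t}. ennreal (?g r) \<partial>lebesgue)"
    "(\<integral>\<^sup>+r\<in>{0<..<t}. ennreal (?g r) \<partial>lebesgue) < \<infinity>" if "0 < t" for t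
    using \<omega> that by (auto simp: cOmega_def unorm zero_less_iff_neq_zero top.not_eq_extremum[symmetric])
  have meas: "(\<lambda>r. ?g r * indicator {0<..<t} r) \<in> borel_measurable lebesgue" for t
  proof -
    have "\<omega> \<in> borel_measurable (restrict_space lebesgue {0<..})"
      using \<omega> by (auto simp: cOmega_def)
    then have "?g \<in> borel_measurable (restrict_space lebesgue {0<..})" by measurable
    then have h: "(\<lambda>r. indicator {0<..} r *\<^sub>R ?g r) \<in> borel_measurable lebesgue"
      by (subst (asm) borel_measurable_restrict_space_iff) auto
    have "(\<lambda>r. (indicator {0<..} r *\<^sub>R ?g r) * indicator {0<..<t} r) \<in> borel_measurable lebesgue"
      by (rule borel_measurable_times[OF h]) (auto intro: borel_measurable_indicator)
    also have "(\<lambda>r. (indicator {0<..} r *\<^sub>R ?g r) * indicator {0<..<t} r) = (\<lambda>r. ?g r * indicator {0<..<t} r)"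
      by (auto simp: indicator_def)
    finally show ?thesis .
  qed
  have int: "(?g has_integral enn2real (\<integral>\<^sup>+r\<in>{0<..<t}. ennreal (?g r) \<partial>lebesgue)) {0..t}" if "0 < t" for t
  proof -
    have "((\<lambda>r. ?g r * indicator {0<..<t} r) has_integral
        enn2real (\<integral>\<^sup>+r\<in>{0<..<t}. ennreal (?g r) \<partial>lebesgue)) UNIV"
      using meas[of t] pos_fin[OF that]
      by (subst has_integral_iff_nn_integral_lebesgue) (auto simp: nn_integral_set_ennreal)
    moreover have "(\<lambda>r. ?g r * indicator {0<..<t} r) = (\<lambda>r. if r \<in> {0<..<t} then ?g r else 0)"
      by (auto simp: indicator_def)
    ultimately show ?thesis
      by (simp only: has_integral_Icc_iff_Ioo has_integral_restrict_UNIV)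
  qed
  have F: "(\<integral>\<^sup>+r\<in>{0<..<t}. ennreal (?g r) \<partial>lebesgue) = ennreal (F t)" "0 < F t" if "0 < t" for t
    using int[OF that] pos_fin[OF that] unfolding F_def
    by (auto simp: integral_unique enn2real_positive_iff)
  have integrable: "?g integrable_on {0..t}" for t
    using int[of t] by (cases "0 < t") (auto simp: integrable_on_def intro!: integrable_negligible[unfolded integrable_on_def] exI)
  show thesis
  proof (rule that[OF F(1)])
    show "unorm lebesgue (ereal th) {0<..<t} (\<lambda>s. ennreal (\<omega> s)) = ennreal (F t powr (1 / th))" if "0 < t" for t
      using F[OF that] by (simp add: unorm enn_powr_ennreal)
    show "F x \<le> F y" if "0 \<le> x" "x \<le> y" for x y
      unfolding F_def using that by (intro integral_subset_le integrable) auto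
    show "continuous_on {0..b} F" for b
      unfolding F_def by (intro indefinite_integral_continuous_1 integrable)
  qed (use F in \<open>auto simp: F_def\<close>)
qed

text \<open>\<open>R k\<close> stands for the set of radii with F \<ge> 2^k, a half line or, when F
  is bounded, possibly empty. The two comparisons allow a power F^\<kappa> and a monotone set
  function H: \<kappa> = 0 and H = N^\<theta> give the Morrey norm, a positive \<kappa> and a power
  of V give the outer norm in the case \<theta> < p_1. As H acts on sets and vanishes at {}, empty
  levels contribute nothing to the sums.\<close>

locale dyadic_levels =
  fixes th :: real and \<omega> F :: "real \<Rightarrow> real" and R :: "int \<Rightarrow> real set"
  assumes F_pos: "\<And>t. 0 < t \<Longrightarrow> 0 < F t"
    and unorm_eq: "\<And>t. 0 < t \<Longrightarrow> unorm lebesgue (ereal th) {0<..<t} (\<lambda>s. ennreal (\<omega> s)) = ennreal (F t powr (1 / th))"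
    and R_cases: "\<And>k. R k = {} \<or> (\<exists>t>0. R k = {t..} \<and> F t = 2 powr real_of_int k)"
    and R_antimono: "antimono R"
    and R_cover: "\<And>r. 0 < r \<Longrightarrow> \<exists>k. r \<in> R k - R (k + 1)"
    and integral_le_sum: "\<And>\<kappa> H. 0 \<le> \<kappa> \<Longrightarrow> mono H \<Longrightarrow> H {} = 0 \<Longrightarrow>
      (\<integral>\<^sup>+r\<in>{0<..}. ennreal (\<omega> r powr th) * ennreal (F r powr \<kappa>) * H {r..} \<partial>lebesgue)
      \<le> ennreal (2 powr (1 + \<kappa>)) * (\<integral>\<^sup>+k. ennreal (2 powr ((1 + \<kappa>) * real_of_int k)) * H (R k) \<partial>count_space UNIV)"
    and sum_le_integral: "\<And>\<kappa> H. 0 \<le> \<kappa> \<Longrightarrow> mono H \<Longrightarrow> H {} = 0 \<Longrightarrow>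
      (\<integral>\<^sup>+k. ennreal (2 powr ((1 + \<kappa>) * real_of_int k)) * H (R k) \<partial>count_space UNIV)
      \<le> ennreal (2 powr (1 + \<kappa>)) *
        (\<integral>\<^sup>+r\<in>{0<..}. ennreal (\<omega> r powr th) * ennreal (F r powr \<kappa>) * H {r..} \<partial>lebesgue)"

lemma cOmega_dyadic_levels:
  assumes th: "0 < th" and \<omega>: "\<omega> \<in> cOmega (ereal th)"
  shows "\<exists>F R. dyadic_levels th \<omega> F R"
proof -
  obtain F where F: "\<And>t. 0 < t \<Longrightarrow> (\<integral>\<^sup>+r\<in>{0<..<t}. ennreal (\<omega> r powr th) \<partial>lebesgue) = ennreal (F t)"
    and W: "\<And>t. 0 < t \<Longrightarrow> unorm lebesgue (ereal th) {0<..<t} (\<lambda>s. ennreal (\<omega> s)) = ennreal (F t powr (1 / th))"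
    and Fpos: "\<And>t. 0 < t \<Longrightarrow> 0 < F t" and F0: "F 0 = 0"
    and Fmono: "\<And>x y. 0 \<le> x \<Longrightarrow> x \<le> y \<Longrightarrow> F x \<le> F y" and Fcont: "\<And>b. continuous_on {0..b} F"
    by (rule cOmega_primitive[OF th \<omega>], rule that)
  define R where "R k = {r. 0 < r \<and> 2 powr real_of_int k \<le> F r}" for k
  define g where "g r = ennreal (\<omega> r powr th) * indicator {0<..} r" for r
  define \<nu> where "\<nu> = density lebesgue g"
  have g[measurable]: "g \<in> borel_measurable lebesgue"
  proof -
    have "(\<lambda>r. enn_powr (ennreal (\<omega> r) * indicator {0<..} r) th) \<in> borel_measurable lebesgue"
      by (intro measurable_enn_powr cOmega_measurable[OF \<omega>]) auto
    also have "(\<lambda>r. enn_powr (ennreal (\<omega> r) * indicator {0<..} r) th) = g"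
      using \<omega> by (auto simp: g_def fun_eq_iff cOmega_def enn_powr_ennreal split: split_indicator)
    finally show ?thesis .
  qed
  have R: "R k = {} \<or> (\<exists>t>0. R k = {t..} \<and> F t = 2 powr k)" for k
  proof (cases "R k = {}")
    case False
    then obtain r where r: "0 < r" "2 powr real_of_int k \<le> F r" by (auto simp: R_def)
    have "F 0 < 2 powr real_of_int k" using F0 by simp
    from increasing_threshold[OF Fmono Fcont this r]
    obtain t where "0 < t" "F t = 2 powr real_of_int k" "R k = {t..}"
      unfolding R_def by metis
    then show ?thesis by blast
  qed simp
  have R_sets [measurable]: "R k \<in> sets lebesgue" for k
    using R[of k] by auto
  have R_antimono: "antimono R"
  proof (rule antimonoI, rule subsetI)
    fix j k r assume "j \<le> (k :: int)" "r \<in> R k"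
    moreover from this(1) have "2 powr real_of_int j \<le> 2 powr real_of_int k" by simp
    ultimately show "r \<in> R j" unfolding R_def mem_Collect_eq by linarith
  qed
  have R_cover: "\<exists>k. r \<in> R k - R (k + 1)" if r: "0 < r" for r
  proof -
    have "2 powr \<lfloor>log 2 (F r)\<rfloor> \<le> F r" "F r < 2 powr (\<lfloor>log 2 (F r)\<rfloor> + 1)"
      using Fpos[OF r] by (simp_all add: powr_le_iff less_powr_iff)
    then show ?thesis using r by (auto simp: R_def intro!: exI[of _ "\<lfloor>log 2 (F r)\<rfloor>"])
  qed
  have R_unique: "k = j" if "r \<in> R k - R (k + 1)" "r \<in> R j - R (j + 1)" for r k j
  proof (rule ccontr)
    assume "k \<noteq> j"
    then have "k + 1 \<le> j \<or> j + 1 \<le> k" by auto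
    then show False using that antimonoD[OF R_antimono] by blast
  qed
  have \<nu>: "emeasure \<nu> A = (\<integral>\<^sup>+r\<in>A. g r \<partial>lebesgue)" if "A \<in> sets lebesgue" for A
    unfolding \<nu>_def using that by (simp add: emeasure_density)
  have \<nu>_Ioo: "emeasure \<nu> {0<..<t} = ennreal (F t)" if "0 < t" for t
  proof -
    have "emeasure \<nu> {0<..<t} = (\<integral>\<^sup>+r\<in>{0<..<t}. ennreal (\<omega> r powr th) \<partial>lebesgue)"
      by (subst \<nu>) (auto intro!: nn_integral_cong simp: g_def split: split_indicator)
    then show ?thesis using F[OF that] by simp
  qed
  \<comment> \<open>A crude bound suffices: the annulus lies in (0,t) with F t = 2^(k+1), or else
    level k + 1 is empty, F stays below 2^(k+1), and so does the mass of every bounded interval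
    (0,t).\<close>
  have \<nu>_le: "emeasure \<nu> (R k - R (k + 1)) \<le> ennreal (2 powr (real_of_int k + 1))" for k
    using R[of "k + 1"]
  proof
    assume e: "R (k + 1) = {}"
    have "R k - R (k + 1) \<subseteq> (\<Union>n. {0<..<real (Suc n)})"
    proof
      fix r assume r: "r \<in> R k - R (k + 1)"
      obtain n where "r < real n" using reals_Archimedean2 by blast
      then show "r \<in> (\<Union>n. {0<..<real (Suc n)})"
        using r by (auto simp: R_def intro!: exI[of _ n])
    qed
    then have "emeasure \<nu> (R k - R (k + 1)) \<le> emeasure \<nu> (\<Union>n. {0<..<real (Suc n)})"
      by (intro emeasure_mono) (auto simp: \<nu>_def)
    also have "\<dots> = (SUP n. emeasure \<nu> {0<..<real (Suc n)})"
      by (intro SUP_emeasure_incseq[symmetric]) (auto simp: \<nu>_def incseq_def)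
    also have "\<dots> \<le> ennreal (2 powr (real_of_int k + 1))"
    proof (rule SUP_least)
      fix n :: nat
      have "real (Suc n) \<notin> R (k + 1)" using e by simp
      then have "F (real (Suc n)) \<le> 2 powr (real_of_int k + 1)" by (simp add: R_def)
      then show "emeasure \<nu> {0<..<real (Suc n)} \<le> ennreal (2 powr (real_of_int k + 1))"
        by (simp add: \<nu>_Ioo ennreal_leI del: of_nat_Suc)
    qed
    finally show ?thesis .
  next
    assume "\<exists>t>0. R (k + 1) = {t..} \<and> F t = 2 powr real_of_int (k + 1)"
    then obtain t where t: "0 < t" "R (k + 1) = {t..}" "F t = 2 powr real_of_int (k + 1)" by blast
    have "R k - R (k + 1) \<subseteq> {0<..<t}" unfolding t(2) by (auto simp: R_def)
    then have "emeasure \<nu> (R k - R (k + 1)) \<le> emeasure \<nu> {0<..<t}"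
      by (rule emeasure_mono) (simp add: \<nu>_def)
    also have "\<dots> = ennreal (2 powr (real_of_int k + 1))"
      unfolding \<nu>_Ioo[OF t(1)] t(3) by simp
    finally show ?thesis .
  qed
  \<comment> \<open>F gains exactly 2^(k+1) - 2^k between the two thresholds. For the last nonempty
    level there is no such identity; its annulus may even have mass 0.\<close>
  have \<nu>_eq: "emeasure \<nu> (R k - R (k + 1)) = ennreal (2 powr k)" if ne: "R (k + 1) \<noteq> {}" for k
  proof -
    obtain t where t: "0 < t" "R (k + 1) = {t..}" "F t = 2 powr real_of_int (k + 1)"
      using R[of "k + 1"] ne by blast
    have sub: "R (k + 1) \<subseteq> R k" using R_antimono by (auto simp: antimono_def)
    then obtain t' where t': "0 < t'" "R k = {t'..}" "F t' = 2 powr k"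
      using R[of k] ne by blast
    have "t' \<le> t" using sub unfolding t(2) t'(2) by simp
    have D: "R k - R (k + 1) = {t'..<t}" unfolding t(2) t'(2) by auto
    have "{0<..<t} = {0<..<t'} \<union> {t'..<t}" using t(1) t'(1) \<open>t' \<le> t\<close> by auto
    then have "emeasure \<nu> {0<..<t} = emeasure \<nu> {0<..<t'} + emeasure \<nu> (R k - R (k + 1))"
      unfolding D by (subst plus_emeasure) (auto simp: \<nu>_def)
    then have "ennreal (2 powr k) + emeasure \<nu> (R k - R (k + 1)) = ennreal (2 powr k) + ennreal (2 powr k)"
      unfolding \<nu>_Ioo[OF t(1)] \<nu>_Ioo[OF t'(1)] t(3) t'(3)
      by (simp add: powr_add mult.commute flip: ennreal_plus)
    then show ?thesis by (simp add: ennreal_add_left_cancel)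
  qed
  \<comment> \<open>A radius belongs to exactly one annulus, so a sum over levels evaluated at r has
    a single term; this turns functions of the level into functions of r.\<close>
  have levels: "(\<integral>\<^sup>+k. c k * indicator (R k - R (k + 1)) r \<partial>count_space UNIV) = c j"
    if r: "r \<in> R j - R (j + 1)" for r j and c :: "int \<Rightarrow> ennreal"
  proof -
    have "indicator (R k - R (k + 1)) r = (0 :: ennreal)" if "k \<noteq> j" for k
      using R_unique[of r k j] r that by (meson indicator_simps(2))
    with r show ?thesis by (subst nn_integral_count_space'[of "{j}"]) auto
  qed
  have step: "(\<integral>\<^sup>+r. \<integral>\<^sup>+k. c k * indicator (R k - R (k + 1)) r * g r \<partial>count_space UNIV \<partial>lebesgue)
      = (\<integral>\<^sup>+k. c k * emeasure \<nu> (R k - R (k + 1)) \<partial>count_space UNIV)" for c :: "int \<Rightarrow> ennreal"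
  proof (subst nn_integral_count_space_nn_integral)
    have "(\<integral>\<^sup>+r. c k * indicator (R k - R (k + 1)) r * g r \<partial>lebesgue) = c k * emeasure \<nu> (R k - R (k + 1))" for k
      by (simp add: \<nu> mult_ac flip: nn_integral_cmult)
    then show "(\<integral>\<^sup>+k. \<integral>\<^sup>+r. c k * indicator (R k - R (k + 1)) r * g r \<partial>lebesgue \<partial>count_space UNIV)
      = (\<integral>\<^sup>+k. c k * emeasure \<nu> (R k - R (k + 1)) \<partial>count_space UNIV)"
      by simp
  qed auto
  have RD: "F r \<le> 2 powr (real_of_int k + 1)" "2 powr k \<le> F r" "0 < r" "{r..} \<subseteq> R k" "R (k + 1) \<subseteq> {r..}"
    if r: "r \<in> R k - R (k + 1)" for r k
  proof -
    show *: "F r \<le> 2 powr (real_of_int k + 1)" "2 powr k \<le> F r" "0 < r"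
      using r by (auto simp: R_def)
    show "{r..} \<subseteq> R k"
    proof
      fix x assume "x \<in> {r..}"
      with * Fmono[of r x] show "x \<in> R k" unfolding R_def by simp
    qed
    show "R (k + 1) \<subseteq> {r..}"
    proof (rule ccontr)
      assume "\<not> R (k + 1) \<subseteq> {r..}"
      then obtain x where "x \<in> R (k + 1)" "x < r" by fastforce
      then have "r \<in> R (k + 1)"
        using Fmono[of x r] unfolding R_def by simp
      with r show False by simp
    qed
  qed
  have bounds: "(\<integral>\<^sup>+r\<in>{0<..}. ennreal (\<omega> r powr th) * ennreal (F r powr \<kappa>) * H {r..} \<partial>lebesgue)
      \<le> ennreal (2 powr (1 + \<kappa>)) * (\<integral>\<^sup>+k. ennreal (2 powr ((1 + \<kappa>) * real_of_int k)) * H (R k) \<partial>count_space UNIV)"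
      (is "?I \<le> _ * ?S")
    "(\<integral>\<^sup>+k. ennreal (2 powr ((1 + \<kappa>) * real_of_int k)) * H (R k) \<partial>count_space UNIV)
      \<le> ennreal (2 powr (1 + \<kappa>)) *
        (\<integral>\<^sup>+r\<in>{0<..}. ennreal (\<omega> r powr th) * ennreal (F r powr \<kappa>) * H {r..} \<partial>lebesgue)"
    if \<kappa>: "0 \<le> \<kappa>" and H: "mono H" "H {} = 0" for \<kappa> :: real and H :: "real set \<Rightarrow> ennreal"
  proof -
    \<comment> \<open>On annulus k one has F r \<le> 2^(k+1) and \<open>{r..}\<close> inside
      \<open>R k\<close>. The factor 2^(1+\<kappa>) collects a loss of 2^\<kappa> from F^\<kappa>
      and of 2 from the mass.\<close>
    have "?I \<le> (\<integral>\<^sup>+r. \<integral>\<^sup>+k. ennreal (2 powr (\<kappa> * (real_of_int k + 1))) * H (R k) *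
        indicator (R k - R (k + 1)) r * g r \<partial>count_space UNIV \<partial>lebesgue)"
    proof (rule nn_integral_mono)
      fix r :: real
      show "ennreal (\<omega> r powr th) * ennreal (F r powr \<kappa>) * H {r..} * indicator {0<..} r
        \<le> (\<integral>\<^sup>+k. ennreal (2 powr (\<kappa> * (real_of_int k + 1))) * H (R k) * indicator (R k - R (k + 1)) r * g r \<partial>count_space UNIV)"
      proof (cases "0 < r")
        case True
        then obtain j where j: "r \<in> R j - R (j + 1)" using R_cover by blast
        have "F r powr \<kappa> \<le> 2 powr (\<kappa> * (real_of_int j + 1))"
          using RD[OF j] \<kappa> Fpos[OF True] powr_mono2[of \<kappa> "F r" "2 powr (real_of_int j + 1)"]
          by (simp add: powr_powr mult.commute)
        then have "ennreal (F r powr \<kappa>) * H {r..} * g r \<le> ennreal (2 powr (\<kappa> * (real_of_int j + 1))) * H (R j) * g r"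
          using RD[OF j] by (intro mult_mono ennreal_leI monoD[OF H(1)]) auto
        also have "\<dots> = (\<integral>\<^sup>+k. ennreal (2 powr (\<kappa> * (real_of_int k + 1))) * H (R k) * indicator (R k - R (k + 1)) r * g r \<partial>count_space UNIV)"
          by (subst nn_integral_multc) (simp_all add: levels[OF j])
        finally show ?thesis by (simp add: g_def mult_ac)
      qed simp
    qed
    also have "\<dots> \<le> (\<integral>\<^sup>+k. ennreal (2 powr (1 + \<kappa>)) * (ennreal (2 powr ((1 + \<kappa>) * real_of_int k)) * H (R k)) \<partial>count_space UNIV)"
      unfolding step
    proof (rule nn_integral_mono)
      fix k :: int
      have "ennreal (2 powr (\<kappa> * (real_of_int k + 1))) * H (R k) * emeasure \<nu> (R k - R (k + 1))
        \<le> ennreal (2 powr (\<kappa> * (real_of_int k + 1))) * H (R k) * ennreal (2 powr (real_of_int k + 1))"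
        by (intro mult_left_mono) (use \<nu>_le[of k] in auto)
      also have "\<dots> = ennreal (2 powr (\<kappa> * (real_of_int k + 1))) * ennreal (2 powr (real_of_int k + 1)) * H (R k)"
        by (simp add: mult_ac)
      also have "ennreal (2 powr (\<kappa> * (real_of_int k + 1))) * ennreal (2 powr (real_of_int k + 1)) =
          ennreal (2 powr (1 + \<kappa>)) * ennreal (2 powr ((1 + \<kappa>) * real_of_int k))"
        by (simp add: algebra_simps flip: ennreal_mult powr_add)
      finally show "ennreal (2 powr (\<kappa> * (real_of_int k + 1))) * H (R k) * emeasure \<nu> (R k - R (k + 1))
        \<le> ennreal (2 powr (1 + \<kappa>)) * (ennreal (2 powr ((1 + \<kappa>) * real_of_int k)) * H (R k))"
        by (simp add: mult_ac)
    qed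
    also have "\<dots> = ennreal (2 powr (1 + \<kappa>)) * ?S"
      by (simp add: nn_integral_cmult)
    finally show "?I \<le> ennreal (2 powr (1 + \<kappa>)) * ?S" .
    \<comment> \<open>The index is shifted by one: the term of level k + 1 is charged to annulus k,
      which lies to the left of \<open>R (k + 1)\<close> and has mass exactly 2^k. If level k + 1 is
      empty, the term is \<open>H {}\<close>, which is 0.\<close>
    have "?S = (\<integral>\<^sup>+k. ennreal (2 powr ((1 + \<kappa>) * real_of_int (k + 1))) * H (R (k + 1)) \<partial>count_space UNIV)"
      by (rule nn_integral_bij_count_space[symmetric]) (auto simp: bij_betw_def inj_on_def image_iff intro!: exI[of _ "_ - 1"])
    also have "\<dots> = (\<integral>\<^sup>+k. ennreal (2 powr (1 + \<kappa>)) *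
        (ennreal (2 powr (\<kappa> * real_of_int k)) * H (R (k + 1)) * emeasure \<nu> (R k - R (k + 1))) \<partial>count_space UNIV)"
    proof (rule nn_integral_cong)
      fix k :: int
      have "ennreal (2 powr ((1 + \<kappa>) * real_of_int (k + 1))) =
          ennreal (2 powr (1 + \<kappa>)) * (ennreal (2 powr (\<kappa> * real_of_int k)) * ennreal (2 powr k))"
        by (simp add: algebra_simps flip: ennreal_mult powr_add)
      then show "ennreal (2 powr ((1 + \<kappa>) * real_of_int (k + 1))) * H (R (k + 1)) = ennreal (2 powr (1 + \<kappa>)) *
        (ennreal (2 powr (\<kappa> * real_of_int k)) * H (R (k + 1)) * emeasure \<nu> (R k - R (k + 1)))"
        using \<nu>_eq[of k] H(2) by (cases "R (k + 1) = {}") (auto simp: mult_ac)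
    qed
    also have "\<dots> = ennreal (2 powr (1 + \<kappa>)) * (\<integral>\<^sup>+r. \<integral>\<^sup>+k. ennreal (2 powr (\<kappa> * real_of_int k)) * H (R (k + 1)) *
        indicator (R k - R (k + 1)) r * g r \<partial>count_space UNIV \<partial>lebesgue)"
      by (simp add: nn_integral_cmult step)
    also have "\<dots> \<le> ennreal (2 powr (1 + \<kappa>)) * ?I"
    proof (intro mult_left_mono nn_integral_mono)
      fix r :: real
      show "(\<integral>\<^sup>+k. ennreal (2 powr (\<kappa> * real_of_int k)) * H (R (k + 1)) * indicator (R k - R (k + 1)) r * g r \<partial>count_space UNIV)
        \<le> ennreal (\<omega> r powr th) * ennreal (F r powr \<kappa>) * H {r..} * indicator {0<..} r"
      proof (cases "0 < r")
        case True
        then obtain j where j: "r \<in> R j - R (j + 1)" using R_cover by blast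
        have "2 powr (\<kappa> * real_of_int j) \<le> F r powr \<kappa>"
          using RD[OF j] \<kappa> powr_mono2[of \<kappa> "2 powr j" "F r"]
          by (simp add: powr_powr mult.commute)
        then have "ennreal (2 powr (\<kappa> * real_of_int j)) * H (R (j + 1)) * g r \<le> ennreal (F r powr \<kappa>) * H {r..} * g r"
          using RD[OF j] by (intro mult_mono ennreal_leI monoD[OF H(1)]) auto
        moreover have "(\<integral>\<^sup>+k. ennreal (2 powr (\<kappa> * real_of_int k)) * H (R (k + 1)) * indicator (R k - R (k + 1)) r * g r \<partial>count_space UNIV)
          = ennreal (2 powr (\<kappa> * real_of_int j)) * H (R (j + 1)) * g r"
          by (subst nn_integral_multc) (simp_all add: levels[OF j])
        ultimately show ?thesis by (simp add: g_def mult_ac)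
      qed (simp add: g_def)
    qed simp
    finally show "?S \<le> ennreal (2 powr (1 + \<kappa>)) * ?I" .
  qed
  have "dyadic_levels th \<omega> F R"
    by unfold_locales (fact Fpos W R R_antimono R_cover bounds)+
  then show ?thesis by blast
qed

text \<open>Each term is bounded by the sum S, so b^m = b * b^(m-1) \<le> b * S^(m-1). This is the
  inclusion of l^1 in l^m.\<close>

lemma sum_powr_le_powr_sum:
  fixes b :: "'i \<Rightarrow> ennreal"
  assumes "1 \<le> m"
  shows "(\<integral>\<^sup>+k. enn_powr (b k) m \<partial>count_space A) \<le> enn_powr (\<integral>\<^sup>+k. b k \<partial>count_space A) m"
proof -
  let ?S = "\<integral>\<^sup>+k. b k \<partial>count_space A"
  have split: "enn_powr x m = x * enn_powr x (m - 1)" for x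
    using enn_powr_add[of x 1 "m - 1"] by simp
  have "b k \<le> ?S" if "k \<in> A" for k
    using that nn_integral_ge_point by fastforce
  then have "(\<integral>\<^sup>+k. enn_powr (b k) m \<partial>count_space A) \<le> (\<integral>\<^sup>+k. b k * enn_powr ?S (m - 1) \<partial>count_space A)"
    unfolding split using assms by (intro nn_integral_mono mult_left_mono enn_powr_mono) auto
  also have "\<dots> = enn_powr ?S m"
    by (simp add: nn_integral_multc split)
  finally show ?thesis .
qed

text \<open>Reduces a full sum to finite subsums, on which a quantity to be cancelled is known to be
  finite.\<close>

lemma nn_integral_count_space_int_le:
  fixes h :: "int \<Rightarrow> ennreal"
  assumes "\<And>K. finite K \<Longrightarrow> (\<Sum>k\<in>K. h k) \<le> C"
  shows "(\<integral>\<^sup>+k. h k \<partial>count_space UNIV) \<le> C"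
proof -
  have "h k = (SUP n. h k * indicator {- int n..int n} k)" for k
  proof (rule antisym)
    show "h k \<le> (SUP n. h k * indicator {- int n..int n} k)"
      by (rule SUP_upper2[of "nat \<bar>k\<bar>"]) (auto split: split_indicator)
  qed (auto intro!: SUP_least split: split_indicator)
  then have "(\<integral>\<^sup>+k. h k \<partial>count_space UNIV) = (\<integral>\<^sup>+k. (SUP n. h k * indicator {- int n..int n} k) \<partial>count_space UNIV)"
    by simp
  also have "\<dots> = (SUP n. \<integral>\<^sup>+k. h k * indicator {- int n..int n} k \<partial>count_space UNIV)"
    by (intro nn_integral_monotone_convergence_SUP)
      (auto simp: incseq_def le_fun_def split: split_indicator)
  also have "\<dots> \<le> C"
  proof (rule SUP_least)
    fix n
    have "(\<integral>\<^sup>+k. h k * indicator {- int n..int n} k \<partial>count_space UNIV) = (\<Sum>k\<in>{- int n..int n}. h k)"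
      by (subst nn_integral_count_space'[of "{- int n..int n}"]) auto
    then show "(\<integral>\<^sup>+k. h k * indicator {- int n..int n} k \<partial>count_space UNIV) \<le> C"
      using assms by simp
  qed
  finally show ?thesis .
qed

section \<open>Discretization of the Morrey norm\<close>

text \<open>Transports sets of radii to sets of points, so that half lines, empty levels and
  differences of levels share one notation; X_k is \<open>shell (R k)\<close> and Y_k is
  \<open>shell (R k - R (k + 1))\<close>.\<close>

definition shell :: "real set \<Rightarrow> 'a::euclidean_space set" where
  "shell S = {x. norm x \<in> S}"

lemma shell_atLeast [simp]: "shell {t..} = cball0 t"
  by (auto simp: shell_def in_cball0_iff)

lemma shell_empty [simp]: "shell {} = {}"
  by (simp add: shell_def)

lemma shell_mono: "S \<subseteq> T \<Longrightarrow> shell S \<subseteq> shell T"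
  by (auto simp: shell_def)

lemma shell_Diff: "shell (S - T) = shell S - shell T"
  by (auto simp: shell_def)

context dyadic_levels
begin

lemma shell_R_cases: "shell (R k) = {} \<or> (\<exists>t>0. shell (R k) = cball0 t \<and> F t = 2 powr real_of_int k)"
  using R_cases[of k] by (metis shell_atLeast shell_empty)

lemma shell_R_sets [measurable]: "shell (R k) \<in> sets lebesgue"
  using shell_R_cases[of k] by (metis cball0_sets sets.empty_sets)

lemma annulus_unique:
  assumes "x \<in> shell (R k - R (k + 1))"
  shows "x \<in> shell (R j) \<longleftrightarrow> j \<le> k"
proof
  assume "x \<in> shell (R j)"
  show "j \<le> k"
  proof (rule ccontr)
    assume "\<not> j \<le> k"
    then have "R j \<subseteq> R (k + 1)" by (intro antimonoD[OF R_antimono]) simp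
    with assms \<open>x \<in> shell (R j)\<close> show False by (auto simp: shell_def)
  qed
next
  assume "j \<le> k"
  then have "R k \<subseteq> R j" by (intro antimonoD[OF R_antimono])
  with assms show "x \<in> shell (R j)" by (auto simp: shell_def)
qed

lemma sum_annuli:
  fixes x :: "'a::euclidean_space" and c :: "int \<Rightarrow> ennreal"
  assumes x: "x \<in> shell (R j - R (j + 1))"
  shows "(\<integral>\<^sup>+i. c i * indicator (shell (R i - R (i + 1))) x \<partial>count_space UNIV) = c j"
proof -
  have "i = j" if "x \<in> shell (R i - R (i + 1))" for i
    using annulus_unique[OF x, of i] annulus_unique[OF that, of j] x that
    by (auto simp: shell_def)
  then have "indicator (shell (R i - R (i + 1))) x = (0 :: ennreal)" if "i \<noteq> j" for i
    using that by (meson indicator_simps(2))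
  with x show ?thesis
    by (subst nn_integral_count_space'[of "{j}"]) auto
qed

text \<open>The annuli of index j \<ge> k tile X_k. With h = |f|^q v_2 this exhibits a power of
  N(X_k,f) as a tail sum, the form that Hardy's inequality handles.\<close>

lemma nn_integral_shell_R:
  fixes h :: "'a::euclidean_space \<Rightarrow> ennreal"
  assumes [measurable]: "h \<in> borel_measurable lebesgue"
  shows "(\<integral>\<^sup>+x\<in>shell (R k). h x \<partial>lebesgue) =
    (\<integral>\<^sup>+j\<in>{k..}. (\<integral>\<^sup>+x\<in>shell (R j - R (j + 1)). h x \<partial>lebesgue) \<partial>count_space UNIV)"
proof -
  have [measurable]: "shell (R j - R (j + 1)) \<in> sets (lebesgue :: 'a measure)" for j
    by (simp add: shell_Diff)
  have pt: "indicator (shell (R k)) x = (\<integral>\<^sup>+j. indicator {k..} j * indicator (shell (R j - R (j + 1))) x \<partial>count_space UNIV :: ennreal)"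
    for x :: 'a
  proof (cases "\<exists>j. x \<in> shell (R j - R (j + 1))")
    case True
    then obtain j where "x \<in> shell (R j - R (j + 1))" by blast
    then show ?thesis
      using annulus_unique[of x j k] by (subst sum_annuli) (auto simp: indicator_def)
  next
    \<comment> \<open>Only the origin can miss all annuli, and it lies in no X_k because the
      thresholds are positive.\<close>
    case False
    then have "x \<notin> shell (R k)"
      using R_cover[of "norm x"] R_cases[of k] by (fastforce simp: shell_def)
    moreover have "indicator (shell (R j - R (j + 1))) x = (0::ennreal)" for j
      using False by simp
    ultimately show ?thesis by simp
  qed
  have "(\<integral>\<^sup>+x\<in>shell (R k). h x \<partial>lebesgue) =
    (\<integral>\<^sup>+x. \<integral>\<^sup>+j. h x * indicator (shell (R j - R (j + 1))) x * indicator {k..} j \<partial>count_space UNIV \<partial>lebesgue)"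
    unfolding pt by (intro nn_integral_cong) (simp add: mult_ac flip: nn_integral_cmult)
  also have "\<dots> = (\<integral>\<^sup>+j. \<integral>\<^sup>+x. h x * indicator (shell (R j - R (j + 1))) x * indicator {k..} j \<partial>lebesgue \<partial>count_space UNIV)"
    by (subst nn_integral_count_space_nn_integral) auto
  also have "\<dots> = (\<integral>\<^sup>+j\<in>{k..}. (\<integral>\<^sup>+x\<in>shell (R j - R (j + 1)). h x \<partial>lebesgue) \<partial>count_space UNIV)"
    by (simp add: nn_integral_multc)
  finally show ?thesis .
qed

lemma sum_nn_integral_annuli_le:
  fixes h :: "'a::euclidean_space \<Rightarrow> ennreal"
  assumes [measurable]: "h \<in> borel_measurable lebesgue"
  shows "(\<integral>\<^sup>+j. (\<integral>\<^sup>+x\<in>shell (R j - R (j + 1)). h x \<partial>lebesgue) \<partial>count_space UNIV) \<le> (\<integral>\<^sup>+x. h x \<partial>lebesgue)"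
proof -
  have [measurable]: "shell (R j - R (j + 1)) \<in> sets (lebesgue :: 'a measure)" for j
    by (simp add: shell_Diff)
  have "(\<integral>\<^sup>+j. (\<integral>\<^sup>+x\<in>shell (R j - R (j + 1)). h x \<partial>lebesgue) \<partial>count_space UNIV) =
    (\<integral>\<^sup>+x. \<integral>\<^sup>+j. h x * indicator (shell (R j - R (j + 1))) x \<partial>count_space UNIV \<partial>lebesgue)"
    by (subst nn_integral_count_space_nn_integral) auto
  also have "\<dots> \<le> (\<integral>\<^sup>+x. h x \<partial>lebesgue)"
  proof (rule nn_integral_mono)
    fix x :: 'a
    show "(\<integral>\<^sup>+j. h x * indicator (shell (R j - R (j + 1))) x \<partial>count_space UNIV) \<le> h x"
    proof (cases "\<exists>j. x \<in> shell (R j - R (j + 1))")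
      case True
      then show ?thesis by (auto simp: sum_annuli)
    next
      case False
      then have "indicator (shell (R j - R (j + 1))) x = (0::ennreal)" for j by simp
      then show ?thesis by simp
    qed
  qed
  finally show ?thesis .
qed

end

text \<open>Finite p_1 and p_2, so that norms can be raised to powers, while \<open>s\<close> may
  still be infinite: the case p_1 = p_2 is included.\<close>

locale sharp_Holder_finite = sharp_Holder "ereal p" "ereal q" s v1 v2 u
  for p q :: real and s :: ereal and v1 v2 u :: "'a::euclidean_space \<Rightarrow> real"
begin

lemma pq_pos: "0 < p" "0 < q"
  using pos by auto

lemma Lp_norm_powr: "enn_powr (Lp_norm (ereal p) v1 f) p = (\<integral>\<^sup>+x. enn_powr (ennreal \<bar>f x\<bar>) p * ennreal (v1 x) \<partial>lebesgue)"
  using pq_pos by (simp add: Lp_norm_def wnorm_ereal enn_powr_inv)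

lemma cLM_norm_powr:
  assumes "0 < th" "\<omega> \<in> cOmega (ereal th)"
  shows "enn_powr (cLM_norm (ereal q) (ereal th) \<omega> v2 f) th =
    (\<integral>\<^sup>+r\<in>{0<..}. ennreal (\<omega> r powr th) * enn_powr (N (cball0 r) f) th \<partial>lebesgue)"
proof -
  have "0 \<le> \<omega> r" if "0 < r" for r
    using assms(2) that by (auto simp: cOmega_def)
  then have "(\<integral>\<^sup>+r\<in>{0<..}. enn_powr (ennreal (\<omega> r) * N (cball0 r) f) th \<partial>lebesgue) =
    (\<integral>\<^sup>+r\<in>{0<..}. ennreal (\<omega> r powr th) * enn_powr (N (cball0 r) f) th \<partial>lebesgue)"
    by (intro nn_integral_cong) (auto simp: enn_powr_mult enn_powr_ennreal split: split_indicator)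
  then show ?thesis
    using assms(1) by (simp add: cLM_norm_def unorm_ereal enn_powr_inv)
qed

lemma
  assumes "0 < th" "\<omega> \<in> cOmega (ereal th)" "dyadic_levels th \<omega> F R"
  shows cLM_norm_le_level_sum: "enn_powr (cLM_norm (ereal q) (ereal th) \<omega> v2 f) th \<le>
      2 * (\<integral>\<^sup>+k. ennreal (2 powr real_of_int k) * enn_powr (N (shell (R k)) f) th \<partial>count_space UNIV)"
    and level_sum_le_cLM_norm: "(\<integral>\<^sup>+k. ennreal (2 powr real_of_int k) * enn_powr (N (shell (R k)) f) th \<partial>count_space UNIV)
      \<le> 2 * enn_powr (cLM_norm (ereal q) (ereal th) \<omega> v2 f) th"
proof -
  interpret dyadic_levels th \<omega> F R by fact
  let ?H = "\<lambda>S. enn_powr (N (shell S) f) th"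
  have H: "mono ?H" "?H {} = 0"
    using assms(1) pos by (auto intro!: monoI enn_powr_mono N_mono shell_mono wnorm_zero)
  have "(\<integral>\<^sup>+r\<in>{0<..}. ennreal (\<omega> r powr th) * ennreal (F r powr 0) * ?H {r..} \<partial>lebesgue)
    = enn_powr (cLM_norm (ereal q) (ereal th) \<omega> v2 f) th"
    \<comment> \<open>Positivity of F makes \<open>F r powr 0\<close> equal to 1; at a zero of F
      this power would be 0.\<close>
    unfolding cLM_norm_powr[OF assms(1,2)] using F_pos
    by (intro nn_integral_cong) (auto simp: less_le split: split_indicator)
  then show "enn_powr (cLM_norm (ereal q) (ereal th) \<omega> v2 f) th \<le>
      2 * (\<integral>\<^sup>+k. ennreal (2 powr real_of_int k) * enn_powr (N (shell (R k)) f) th \<partial>count_space UNIV)"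
    "(\<integral>\<^sup>+k. ennreal (2 powr real_of_int k) * enn_powr (N (shell (R k)) f) th \<partial>count_space UNIV)
      \<le> 2 * enn_powr (cLM_norm (ereal q) (ereal th) \<omega> v2 f) th"
    using integral_le_sum[OF _ H, of 0] sum_le_integral[OF _ H, of 0] by simp_all
qed

text \<open>Hoelder's inequality for f cut off to A, so that only the part of the norm of f living
  on A appears. This local form is the one that can be summed over disjoint annuli.\<close>

lemma N_annulus_le:
  assumes f: "f \<in> borel_measurable lebesgue" "Lp_norm (ereal p) v1 f < \<infinity>" and A: "A \<in> sets lebesgue"
  shows "N A f \<le> enn_powr (\<integral>\<^sup>+x\<in>A. enn_powr (ennreal \<bar>f x\<bar>) p * ennreal (v1 x) \<partial>lebesgue) (1 / p) * V A"
proof -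
  let ?g = "\<lambda>x. f x * indicator A x"
  have g: "?g \<in> borel_measurable lebesgue" using f A by measurable
  have Lg: "Lp_norm (ereal p) v1 ?g = enn_powr (\<integral>\<^sup>+x\<in>A. enn_powr (ennreal \<bar>f x\<bar>) p * ennreal (v1 x) \<partial>lebesgue) (1 / p)"
    unfolding Lp_norm_def wnorm_ereal
    by (intro arg_cong[where f = "\<lambda>x. enn_powr x _"] nn_integral_cong) (auto split: split_indicator)
  have "Lp_norm (ereal p) v1 ?g \<le> Lp_norm (ereal p) v1 f"
    unfolding Lp_norm_def by (intro wnorm_mono pos) (auto split: split_indicator)
  then have "Lp_norm (ereal p) v1 ?g < \<infinity>" using f(2) by (rule le_less_trans)
  have "N A f \<le> N A ?g" by (intro wnorm_mono pos) auto
  also have "\<dots> \<le> Lp_norm (ereal p) v1 ?g * V A"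
    by (rule Holder) fact+
  finally show ?thesis unfolding Lg .
qed

text \<open>N^\<theta> is the power \<theta>/q of an integral, so Hardy's inequality is used with m
  = \<theta>/q and with a_j the integral of |f|^q v_2 over Y_j. The cases p \<le> \<theta> and
  \<theta> < p share this estimate and differ in how the remaining sum over k is bounded.\<close>

lemma cLM_norm_le_annuli:
  assumes th: "0 < th"
  obtains C where "0 < C"
    "\<And>\<omega> F R f. \<omega> \<in> cOmega (ereal th) \<Longrightarrow> dyadic_levels th \<omega> F R \<Longrightarrow>
      f \<in> borel_measurable lebesgue \<Longrightarrow> Lp_norm (ereal p) v1 f < \<infinity> \<Longrightarrow>
      enn_powr (cLM_norm (ereal q) (ereal th) \<omega> v2 f) th \<le> ennreal C *
        (\<integral>\<^sup>+k. ennreal (2 powr real_of_int k) *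
          (enn_powr (\<integral>\<^sup>+x\<in>shell (R k - R (k + 1)). enn_powr (ennreal \<bar>f x\<bar>) p * ennreal (v1 x) \<partial>lebesgue) (th / p)
            * enn_powr (V (shell (R k))) th) \<partial>count_space UNIV)"
proof -
  have m: "0 < th / q" using th pq_pos by simp
  obtain C :: real where C: "0 < C"
    "\<And>a :: int \<Rightarrow> ennreal. (\<integral>\<^sup>+k. ennreal (2 powr k) *
        enn_powr (\<integral>\<^sup>+j\<in>{k..}. a j \<partial>count_space UNIV) (th / q) \<partial>count_space UNIV)
      \<le> ennreal C * (\<integral>\<^sup>+k. ennreal (2 powr k) * enn_powr (a k) (th / q) \<partial>count_space UNIV)"
    by (rule discrete_Hardy[OF m], rule that)
  show thesis
  proof (rule that[of "2 * C"])
    show "0 < 2 * C" using C by simp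
    fix \<omega> F R and f :: "'a \<Rightarrow> real"
    assume \<omega>: "\<omega> \<in> cOmega (ereal th)" and levels: "dyadic_levels th \<omega> F R"
      and f: "f \<in> borel_measurable lebesgue" "Lp_norm (ereal p) v1 f < \<infinity>"
    interpret dyadic_levels th \<omega> F R by fact
    note [measurable] = f(1)
    let ?h = "\<lambda>x. enn_powr (ennreal \<bar>f x\<bar>) q * ennreal (v2 x)"
    let ?G = "\<lambda>A. \<integral>\<^sup>+x\<in>A. enn_powr (ennreal \<bar>f x\<bar>) p * ennreal (v1 x) \<partial>lebesgue"
    have N_powr: "enn_powr (N A f) th = enn_powr (\<integral>\<^sup>+x\<in>A. ?h x \<partial>lebesgue) (th / q)" for A
      by (simp add: wnorm_ereal enn_powr_powr)
    have "enn_powr (cLM_norm (ereal q) (ereal th) \<omega> v2 f) th \<le>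
      2 * (\<integral>\<^sup>+k. ennreal (2 powr real_of_int k) * enn_powr (N (shell (R k)) f) th \<partial>count_space UNIV)"
      by (rule cLM_norm_le_level_sum) fact+
    also have "\<dots> = 2 * (\<integral>\<^sup>+k. ennreal (2 powr real_of_int k) *
        enn_powr (\<integral>\<^sup>+j\<in>{k..}. (\<integral>\<^sup>+x\<in>shell (R j - R (j + 1)). ?h x \<partial>lebesgue) \<partial>count_space UNIV) (th / q) \<partial>count_space UNIV)"
      unfolding N_powr by (subst nn_integral_shell_R) auto
    also have "\<dots> \<le> 2 * (ennreal C * (\<integral>\<^sup>+k. ennreal (2 powr real_of_int k) *
        enn_powr (\<integral>\<^sup>+x\<in>shell (R k - R (k + 1)). ?h x \<partial>lebesgue) (th / q) \<partial>count_space UNIV))"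
      by (intro mult_left_mono C) auto
    also have "\<dots> = ennreal (2 * C) * (\<integral>\<^sup>+k. ennreal (2 powr real_of_int k) *
        enn_powr (N (shell (R k - R (k + 1))) f) th \<partial>count_space UNIV)"
      using C(1) by (simp add: N_powr ennreal_mult mult.assoc)
    also have "\<dots> \<le> ennreal (2 * C) * (\<integral>\<^sup>+k. ennreal (2 powr real_of_int k) *
          (enn_powr (?G (shell (R k - R (k + 1)))) (th / p) * enn_powr (V (shell (R k))) th) \<partial>count_space UNIV)"
    proof (intro mult_left_mono nn_integral_mono)
      fix k :: int
      let ?Y = "shell (R k - R (k + 1)) :: 'a set"
      have "N ?Y f \<le> enn_powr (?G ?Y) (1 / p) * V ?Y"
        by (intro N_annulus_le f) (simp add: shell_Diff)
      \<comment> \<open>Enlarging the annulus in V only is admissible: the claimed bounds involve V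
        of complements of balls, while the part of f stays localized.\<close>
      also have "\<dots> \<le> enn_powr (?G ?Y) (1 / p) * V (shell (R k))"
        by (intro mult_left_mono V_mono shell_mono) auto
      finally have "enn_powr (N ?Y f) th \<le> enn_powr (enn_powr (?G ?Y) (1 / p) * V (shell (R k))) th"
        using th by (intro enn_powr_mono) auto
      then show "enn_powr (N ?Y f) th \<le> enn_powr (?G ?Y) (th / p) * enn_powr (V (shell (R k))) th"
        by (simp add: enn_powr_mult enn_powr_powr)
    qed auto
    finally show "enn_powr (cLM_norm (ereal q) (ereal th) \<omega> v2 f) th \<le> ennreal (2 * C) *
        (\<integral>\<^sup>+k. ennreal (2 powr real_of_int k) *
          (enn_powr (?G (shell (R k - R (k + 1)))) (th / p) * enn_powr (V (shell (R k))) th) \<partial>count_space UNIV)" .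
  qed
qed

lemma Id_norm_le_of_powr_le:
  assumes "0 < th" "0 < C"
    and le: "\<And>f. f \<in> borel_measurable lebesgue \<Longrightarrow> Lp_norm (ereal p) v1 f < \<infinity> \<Longrightarrow>
      enn_powr (cLM_norm (ereal q) (ereal th) \<omega> v2 f) th \<le> ennreal C * enn_powr (B * Lp_norm (ereal p) v1 f) th"
  shows "Id_norm (ereal p) v1 (ereal q) (ereal th) \<omega> v2 \<le> ennreal (C powr (1 / th)) * B"
proof (rule Id_norm_leI)
  fix f :: "'a \<Rightarrow> real" assume f: "f \<in> borel_measurable lebesgue" "Lp_norm (ereal p) v1 f < \<infinity>"
  have "enn_powr (enn_powr (cLM_norm (ereal q) (ereal th) \<omega> v2 f) th) (1 / th)
      \<le> enn_powr (ennreal C * enn_powr (B * Lp_norm (ereal p) v1 f) th) (1 / th)"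
    using assms(1) by (intro enn_powr_mono le f) auto
  then show "cLM_norm (ereal q) (ereal th) \<omega> v2 f \<le> ennreal (C powr (1 / th)) * B * Lp_norm (ereal p) v1 f"
    using assms(1,2) by (simp add: enn_powr_inv enn_powr_mult enn_powr_ennreal mult.assoc)
qed (fact pos v1)+

lemma Id_norm_le_exponent:
  assumes "p \<le> th"
  shows "unif_equiv (\<lambda>\<omega>. \<omega> \<in> cOmega (ereal th)) (\<lambda>\<omega>. Id_norm (ereal p) v1 (ereal q) (ereal th) \<omega> v2)
     (\<lambda>\<omega>. SUP t\<in>{0<..}. W (ereal th) \<omega> t * V (cball0 t))"
proof -
  have th: "0 < th" using assms pq_pos by simp
  obtain C where C: "0 < C"
    "\<And>\<omega> F R f. \<omega> \<in> cOmega (ereal th) \<Longrightarrow> dyadic_levels th \<omega> F R \<Longrightarrow>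
      f \<in> borel_measurable lebesgue \<Longrightarrow> Lp_norm (ereal p) v1 f < \<infinity> \<Longrightarrow>
      enn_powr (cLM_norm (ereal q) (ereal th) \<omega> v2 f) th \<le> ennreal C *
        (\<integral>\<^sup>+k. ennreal (2 powr real_of_int k) *
          (enn_powr (\<integral>\<^sup>+x\<in>shell (R k - R (k + 1)). enn_powr (ennreal \<bar>f x\<bar>) p * ennreal (v1 x) \<partial>lebesgue) (th / p)
            * enn_powr (V (shell (R k))) th) \<partial>count_space UNIV)"
    by (rule cLM_norm_le_annuli[OF th], rule that)
  show ?thesis
  proof (rule unif_equivI[of "C powr (1 / th)" 1])
    fix \<omega> assume \<omega>: "\<omega> \<in> cOmega (ereal th)"
    let ?A = "SUP t\<in>{0<..}. W (ereal th) \<omega> t * V (cball0 t)"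
    show "?A \<le> ennreal 1 * Id_norm (ereal p) v1 (ereal q) (ereal th) \<omega> v2"
      using \<omega> th by (auto intro!: SUP_least W_times_V_le_Id_norm)
    obtain F R where levels: "dyadic_levels th \<omega> F R"
      using cOmega_dyadic_levels[OF th \<omega>] by blast
    interpret dyadic_levels th \<omega> F R by fact
    \<comment> \<open>A nonempty X_k is \<open>cball0 t\<close> with F t = 2^k, and F is the
      \<theta>-th power of W; so the left side is the \<theta>-th power of one member of the
      supremum.\<close>
    have A: "ennreal (2 powr real_of_int k) * enn_powr (V (shell (R k))) th \<le> enn_powr ?A th" for k
    proof (cases "shell (R k) = ({} :: 'a set)")
      case False
      then obtain t where t: "0 < t" "shell (R k) = (cball0 t :: 'a set)" "F t = 2 powr real_of_int k"
        using shell_R_cases[of k, where 'a = 'a] by blast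
      have "ennreal (2 powr real_of_int k) * enn_powr (V (shell (R k))) th = enn_powr (W (ereal th) \<omega> t * V (cball0 t)) th"
        unfolding enn_powr_mult unorm_eq[OF t(1)] t(2) t(3) using th by (simp add: enn_powr_ennreal powr_powr)
      also have "\<dots> \<le> enn_powr ?A th"
        using th t(1) by (intro enn_powr_mono SUP_upper) auto
      finally show ?thesis .
    qed (use pos in simp)
    show "Id_norm (ereal p) v1 (ereal q) (ereal th) \<omega> v2 \<le> ennreal (C powr (1 / th)) * ?A"
    proof (rule Id_norm_le_of_powr_le[OF th C(1)])
      fix f :: "'a \<Rightarrow> real"
      assume f: "f \<in> borel_measurable lebesgue" "Lp_norm (ereal p) v1 f < \<infinity>"
      note [measurable] = f(1)
      let ?b = "\<lambda>k. \<integral>\<^sup>+x\<in>shell (R k - R (k + 1)). enn_powr (ennreal \<bar>f x\<bar>) p * ennreal (v1 x) \<partial>lebesgue"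
      have "(\<integral>\<^sup>+k. ennreal (2 powr real_of_int k) * (enn_powr (?b k) (th / p) * enn_powr (V (shell (R k))) th) \<partial>count_space UNIV)
        \<le> (\<integral>\<^sup>+k. enn_powr ?A th * enn_powr (?b k) (th / p) \<partial>count_space UNIV)"
      proof (rule nn_integral_mono)
        fix k :: int
        show "ennreal (2 powr real_of_int k) * (enn_powr (?b k) (th / p) * enn_powr (V (shell (R k))) th)
          \<le> enn_powr ?A th * enn_powr (?b k) (th / p)"
          using mult_right_mono[OF A[of k], of "enn_powr (?b k) (th / p)"] by (simp add: mult_ac)
      qed
      also have "\<dots> = enn_powr ?A th * (\<integral>\<^sup>+k. enn_powr (?b k) (th / p) \<partial>count_space UNIV)"
        by (simp add: nn_integral_cmult)
      \<comment> \<open>Here p \<le> \<theta> is decisive: the exponent \<theta>/p is at least 1, so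
        the powers of the local energies sum to at most the power of their sum.\<close>
      also have "\<dots> \<le> enn_powr ?A th * enn_powr (\<integral>\<^sup>+k. ?b k \<partial>count_space UNIV) (th / p)"
        using assms pq_pos by (intro mult_left_mono sum_powr_le_powr_sum) auto
      also have "\<dots> \<le> enn_powr ?A th * enn_powr (enn_powr (Lp_norm (ereal p) v1 f) p) (th / p)"
        unfolding Lp_norm_powr using th pq_pos
        by (intro mult_left_mono enn_powr_mono sum_nn_integral_annuli_le) auto
      also have "\<dots> = enn_powr (?A * Lp_norm (ereal p) v1 f) th"
        using pq_pos by (simp add: enn_powr_mult enn_powr_powr)
      finally have "ennreal C * (\<integral>\<^sup>+k. ennreal (2 powr real_of_int k) * (enn_powr (?b k) (th / p) * enn_powr (V (shell (R k))) th) \<partial>count_space UNIV)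
        \<le> ennreal C * enn_powr (?A * Lp_norm (ereal p) v1 f) th"
        by (rule mult_left_mono) simp
      with C(2)[OF \<omega> levels f]
      show "enn_powr (cLM_norm (ereal q) (ereal th) \<omega> v2 f) th \<le> ennreal C * enn_powr (?A * Lp_norm (ereal p) v1 f) th"
        by (rule order_trans)
    qed
  qed (use C in auto)
qed

end

section \<open>The case \<open>\<theta> < p_1\<close>\<close>

text \<open>Dividing by s^a leaves s^(1-a) on the left. \<open>s\<close> is a real number, as an
  infinite value could not be cancelled.\<close>

lemma ennreal_self_bound:
  assumes "0 < a" "a < 1" "0 \<le> s" "0 < D" "ennreal s \<le> ennreal D * enn_powr (ennreal s) a * J"
  shows "ennreal s \<le> enn_powr (ennreal D * J) (1 / (1 - a))"
proof (cases "s = 0")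
  case False
  then have s: "0 < s" using assms(3) by simp
  have "ennreal (s powr (1 - a)) = ennreal (s powr (- a)) * ennreal s"
    using s by (simp add: powr_diff powr_minus_divide flip: ennreal_mult)
  also have "\<dots> \<le> ennreal (s powr (- a)) * (ennreal D * enn_powr (ennreal s) a * J)"
    by (rule mult_left_mono) (use assms in auto)
  also have "\<dots> = (ennreal (s powr (- a)) * ennreal (s powr a)) * (ennreal D * J)"
    using s by (simp add: enn_powr_ennreal mult_ac)
  also have "ennreal (s powr (- a)) * ennreal (s powr a) = 1"
    using s by (simp add: powr_minus_divide flip: ennreal_mult)
  finally have "enn_powr (ennreal s) (1 - a) \<le> ennreal D * J"
    using s by (simp add: enn_powr_ennreal)
  then show ?thesis using assms by (simp add: enn_powr_le_swap)
qed simp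

context sharp_Holder_finite
begin

text \<open>With \<rho> = \<theta> p / (p - \<theta>), the \<rho>-th power of this norm is the
  integral of \<omega>^\<theta> F^(\<rho>/p) V^\<rho>, since W is the power 1/\<theta> of F.\<close>

definition level_energy :: "real \<Rightarrow> (real \<Rightarrow> real) \<Rightarrow> ennreal" where
  "level_energy th \<omega> = wnorm lebesgue (ereal (th * p / (p - th))) {0<..} (\<lambda>t. ennreal (\<omega> t powr th))
     (\<lambda>t. enn_powr (W (ereal th) \<omega> t) (th / p) * V (cball0 t))"

text \<open>The comparison of integrals and level sums for \<kappa> = \<rho>/p; here 1 + \<kappa> =
  \<rho>/\<theta> because 1/\<rho> = 1/\<theta> - 1/p.\<close>

lemma
  assumes th: "0 < th" "th < p" and \<omega>: "\<omega> \<in> cOmega (ereal th)" and "dyadic_levels th \<omega> F R"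
  defines "\<rho> \<equiv> th * p / (p - th)"
  shows level_energy_le_sum: "enn_powr (level_energy th \<omega>) \<rho> \<le> ennreal (2 powr (\<rho> / th)) *
      (\<integral>\<^sup>+k. ennreal (2 powr (\<rho> / th * real_of_int k)) * enn_powr (V (shell (R k))) \<rho> \<partial>count_space UNIV)"
    and sum_le_level_energy: "(\<integral>\<^sup>+k. ennreal (2 powr (\<rho> / th * real_of_int k)) * enn_powr (V (shell (R k))) \<rho> \<partial>count_space UNIV)
      \<le> ennreal (2 powr (\<rho> / th)) * enn_powr (level_energy th \<omega>) \<rho>"
proof -
  interpret dyadic_levels th \<omega> F R by fact
  let ?H = "\<lambda>S. enn_powr (V (shell S)) \<rho>"
  have \<rho>: "0 < \<rho>" using th by (simp add: \<rho>_def)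
  have \<kappa>: "0 \<le> \<rho> / p" "1 + \<rho> / p = \<rho> / th"
    using th by (auto simp: \<rho>_def field_simps)
  have H: "mono ?H" "?H {} = 0"
    using \<rho> pos by (auto intro!: monoI enn_powr_mono V_mono shell_mono)
  have "(\<integral>\<^sup>+r\<in>{0<..}. ennreal (\<omega> r powr th) * ennreal (F r powr (\<rho> / p)) * ?H {r..} \<partial>lebesgue)
    = (\<integral>\<^sup>+r\<in>{0<..}. enn_powr (enn_powr (W (ereal th) \<omega> r) (th / p) * V (cball0 r)) \<rho> * ennreal (\<omega> r powr th) \<partial>lebesgue)"
    using th by (intro nn_integral_cong)
      (auto simp: unorm_eq enn_powr_mult enn_powr_ennreal powr_powr mult_ac split: split_indicator)
  also have "\<dots> = enn_powr (level_energy th \<omega>) \<rho>"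
    using \<rho> unfolding level_energy_def \<rho>_def[symmetric] wnorm_ereal by (simp add: enn_powr_inv)
  finally show "enn_powr (level_energy th \<omega>) \<rho> \<le> ennreal (2 powr (\<rho> / th)) *
      (\<integral>\<^sup>+k. ennreal (2 powr (\<rho> / th * real_of_int k)) * enn_powr (V (shell (R k))) \<rho> \<partial>count_space UNIV)"
    "(\<integral>\<^sup>+k. ennreal (2 powr (\<rho> / th * real_of_int k)) * enn_powr (V (shell (R k))) \<rho> \<partial>count_space UNIV)
      \<le> ennreal (2 powr (\<rho> / th)) * enn_powr (level_energy th \<omega>) \<rho>"
    using integral_le_sum[OF \<kappa>(1) H] sum_le_integral[OF \<kappa>(1) H] by (simp_all add: \<kappa>(2))
qed

text \<open>Hoelder over the levels with exponents \<theta>/p and \<theta>/\<rho>: the first factor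
  sums the local energies of f, the second is the discretized outer norm. \<open>?H k\<close> is
  chosen so that its power \<theta>/\<rho> is 2^k V(X_k)^\<theta>.\<close>

lemma Id_norm_le_level_energy:
  assumes th: "0 < th" "th < p"
  obtains C where "0 < C"
    "\<And>\<omega>. \<omega> \<in> cOmega (ereal th) \<Longrightarrow> Id_norm (ereal p) v1 (ereal q) (ereal th) \<omega> v2 \<le> ennreal C * level_energy th \<omega>"
proof -
  define \<rho> where "\<rho> = th * p / (p - th)"
  have \<rho>: "0 < \<rho>" "th / p + th / \<rho> = 1" "0 < th / p" "0 < th / \<rho>"
    using th by (auto simp: \<rho>_def field_simps)
  obtain C where C: "0 < C"
    "\<And>\<omega> F R f. \<omega> \<in> cOmega (ereal th) \<Longrightarrow> dyadic_levels th \<omega> F R \<Longrightarrow>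
      f \<in> borel_measurable lebesgue \<Longrightarrow> Lp_norm (ereal p) v1 f < \<infinity> \<Longrightarrow>
      enn_powr (cLM_norm (ereal q) (ereal th) \<omega> v2 f) th \<le> ennreal C *
        (\<integral>\<^sup>+k. ennreal (2 powr real_of_int k) *
          (enn_powr (\<integral>\<^sup>+x\<in>shell (R k - R (k + 1)). enn_powr (ennreal \<bar>f x\<bar>) p * ennreal (v1 x) \<partial>lebesgue) (th / p)
            * enn_powr (V (shell (R k))) th) \<partial>count_space UNIV)"
    by (rule cLM_norm_le_annuli[OF th(1)], rule that)
  show thesis
  proof (rule that)
    show "0 < (2 * C) powr (1 / th)" using C by simp
    fix \<omega> assume \<omega>: "\<omega> \<in> cOmega (ereal th)"
    let ?B = "level_energy th \<omega>"
    obtain F R where levels: "dyadic_levels th \<omega> F R"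
      using cOmega_dyadic_levels[OF th(1) \<omega>] by blast
    interpret dyadic_levels th \<omega> F R by fact
    let ?H = "\<lambda>k. ennreal (2 powr (\<rho> / th * real_of_int k)) * enn_powr (V (shell (R k))) \<rho>"
    have sumH: "(\<integral>\<^sup>+k. ?H k \<partial>count_space UNIV) \<le> ennreal (2 powr (\<rho> / th)) * enn_powr ?B \<rho>"
      unfolding \<rho>_def by (rule sum_le_level_energy) fact+
    have H: "enn_powr (?H k) (th / \<rho>) = ennreal (2 powr real_of_int k) * enn_powr (V (shell (R k))) th" for k
      using \<rho>(1) th by (simp add: enn_powr_mult enn_powr_ennreal enn_powr_powr powr_powr)
    have "enn_powr (ennreal (2 powr (\<rho> / th)) * enn_powr ?B \<rho>) (th / \<rho>) = 2 * enn_powr ?B th"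
      using \<rho>(1) th by (simp add: enn_powr_mult enn_powr_ennreal enn_powr_powr powr_powr)
    then have sumH': "enn_powr (\<integral>\<^sup>+k. ?H k \<partial>count_space UNIV) (th / \<rho>) \<le> 2 * enn_powr ?B th"
      using enn_powr_mono[OF sumH, of "th / \<rho>"] \<rho>(4) by simp
    show "Id_norm (ereal p) v1 (ereal q) (ereal th) \<omega> v2 \<le> ennreal ((2 * C) powr (1 / th)) * ?B"
    proof (rule Id_norm_le_of_powr_le)
      fix f :: "'a \<Rightarrow> real"
      assume f: "f \<in> borel_measurable lebesgue" "Lp_norm (ereal p) v1 f < \<infinity>"
      note [measurable] = f(1)
      let ?b = "\<lambda>k. \<integral>\<^sup>+x\<in>shell (R k - R (k + 1)). enn_powr (ennreal \<bar>f x\<bar>) p * ennreal (v1 x) \<partial>lebesgue"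
      have "(\<integral>\<^sup>+k. ennreal (2 powr real_of_int k) * (enn_powr (?b k) (th / p) * enn_powr (V (shell (R k))) th) \<partial>count_space UNIV)
        = (\<integral>\<^sup>+k. enn_powr (?b k) (th / p) * enn_powr (?H k) (th / \<rho>) \<partial>count_space UNIV)"
        unfolding H by (simp add: mult_ac)
      also have "\<dots> \<le> enn_powr (\<integral>\<^sup>+k. ?b k \<partial>count_space UNIV) (th / p) *
          enn_powr (\<integral>\<^sup>+k. ?H k \<partial>count_space UNIV) (th / \<rho>)"
        using \<rho> by (intro nn_integral_Holder) auto
      also have "\<dots> \<le> enn_powr (enn_powr (Lp_norm (ereal p) v1 f) p) (th / p) * (2 * enn_powr ?B th)"
        unfolding Lp_norm_powr using th pq_pos
        by (intro mult_mono enn_powr_mono sum_nn_integral_annuli_le sumH') auto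
      also have "\<dots> = 2 * enn_powr (?B * Lp_norm (ereal p) v1 f) th"
        using pq_pos by (simp add: enn_powr_mult enn_powr_powr mult_ac)
      finally have "ennreal C * (\<integral>\<^sup>+k. ennreal (2 powr real_of_int k) * (enn_powr (?b k) (th / p) * enn_powr (V (shell (R k))) th) \<partial>count_space UNIV)
        \<le> ennreal C * (2 * enn_powr (?B * Lp_norm (ereal p) v1 f) th)"
        by (rule mult_left_mono) simp
      also have "\<dots> = ennreal (2 * C) * enn_powr (?B * Lp_norm (ereal p) v1 f) th"
        using C(1) by (simp add: ennreal_mult mult_ac)
      finally have "ennreal C * (\<integral>\<^sup>+k. ennreal (2 powr real_of_int k) * (enn_powr (?b k) (th / p) * enn_powr (V (shell (R k))) th) \<partial>count_space UNIV)
        \<le> ennreal (2 * C) * enn_powr (?B * Lp_norm (ereal p) v1 f) th" .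
      with C(2)[OF \<omega> levels f]
      show "enn_powr (cLM_norm (ereal q) (ereal th) \<omega> v2 f) th \<le> ennreal (2 * C) * enn_powr (?B * Lp_norm (ereal p) v1 f) th"
        by (rule order_trans)
    qed (use th C in auto)
  qed
qed

text \<open>Turns sharpness, which speaks of numbers below V, into one function per set at the price
  of a factor 2. Finiteness of V makes V/2 an admissible number when V is positive.\<close>

lemma half_sharp:
  assumes "A \<in> sets lebesgue" "V A < top"
  shows "\<exists>f \<in> borel_measurable lebesgue. Lp_norm (ereal p) v1 f \<le> 1 \<and> V A \<le> 2 * N A f"
proof (cases "V A = 0")
  case True
  have "Lp_norm (ereal p) v1 (\<lambda>x. 0) = 0"
    unfolding Lp_norm_def by (intro wnorm_zero pos) auto
  with True show ?thesis by (intro bexI[of _ "\<lambda>x. 0"]) auto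
next
  case False
  obtain y where y: "V A = ennreal y" "0 < y"
    using assms(2) False by (cases "V A") (auto simp: less_le)
  then have "ennreal (y / 2) < V A" by (simp add: ennreal_lessI)
  then obtain f where f: "f \<in> borel_measurable lebesgue" "Lp_norm (ereal p) v1 f \<le> 1" "ennreal (y / 2) \<le> N A f"
    using sharp[OF assms(1)] by blast
  have "V A = 2 * ennreal (y / 2)"
    using y by (simp flip: ennreal_numeral ennreal_mult)
  also have "\<dots> \<le> 2 * N A f" using f(3) by (rule mult_left_mono) simp
  finally show ?thesis using f by blast
qed

text \<open>For a finite partial sum S of the discretized outer norm, testing yields S \<le> D
  S^(\<theta>/p) I^\<theta> with I the operator norm. Cancelling gives S \<le> D^(\<rho>/\<theta>)
  I^\<rho>, a bound free of the chosen finite set.\<close>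

lemma level_energy_le_Id_norm:
  assumes th: "0 < th" "th < p"
  obtains C where "0 < C"
    "\<And>\<omega>. \<omega> \<in> cOmega (ereal th) \<Longrightarrow> level_energy th \<omega> \<le> ennreal C * Id_norm (ereal p) v1 (ereal q) (ereal th) \<omega> v2"
proof -
  define \<rho> where "\<rho> = th * p / (p - th)"
  \<comment> \<open>A factor 2 is lost in passing from the level sum to the Morrey norm, and
    2^\<theta> through the factor 2 in \<open>half_sharp\<close>.\<close>
  define D :: real where "D = 2 * 2 powr th"
  have \<rho>: "0 < \<rho>" "\<rho> / p * th + th = \<rho>" "1 / (1 - th / p) = \<rho> / th" "0 < th / p" "th / p < 1"
    using th by (auto simp: \<rho>_def field_simps)
  have D: "0 < D" by (simp add: D_def)
  show thesis
  proof (rule that)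
    show "0 < 2 powr (1 / th) * D powr (1 / th)" using D by simp
    fix \<omega> assume \<omega>: "\<omega> \<in> cOmega (ereal th)"
    let ?I = "Id_norm (ereal p) v1 (ereal q) (ereal th) \<omega> v2"
    obtain F R where levels: "dyadic_levels th \<omega> F R"
      using cOmega_dyadic_levels[OF th(1) \<omega>] by blast
    interpret dyadic_levels th \<omega> F R by fact
    have sets: "shell (R k) \<in> sets (lebesgue :: 'a measure)" for k by (rule shell_R_sets)
    show "level_energy th \<omega> \<le> ennreal (2 powr (1 / th) * D powr (1 / th)) * ?I"
    proof (cases "?I = top")
      case True
      then show ?thesis using D by (simp add: ennreal_mult_top)
    next
      case False
      \<comment> \<open>A finite operator norm bounds W(t) V(cball0 t), and W(t) is positive; this
        makes near extremal functions available at every level.\<close>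
      have V_fin: "V (shell (R k)) < top" for k
      proof (cases "shell (R k) = ({} :: 'a set)")
        case True
        then show ?thesis using pos by simp
      next
        case ne: False
        then obtain t where t: "0 < t" "shell (R k) = (cball0 t :: 'a set)"
          using shell_R_cases[of k, where 'a = 'a] by blast
        have "W (ereal th) \<omega> t * V (cball0 t) < top"
          using W_times_V_le_Id_norm[of "ereal th" \<omega> t] \<omega> th False
          by (simp add: top.not_eq_extremum order_le_less_trans)
        moreover have "W (ereal th) \<omega> t \<noteq> 0"
          using t F_pos[OF t(1)] by (simp add: unorm_eq)
        ultimately show ?thesis unfolding t(2) by (auto simp: ennreal_mult_less_top)
      qed
      define y where "y k = enn2real (V (shell (R k)))" for k
      have y: "V (shell (R k)) = ennreal (y k)" "0 \<le> y k" for k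
        using V_fin[of k] by (simp_all add: y_def)
      \<comment> \<open>Normalized so that d_k^\<rho> is the k-th term of the discretized outer
        norm.\<close>
      define d where "d k = 2 powr (real_of_int k / th) * y k" for k
      have d: "0 \<le> d k" for k using y by (simp add: d_def)
      have "\<forall>k. \<exists>f. f \<in> borel_measurable lebesgue \<and> Lp_norm (ereal p) v1 f \<le> 1 \<and>
          V (shell (R k)) \<le> 2 * N (shell (R k)) f"
        using half_sharp[OF sets V_fin] by blast
      then obtain g where g: "\<And>k. g k \<in> borel_measurable lebesgue" "\<And>k. Lp_norm (ereal p) v1 (g k) \<le> 1"
          "\<And>k. V (shell (R k)) \<le> 2 * N (shell (R k)) (g k)"
        by metis
      note [measurable] = g(1)
      have fin: "(\<Sum>k\<in>K. ennreal (d k powr \<rho>)) \<le> ennreal (D powr (\<rho> / th)) * enn_powr ?I \<rho>" if K: "finite K" for K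
      proof -
        define S where "S = (\<Sum>k\<in>K. d k powr \<rho>)"
        have S: "0 \<le> S" by (simp add: S_def sum_nonneg)
        \<comment> \<open>the weights \<open>d k powr \<rho>\<close> give equality in the Hoelder inequality for the sum over \<open>k\<close>\<close>
        define f where "f x = (\<Sum>k\<in>K. d k powr \<rho> * \<bar>g k x\<bar> powr p) powr (1 / p)" for x
        have f_meas [measurable]: "f \<in> borel_measurable lebesgue"
          unfolding f_def by measurable
        have f_nonneg: "0 \<le> f x" for x by (simp add: f_def)
        have f_powr: "enn_powr (ennreal \<bar>f x\<bar>) p = (\<Sum>k\<in>K. ennreal (d k powr \<rho>) * enn_powr (ennreal \<bar>g k x\<bar>) p)" for x
        proof -
          have "\<bar>f x\<bar> powr p = (\<Sum>k\<in>K. d k powr \<rho> * \<bar>g k x\<bar> powr p)"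
            unfolding f_def using pq_pos by (simp add: powr_powr sum_nonneg)
          then have "enn_powr (ennreal \<bar>f x\<bar>) p = ennreal (\<Sum>k\<in>K. d k powr \<rho> * \<bar>g k x\<bar> powr p)"
            by (simp add: enn_powr_ennreal)
          also have "\<dots> = (\<Sum>k\<in>K. ennreal (d k powr \<rho> * \<bar>g k x\<bar> powr p))"
            by (rule sum_ennreal[symmetric]) simp
          also have "\<dots> = (\<Sum>k\<in>K. ennreal (d k powr \<rho>) * enn_powr (ennreal \<bar>g k x\<bar>) p)"
            by (simp add: enn_powr_ennreal ennreal_mult)
          finally show ?thesis .
        qed
        have "enn_powr (Lp_norm (ereal p) v1 f) p =
            (\<integral>\<^sup>+x. (\<Sum>k\<in>K. ennreal (d k powr \<rho>) * (enn_powr (ennreal \<bar>g k x\<bar>) p * ennreal (v1 x))) \<partial>lebesgue)"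
          unfolding Lp_norm_powr f_powr sum_distrib_right mult.assoc ..
        also have "\<dots> = (\<Sum>k\<in>K. ennreal (d k powr \<rho>) * enn_powr (Lp_norm (ereal p) v1 (g k)) p)"
          unfolding Lp_norm_powr by (simp add: nn_integral_sum nn_integral_cmult)
        also have "\<dots> \<le> (\<Sum>k\<in>K. ennreal (d k powr \<rho>) * enn_powr 1 p)"
          using pq_pos by (intro sum_mono mult_left_mono enn_powr_mono g) auto
        also have "\<dots> = ennreal S" by (simp add: S_def)
        finally have Lf: "enn_powr (Lp_norm (ereal p) v1 f) p \<le> ennreal S" .
        then have "enn_powr (Lp_norm (ereal p) v1 f) p < top" by (rule le_less_trans) simp
        then have Lf_fin: "Lp_norm (ereal p) v1 f < \<infinity>"
          by (simp add: less_top[symmetric])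
        \<comment> \<open>f dominates each of its summands pointwise, so the overlap of the sets X_k
          is harmless.\<close>
        have Nf: "ennreal (d k powr (\<rho> / p)) * N (shell (R k)) (g k) \<le> N (shell (R k)) f" if "k \<in> K" for k
        proof -
          have "d k powr (\<rho> / p) * \<bar>g k x\<bar> \<le> f x" for x
          proof -
            have "d k powr (\<rho> / p) * \<bar>g k x\<bar> = (d k powr \<rho> * \<bar>g k x\<bar> powr p) powr (1 / p)"
              using pq_pos d by (simp add: powr_mult powr_powr)
            also have "\<dots> \<le> f x"
              unfolding f_def using pq_pos that K
              by (intro powr_mono2 member_le_sum[of k K "\<lambda>k. d k powr \<rho> * \<bar>g k x\<bar> powr p"]) auto
            finally show ?thesis .
          qed
          then have le: "ennreal (d k powr (\<rho> / p)) * ennreal \<bar>g k x\<bar> \<le> ennreal \<bar>f x\<bar>" for x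
            using f_nonneg[of x] by (simp add: ennreal_leI flip: ennreal_mult)
          have "ennreal (d k powr (\<rho> / p)) * N (shell (R k)) (g k) =
              wnorm lebesgue (ereal q) (shell (R k)) (\<lambda>x. ennreal (v2 x)) (\<lambda>x. ennreal (d k powr (\<rho> / p)) * ennreal \<bar>g k x\<bar>)"
            unfolding wnorm_ereal enn_powr_mult mult.assoc using pq_pos
            by (subst nn_integral_cmult) (auto simp: enn_powr_mult enn_powr_inv sets mult.assoc)
          also have "\<dots> \<le> N (shell (R k)) f"
            by (intro wnorm_mono pos) (auto simp: le)
          finally show ?thesis .
        qed
        \<comment> \<open>The identity (\<rho>/p) \<theta> + \<theta> = \<rho> splits d_k^\<rho>
          into the \<theta>-th power of the coefficient of g_k and the factor 2^k
          V(X_k)^\<theta>.\<close>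
        have level_term: "ennreal (d k powr \<rho>) \<le> ennreal (2 powr th) * (ennreal (2 powr real_of_int k) * enn_powr (N (shell (R k)) f) th)"
          if "k \<in> K" for k
        proof -
          have "d k powr \<rho> = d k powr (\<rho> / p * th) * d k powr th"
            unfolding powr_add[symmetric] \<rho>(2) ..
          also have "d k powr th = 2 powr real_of_int k * y k powr th"
            using th y by (simp add: d_def powr_mult powr_powr)
          finally have "ennreal (d k powr \<rho>) = ennreal (2 powr real_of_int k) *
              enn_powr (ennreal (d k powr (\<rho> / p)) * V (shell (R k))) th"
            using y[of k] by (simp add: enn_powr_ennreal powr_powr powr_mult mult_ac flip: ennreal_mult)
          also have "ennreal (d k powr (\<rho> / p)) * V (shell (R k)) \<le> ennreal (d k powr (\<rho> / p)) * (2 * N (shell (R k)) (g k))"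
            by (rule mult_left_mono[OF g(3)]) simp
          also have "\<dots> = 2 * (ennreal (d k powr (\<rho> / p)) * N (shell (R k)) (g k))"
            by (simp add: mult_ac)
          also have "\<dots> \<le> 2 * N (shell (R k)) f"
            by (rule mult_left_mono[OF Nf[OF that]]) simp
          finally have "ennreal (d k powr \<rho>) \<le> ennreal (2 powr real_of_int k) * enn_powr (2 * N (shell (R k)) f) th"
            using th by (simp add: enn_powr_mono mult_left_mono)
          also have "enn_powr 2 th = ennreal (2 powr th)"
            using enn_powr_ennreal[of 2 th] by simp
          then have "enn_powr (2 * N (shell (R k)) f) th = ennreal (2 powr th) * enn_powr (N (shell (R k)) f) th"
            by (simp add: enn_powr_mult)
          finally show ?thesis by (simp add: mult_ac)
        qed
        have "ennreal S = (\<Sum>k\<in>K. ennreal (d k powr \<rho>))" by (simp add: S_def)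
        also have "\<dots> \<le> (\<Sum>k\<in>K. ennreal (2 powr th) * (ennreal (2 powr real_of_int k) * enn_powr (N (shell (R k)) f) th))"
          by (intro sum_mono level_term)
        also have "\<dots> = ennreal (2 powr th) * (\<Sum>k\<in>K. ennreal (2 powr real_of_int k) * enn_powr (N (shell (R k)) f) th)"
          by (simp add: sum_distrib_left)
        also have "(\<Sum>k\<in>K. ennreal (2 powr real_of_int k) * enn_powr (N (shell (R k)) f) th)
            = (\<integral>\<^sup>+k. ennreal (2 powr real_of_int k) * enn_powr (N (shell (R k)) f) th * indicator K k \<partial>count_space UNIV)"
          using K by (subst nn_integral_count_space'[of K]) auto
        also have "\<dots> \<le> (\<integral>\<^sup>+k. ennreal (2 powr real_of_int k) * enn_powr (N (shell (R k)) f) th \<partial>count_space UNIV)"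
          by (intro nn_integral_mono) (auto split: split_indicator)
        also have "\<dots> \<le> 2 * enn_powr (cLM_norm (ereal q) (ereal th) \<omega> v2 f) th"
          by (rule level_sum_le_cLM_norm) fact+
        also have "cLM_norm (ereal q) (ereal th) \<omega> v2 f \<le> ?I * Lp_norm (ereal p) v1 f"
          using th pos by (intro cLM_norm_le_Id_norm v1 f_meas Lf_fin) auto
        finally have "ennreal S \<le> ennreal (2 powr th) * (2 * enn_powr (?I * Lp_norm (ereal p) v1 f) th)"
          using th by (simp add: enn_powr_mono mult_left_mono)
        also have "enn_powr (?I * Lp_norm (ereal p) v1 f) th = enn_powr ?I th * enn_powr (enn_powr (Lp_norm (ereal p) v1 f) p) (th / p)"
          using pq_pos by (simp add: enn_powr_mult enn_powr_powr)
        also have "\<dots> \<le> enn_powr ?I th * enn_powr (ennreal S) (th / p)"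
          using \<rho> by (intro mult_left_mono enn_powr_mono Lf) auto
        finally have "ennreal S \<le> ennreal (2 powr th) * (2 * (enn_powr ?I th * enn_powr (ennreal S) (th / p)))"
          by (simp add: mult_left_mono)
        also have "\<dots> = ennreal D * enn_powr (ennreal S) (th / p) * enn_powr ?I th"
          by (simp add: D_def ennreal_mult mult_ac)
        \<comment> \<open>S stands on both sides, on the right with the smaller exponent \<theta>/p;
          being a finite sum of reals it can be cancelled.\<close>
        finally have "ennreal S \<le> enn_powr (ennreal D * enn_powr ?I th) (1 / (1 - th / p))"
          using \<rho> S D by (intro ennreal_self_bound) auto
        then show ?thesis
          using th D unfolding \<rho>(3) by (simp add: S_def enn_powr_mult enn_powr_ennreal enn_powr_powr)
      qed
      have "ennreal (2 powr (\<rho> / th * real_of_int k)) * enn_powr (V (shell (R k))) \<rho> = ennreal (d k powr \<rho>)" for k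
        using y[of k] by (simp add: d_def powr_mult powr_powr enn_powr_ennreal mult_ac flip: ennreal_mult)
      then have "(\<integral>\<^sup>+k. ennreal (2 powr (\<rho> / th * real_of_int k)) * enn_powr (V (shell (R k))) \<rho> \<partial>count_space UNIV)
          \<le> ennreal (D powr (\<rho> / th)) * enn_powr ?I \<rho>"
        using nn_integral_count_space_int_le[OF fin] by simp
      then have "ennreal (2 powr (\<rho> / th)) * (\<integral>\<^sup>+k. ennreal (2 powr (\<rho> / th * real_of_int k)) * enn_powr (V (shell (R k))) \<rho> \<partial>count_space UNIV)
          \<le> ennreal (2 powr (\<rho> / th)) * (ennreal (D powr (\<rho> / th)) * enn_powr ?I \<rho>)"
        by (rule mult_left_mono) simp
      with level_energy_le_sum[OF th \<omega> levels, folded \<rho>_def]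
      have "enn_powr (level_energy th \<omega>) \<rho> \<le> ennreal (2 powr (\<rho> / th)) * (ennreal (D powr (\<rho> / th)) * enn_powr ?I \<rho>)"
        by (rule order_trans)
      also have "\<dots> = enn_powr (ennreal (2 powr (1 / th) * D powr (1 / th)) * ?I) \<rho>"
        using D by (simp add: enn_powr_mult enn_powr_ennreal powr_powr powr_mult ennreal_mult mult_ac)
      finally show ?thesis using \<rho>(1) by (simp add: enn_powr_le_iff)
    qed
  qed
qed

lemma Id_norm_gt_exponent:
  assumes th: "0 < th" "th < p"
  shows "unif_equiv (\<lambda>\<omega>. \<omega> \<in> cOmega (ereal th)) (\<lambda>\<omega>. Id_norm (ereal p) v1 (ereal q) (ereal th) \<omega> v2)
     (\<lambda>\<omega>. wnorm lebesgue (ereal (th * p / (p - th))) {0<..} (\<lambda>t. ennreal (\<omega> t powr th))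
       (\<lambda>t. enn_powr (W (ereal th) \<omega> t) (th / p) * V (cball0 t)))"
proof -
  obtain C where C: "0 < C" "\<And>\<omega>. \<omega> \<in> cOmega (ereal th) \<Longrightarrow>
      Id_norm (ereal p) v1 (ereal q) (ereal th) \<omega> v2 \<le> ennreal C * level_energy th \<omega>"
    by (rule Id_norm_le_level_energy[OF th], rule that)
  obtain D where D: "0 < D" "\<And>\<omega>. \<omega> \<in> cOmega (ereal th) \<Longrightarrow>
      level_energy th \<omega> \<le> ennreal D * Id_norm (ereal p) v1 (ereal q) (ereal th) \<omega> v2"
    by (rule level_energy_le_Id_norm[OF th], rule that)
  from C(1) D(1) C(2) D(2) show ?thesis
    unfolding level_energy_def by (rule unif_equivI)
qed

end

section \<open>The sharp Hoelder inequalities\<close>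

lemma WsetD:
  assumes "v \<in> Wset"
  shows "v \<in> borel_measurable lebesgue" "AE x in lebesgue. 0 < v x"
  using assms by (auto simp: Wset_def)

lemma nn_integral_bounded_set_finite:
  fixes g :: "'a::euclidean_space \<Rightarrow> ennreal"
  assumes "E \<in> sets lebesgue" "bounded E" "\<And>x. x \<in> E \<Longrightarrow> g x \<le> ennreal C"
  shows "(\<integral>\<^sup>+x\<in>E. g x \<partial>lebesgue) < top"
proof -
  have "(\<integral>\<^sup>+x\<in>E. g x \<partial>lebesgue) \<le> (\<integral>\<^sup>+x. ennreal C * indicator E x \<partial>lebesgue)"
    using assms(3) by (intro nn_integral_mono) (auto split: split_indicator)
  also have "\<dots> = ennreal C * emeasure lebesgue E"
    using assms(1) by (rule nn_integral_cmult_indicator)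
  also have "\<dots> < top"
    using bounded_set_imp_lmeasurable[OF assms(2,1)] fmeasurableD2
    by (fastforce simp: ennreal_mult_less_top less_top)
  finally show ?thesis .
qed

text \<open>Since 1/q = 1/p + 1/s, the integrand |f|^q v_2 equals (|f|^p v_1)^(q/p) (u^s)^(q/s)
  almost everywhere. Equality in Hoelder's inequality asks for |f|^p v_1 proportional to u^s, which
  dictates the test function; a truncation makes u^s integrable.\<close>

lemma sharp_Holder_less:
  fixes v1 v2 :: "'a::euclidean_space \<Rightarrow> real"
  assumes pq: "0 < q" "q < p" and v: "v1 \<in> Wset" "v2 \<in> Wset"
  shows "sharp_Holder_finite p q (ereal (p * q / (p - q))) v1 v2 (\<lambda>x. v1 x powr (- 1 / p) * v2 x powr (1 / q))"
proof -
  note [measurable] = WsetD(1)[OF v(1)] WsetD(1)[OF v(2)]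
  define s where "s = p * q / (p - q)"
  define u where "u x = v1 x powr (- 1 / p) * v2 x powr (1 / q)" for x
  have s: "0 < s" "q / p + q / s = 1" "s * q / p + q = s" "0 < q / p" "0 < q / s"
    using pq by (auto simp: s_def field_simps)
  have u_meas [measurable]: "u \<in> borel_measurable lebesgue" unfolding u_def by measurable
  have u_nonneg: "0 \<le> u x" for x by (simp add: u_def)
  have u_powr: "u x powr q = v1 x powr (- q / p) * v2 x" if "0 < v1 x" "0 < v2 x" for x
    using that pq by (simp add: u_def powr_mult powr_powr)
  have V: "unorm lebesgue (ereal s) A (\<lambda>x. ennreal (u x)) = enn_powr (\<integral>\<^sup>+x\<in>A. ennreal (u x powr s) \<partial>lebesgue) (1 / s)" for A
    by (simp add: unorm_ereal enn_powr_ennreal u_nonneg)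
  have pos: "AE x in lebesgue. 0 < v1 x \<and> 0 < v2 x"
    using WsetD(2)[OF v(1)] WsetD(2)[OF v(2)] by eventually_elim simp
  have "sharp_Holder_finite p q (ereal s) v1 v2 u"
  proof (unfold_locales; (fact v u_meas)?)
    fix f :: "'a \<Rightarrow> real" and A :: "'a set"
    assume [measurable]: "f \<in> borel_measurable lebesgue" "A \<in> sets lebesgue"
    let ?G = "\<lambda>x. enn_powr (ennreal \<bar>f x\<bar>) p * ennreal (v1 x)"
    let ?H = "\<lambda>x. ennreal (u x powr s) * indicator A x"
    have "AE x in lebesgue. enn_powr (ennreal \<bar>f x\<bar>) q * ennreal (v2 x) * indicator A x
        = enn_powr (?G x) (q / p) * enn_powr (?H x) (q / s)"
      using pos
    proof eventually_elim
      case (elim x)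
      have "enn_powr (?G x) (q / p) * enn_powr (ennreal (u x powr s)) (q / s) =
          ennreal (\<bar>f x\<bar> powr q * (v1 x powr (q / p) * u x powr q))"
        using elim pq s u_nonneg[of x]
        by (simp add: enn_powr_mult enn_powr_ennreal powr_powr ennreal_mult mult_ac)
      also have "v1 x powr (q / p) * u x powr q = v2 x"
        using elim by (simp add: u_powr powr_minus field_simps)
      finally show ?case
        using elim by (auto simp: enn_powr_ennreal ennreal_mult split: split_indicator)
    qed
    then have "(\<integral>\<^sup>+x\<in>A. enn_powr (ennreal \<bar>f x\<bar>) q * ennreal (v2 x) \<partial>lebesgue) =
        (\<integral>\<^sup>+x. enn_powr (?G x) (q / p) * enn_powr (?H x) (q / s) \<partial>lebesgue)"
      by (rule nn_integral_cong_AE)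
    also have "\<dots> \<le> enn_powr (\<integral>\<^sup>+x. ?G x \<partial>lebesgue) (q / p) * enn_powr (\<integral>\<^sup>+x. ?H x \<partial>lebesgue) (q / s)"
      using s by (intro nn_integral_Holder) auto
    finally have "enn_powr (\<integral>\<^sup>+x\<in>A. enn_powr (ennreal \<bar>f x\<bar>) q * ennreal (v2 x) \<partial>lebesgue) (1 / q) \<le>
        enn_powr (enn_powr (\<integral>\<^sup>+x. ?G x \<partial>lebesgue) (q / p) * enn_powr (\<integral>\<^sup>+x. ?H x \<partial>lebesgue) (q / s)) (1 / q)"
      using pq by (intro enn_powr_mono) auto
    then show "wnorm lebesgue (ereal q) A (\<lambda>x. ennreal (v2 x)) (\<lambda>x. ennreal \<bar>f x\<bar>)
        \<le> Lp_norm (ereal p) v1 f * unorm lebesgue (ereal s) A (\<lambda>x. ennreal (u x))"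
      using pq by (simp add: V wnorm_ereal Lp_norm_def enn_powr_mult enn_powr_powr)
  next
    fix A :: "'a set" and c
    assume A [measurable]: "A \<in> sets lebesgue" and c: "c < unorm lebesgue (ereal s) A (\<lambda>x. ennreal (u x))"
    define G where "G n = A \<inter> ball 0 (real n) \<inter> {x. u x \<le> real n}" for n
    have G_sets: "G n \<in> sets lebesgue" for n
    proof -
      have "{x \<in> space lebesgue. u x \<le> real n} \<in> sets lebesgue" by measurable
      then show ?thesis using A by (auto simp: G_def intro!: sets.Int)
    qed
    have G_inc: "incseq G"
      by (force simp: incseq_def G_def)
    have G_UN: "(\<Union>n. G n) = A"
    proof (intro equalityI subsetI)
      fix x assume "x \<in> A"
      obtain n where "max (norm x) (u x) < real n" using reals_Archimedean2 by blast
      with \<open>x \<in> A\<close> have "x \<in> G n" by (simp add: G_def)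
      then show "x \<in> (\<Union>n. G n)" by blast
    qed (auto simp: G_def)
    have "unorm lebesgue (ereal s) (\<Union>n. G n) (\<lambda>x. ennreal (u x)) =
        (SUP n. unorm lebesgue (ereal s) (G n) (\<lambda>x. ennreal (u x)))"
      using s(1) by (intro unorm_UN G_inc G_sets) auto
    then obtain n where n: "c < unorm lebesgue (ereal s) (G n) (\<lambda>x. ennreal (u x))"
      using c unfolding G_UN less_SUP_iff by (auto simp: less_SUP_iff)
    define E where "E = G n"
    have E [measurable]: "E \<in> sets lebesgue" and "E \<subseteq> A" using G_sets[of n] by (auto simp: E_def G_def)
    have "(\<integral>\<^sup>+x\<in>E. ennreal (u x powr s) \<partial>lebesgue) < top"
    proof (rule nn_integral_bounded_set_finite[OF E, where C = "real n powr s"])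
      show "bounded E" unfolding E_def G_def by (auto intro: bounded_subset[OF bounded_ball])
      show "ennreal (u x powr s) \<le> ennreal (real n powr s)" if "x \<in> E" for x
        using that s u_nonneg[of x] by (intro ennreal_leI powr_mono2) (auto simp: E_def G_def)
    qed
    moreover have "(\<integral>\<^sup>+x\<in>E. ennreal (u x powr s) \<partial>lebesgue) \<noteq> 0"
      using n unfolding V E_def[symmetric] by auto
    ultimately obtain T where T: "(\<integral>\<^sup>+x\<in>E. ennreal (u x powr s) \<partial>lebesgue) = ennreal T" "0 < T"
      by (cases "\<integral>\<^sup>+x\<in>E. ennreal (u x powr s) \<partial>lebesgue") (auto simp: less_le)
    \<comment> \<open>The factor 1/T normalizes the norm of f to 1; f then attains V(E) exactly, and
      V(E) > c by the choice of n.\<close>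
    define f where "f x = (u x powr s / v1 x / T) powr (1 / p) * indicator E x" for x
    have f [measurable]: "f \<in> borel_measurable lebesgue" unfolding f_def by measurable
    have "(\<integral>\<^sup>+x. enn_powr (ennreal \<bar>f x\<bar>) p * ennreal (v1 x) \<partial>lebesgue) =
        (\<integral>\<^sup>+x. ennreal (1 / T) * (ennreal (u x powr s) * indicator E x) \<partial>lebesgue)"
    proof (rule nn_integral_cong_AE, use pos in eventually_elim)
      case (elim x)
      then show ?case
        using pq T u_nonneg[of x]
        by (auto simp: f_def enn_powr_ennreal powr_powr split: split_indicator simp flip: ennreal_mult)
    qed
    also have "\<dots> = 1"
      using T by (simp add: nn_integral_cmult flip: ennreal_mult)
    finally have Lf: "Lp_norm (ereal p) v1 f = 1" by (simp add: Lp_norm_def wnorm_ereal)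
    have "(\<integral>\<^sup>+x\<in>A. enn_powr (ennreal \<bar>f x\<bar>) q * ennreal (v2 x) \<partial>lebesgue) =
        (\<integral>\<^sup>+x. ennreal (T powr (- q / p)) * (ennreal (u x powr s) * indicator E x) \<partial>lebesgue)"
    proof (rule nn_integral_cong_AE, use pos in eventually_elim)
      case (elim x)
      have "\<bar>f x\<bar> powr q * v2 x = T powr (- q / p) * u x powr s" if "x \<in> E"
      proof -
        have "\<bar>f x\<bar> powr q * v2 x = (u x powr s / v1 x / T) powr (q / p) * v2 x"
          using that pq by (simp add: f_def powr_powr)
        also have "\<dots> = T powr (- q / p) * (u x powr (s * q / p) * (v1 x powr (- q / p) * v2 x))"
          using elim T u_nonneg[of x] by (simp add: powr_divide powr_mult powr_powr powr_minus_divide)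
        also have "v1 x powr (- q / p) * v2 x = u x powr q"
          using elim by (simp add: u_powr)
        also have "u x powr (s * q / p) * u x powr q = u x powr s"
          unfolding powr_add[symmetric] s(3) ..
        finally show ?thesis .
      qed
      moreover have "f x = 0" if "x \<notin> E" using that by (simp add: f_def)
      ultimately show ?case
        using elim \<open>E \<subseteq> A\<close> by (auto simp: enn_powr_ennreal split: split_indicator simp flip: ennreal_mult)
    qed
    also have "\<dots> = ennreal (T powr (- q / p)) * ennreal T"
      using T by (simp add: nn_integral_cmult)
    also have "\<dots> = ennreal (T powr (q / s))"
    proof -
      have "T powr (- q / p) * T powr 1 = T powr (q / s)"
        unfolding powr_add[symmetric] using s(2) by (intro arg_cong[where f = "\<lambda>y. T powr y"]) simp
      then show ?thesis using T by (simp flip: ennreal_mult)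
    qed
    finally have "wnorm lebesgue (ereal q) A (\<lambda>x. ennreal (v2 x)) (\<lambda>x. ennreal \<bar>f x\<bar>) =
        unorm lebesgue (ereal s) E (\<lambda>x. ennreal (u x))"
      using T pq unfolding wnorm_ereal V T(1) by (simp add: enn_powr_ennreal powr_powr)
    then show "\<exists>f\<in>borel_measurable lebesgue. Lp_norm (ereal p) v1 f \<le> 1 \<and>
        c \<le> wnorm lebesgue (ereal q) A (\<lambda>x. ennreal (v2 x)) (\<lambda>x. ennreal \<bar>f x\<bar>)"
      using f Lf n unfolding E_def by (intro bexI[of _ f]) auto
  qed (use pq s in auto)
  then show ?thesis unfolding s_def u_def .
qed

text \<open>Almost everywhere v_2 = v_1 u^p, so the essential supremum of u comes out of the
  integral. For sharpness one takes a normalized indicator of a part of {u > c}: the average of u^p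
  over it, with respect to v_1 dx, is at least c^p.\<close>

lemma sharp_Holder_equal:
  fixes v1 v2 :: "'a::euclidean_space \<Rightarrow> real"
  assumes p: "0 < p" and v: "v1 \<in> Wset" "v2 \<in> Wset"
  shows "sharp_Holder_finite p p \<infinity> v1 v2 (\<lambda>x. v1 x powr (- 1 / p) * v2 x powr (1 / p))"
proof -
  note [measurable] = WsetD(1)[OF v(1)] WsetD(1)[OF v(2)]
  define u where "u x = v1 x powr (- 1 / p) * v2 x powr (1 / p)" for x
  have u_meas [measurable]: "u \<in> borel_measurable lebesgue" unfolding u_def by measurable
  have u_nonneg: "0 \<le> u x" for x by (simp add: u_def)
  have pos: "AE x in lebesgue. 0 < v1 x \<and> 0 < v2 x"
    using WsetD(2)[OF v(1)] WsetD(2)[OF v(2)] by eventually_elim simp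
  have v2_eq: "ennreal (v2 x) = ennreal (v1 x) * enn_powr (ennreal (u x)) p" if "0 < v1 x \<and> 0 < v2 x" for x
    using that p u_nonneg[of x]
    by (simp add: enn_powr_ennreal u_def powr_mult powr_divide powr_powr powr_minus_divide flip: ennreal_mult)
  have "sharp_Holder_finite p p \<infinity> v1 v2 u"
  proof (unfold_locales; (fact v u_meas)?)
    fix f :: "'a \<Rightarrow> real" and A :: "'a set"
    assume [measurable]: "f \<in> borel_measurable lebesgue" "A \<in> sets lebesgue"
    let ?V = "ess_sup_on lebesgue A (\<lambda>x. ennreal (u x))"
    have "AE x in lebesgue. enn_powr (ennreal \<bar>f x\<bar>) p * ennreal (v2 x) * indicator A x
        \<le> enn_powr (ennreal \<bar>f x\<bar>) p * ennreal (v1 x) * enn_powr ?V p"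
      using pos AE_le_ess_sup_on[of A "\<lambda>x. ennreal (u x)" lebesgue]
      by eventually_elim (use p in \<open>auto simp: v2_eq mult.assoc split: split_indicator intro!: mult_left_mono enn_powr_mono\<close>)
    then have "(\<integral>\<^sup>+x\<in>A. enn_powr (ennreal \<bar>f x\<bar>) p * ennreal (v2 x) \<partial>lebesgue) \<le>
        (\<integral>\<^sup>+x. enn_powr (ennreal \<bar>f x\<bar>) p * ennreal (v1 x) * enn_powr ?V p \<partial>lebesgue)"
      by (rule nn_integral_mono_AE)
    also have "\<dots> = (\<integral>\<^sup>+x. enn_powr (ennreal \<bar>f x\<bar>) p * ennreal (v1 x) \<partial>lebesgue) * enn_powr ?V p"
      by (rule nn_integral_multc) measurable
    finally have "enn_powr (\<integral>\<^sup>+x\<in>A. enn_powr (ennreal \<bar>f x\<bar>) p * ennreal (v2 x) \<partial>lebesgue) (1 / p) \<le>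
        enn_powr ((\<integral>\<^sup>+x. enn_powr (ennreal \<bar>f x\<bar>) p * ennreal (v1 x) \<partial>lebesgue) * enn_powr ?V p) (1 / p)"
      using p by (intro enn_powr_mono) auto
    then show "wnorm lebesgue (ereal p) A (\<lambda>x. ennreal (v2 x)) (\<lambda>x. ennreal \<bar>f x\<bar>)
        \<le> Lp_norm (ereal p) v1 f * unorm lebesgue \<infinity> A (\<lambda>x. ennreal (u x))"
      using p by (simp add: unorm_infinity wnorm_ereal Lp_norm_def enn_powr_mult enn_powr_inv)
  next
    fix A :: "'a set" and c
    assume A [measurable]: "A \<in> sets lebesgue" and c: "c < unorm lebesgue \<infinity> A (\<lambda>x. ennreal (u x))"
    \<comment> \<open>Boundedness of the set and of v_1 on it makes the mass of v_1 finite; together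
      the sets exhaust the part of A where u exceeds c.\<close>
    let ?E = "\<lambda>n. A \<inter> ball 0 (real n) \<inter> {x. c < ennreal (u x) \<and> v1 x \<le> real n}"
    have E_sets: "?E n \<in> sets lebesgue" for n
    proof -
      have "{x \<in> space lebesgue. c < ennreal (u x) \<and> v1 x \<le> real n} \<in> sets lebesgue" by measurable
      then show ?thesis using A by (auto intro!: sets.Int)
    qed
    have "\<exists>n. \<not> (AE x in lebesgue. x \<notin> ?E n)"
    proof (rule ccontr)
      assume "\<not> ?thesis"
      then have "AE x in lebesgue. \<forall>n. x \<notin> ?E n"
        by (subst AE_all_countable) blast
      then have "AE x in lebesgue. x \<in> A \<longrightarrow> ennreal (u x) \<le> c"
      proof eventually_elim
        case (elim x)
        obtain n where "max (norm x) (v1 x) < real n" using reals_Archimedean2 by blast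
        then show ?case using elim[rule_format, of n] by (auto simp: not_less)
      qed
      then have "unorm lebesgue \<infinity> A (\<lambda>x. ennreal (u x)) \<le> c"
        unfolding unorm_infinity by (rule ess_sup_on_leI)
      with c show False by simp
    qed
    then obtain n where n: "\<not> (AE x in lebesgue. x \<notin> ?E n)" by blast
    define E where "E = ?E n"
    have E [measurable]: "E \<in> sets lebesgue" and "E \<subseteq> A" using E_sets[of n] by (auto simp: E_def)
    have "(\<integral>\<^sup>+x\<in>E. ennreal (v1 x) \<partial>lebesgue) < top"
    proof (rule nn_integral_bounded_set_finite[OF E, where C = "real n"])
      show "bounded E" unfolding E_def by (auto intro: bounded_subset[OF bounded_ball])
    qed (auto simp: E_def intro: ennreal_leI)
    moreover have "(\<integral>\<^sup>+x\<in>E. ennreal (v1 x) \<partial>lebesgue) \<noteq> 0"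
    proof
      assume "(\<integral>\<^sup>+x\<in>E. ennreal (v1 x) \<partial>lebesgue) = 0"
      then have "AE x in lebesgue. ennreal (v1 x) * indicator E x = 0"
        by (subst (asm) nn_integral_0_iff_AE) auto
      with pos have "AE x in lebesgue. x \<notin> E"
        by eventually_elim (auto simp: ennreal_eq_0_iff)
      with n show False by (simp add: E_def)
    qed
    ultimately obtain T where T: "(\<integral>\<^sup>+x\<in>E. ennreal (v1 x) \<partial>lebesgue) = ennreal T" "0 < T"
      by (cases "\<integral>\<^sup>+x\<in>E. ennreal (v1 x) \<partial>lebesgue") (auto simp: less_le)
    define f where "f x = (1 / T) powr (1 / p) * indicator E x" for x :: 'a
    have f [measurable]: "f \<in> borel_measurable lebesgue" unfolding f_def by measurable
    have f_powr: "enn_powr (ennreal \<bar>f x\<bar>) p = ennreal (1 / T) * indicator E x" for x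
      using p T(2) by (auto simp: f_def enn_powr_ennreal powr_powr split: split_indicator)
    have avg: "ennreal (1 / T) * (\<integral>\<^sup>+x\<in>E. ennreal (v1 x) \<partial>lebesgue) = 1"
      using T by (simp flip: ennreal_mult)
    have "(\<integral>\<^sup>+x. enn_powr (ennreal \<bar>f x\<bar>) p * ennreal (v1 x) \<partial>lebesgue) = 1"
      unfolding f_powr avg[symmetric] by (subst nn_integral_cmult[symmetric]) (auto simp: mult_ac)
    then have Lf: "Lp_norm (ereal p) v1 f = 1" by (simp add: Lp_norm_def wnorm_ereal)
    have "enn_powr c p = (\<integral>\<^sup>+x. ennreal (1 / T) * enn_powr c p * (ennreal (v1 x) * indicator E x) \<partial>lebesgue)"
      by (subst nn_integral_cmult) (auto simp: avg mult_ac intro: arg_cong2[where f = times, of 1 _ x x for x, simplified])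
    also have "\<dots> \<le> (\<integral>\<^sup>+x\<in>A. enn_powr (ennreal \<bar>f x\<bar>) p * ennreal (v2 x) \<partial>lebesgue)"
    proof (rule nn_integral_mono_AE, use pos in eventually_elim)
      case (elim x)
      show ?case
      proof (cases "x \<in> E")
        case True
        then have "enn_powr c p \<le> enn_powr (ennreal (u x)) p"
          using p by (intro enn_powr_mono) (auto simp: E_def)
        then have "ennreal (1 / T) * ennreal (v1 x) * enn_powr c p \<le> ennreal (1 / T) * ennreal (v1 x) * enn_powr (ennreal (u x)) p"
          by (rule mult_left_mono) simp
        then show ?thesis
          using True \<open>E \<subseteq> A\<close> by (auto simp: f_powr v2_eq[OF elim] mult_ac)
      qed simp
    qed
    finally have "c \<le> enn_powr (\<integral>\<^sup>+x\<in>A. enn_powr (ennreal \<bar>f x\<bar>) p * ennreal (v2 x) \<partial>lebesgue) (1 / p)"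
      using p by (simp add: enn_powr_le_swap)
    then show "\<exists>f\<in>borel_measurable lebesgue. Lp_norm (ereal p) v1 f \<le> 1 \<and>
        c \<le> wnorm lebesgue (ereal p) A (\<lambda>x. ennreal (v2 x)) (\<lambda>x. ennreal \<bar>f x\<bar>)"
      using f Lf by (intro bexI[of _ f]) (auto simp: wnorm_ereal)
  qed (use p in auto)
  then show ?thesis unfolding u_def .
qed

text \<open>Among functions of norm at most 1, 1/v_1 is the largest in modulus almost everywhere, so
  it is extremal for every set and every p_2. The assumption \<open>wnorm_eq\<close> hides how v_2
  enters, which differs between finite and infinite p_2.\<close>

lemma
  fixes v1 v2 u :: "'a::euclidean_space \<Rightarrow> real"
  assumes p2: "0 < p2" and v: "v1 \<in> Wset" "v2 \<in> Wset" and u [measurable]: "u \<in> borel_measurable lebesgue"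
    and wnorm_eq: "\<And>A f. wnorm lebesgue p2 A (\<lambda>x. ennreal (v2 x)) (\<lambda>x. ennreal \<bar>f x\<bar>)
      = unorm lebesgue p2 A (\<lambda>x. ennreal \<bar>f x\<bar> * ennreal (v1 x) * ennreal (u x))"
  shows sharp_Holder_infinity: "sharp_Holder \<infinity> p2 p2 v1 v2 u"
    and Lp_norm_inverse_weight: "Lp_norm \<infinity> v1 (\<lambda>x. 1 / v1 x) \<le> 1"
    and unorm_le_wnorm_inverse_weight: "unorm lebesgue p2 A (\<lambda>x. ennreal (u x))
      \<le> wnorm lebesgue p2 A (\<lambda>x. ennreal (v2 x)) (\<lambda>x. ennreal \<bar>1 / v1 x\<bar>)"
proof -
  note [measurable] = WsetD(1)[OF v(1)] WsetD(1)[OF v(2)]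
  have one: "AE x in lebesgue. ennreal \<bar>1 / v1 x\<bar> * ennreal (v1 x) = 1"
    using WsetD(2)[OF v(1)] by eventually_elim (simp flip: ennreal_mult)
  then show L: "Lp_norm \<infinity> v1 (\<lambda>x. 1 / v1 x) \<le> 1"
    unfolding Lp_norm_def wnorm_infinity by (intro ess_sup_on_leI, eventually_elim) simp
  show V: "unorm lebesgue p2 A (\<lambda>x. ennreal (u x))
      \<le> wnorm lebesgue p2 A (\<lambda>x. ennreal (v2 x)) (\<lambda>x. ennreal \<bar>1 / v1 x\<bar>)" for A
    unfolding wnorm_eq using one by (intro unorm_mono p2, eventually_elim) simp
  show "sharp_Holder \<infinity> p2 p2 v1 v2 u"
  proof (unfold_locales; (fact v u p2)?)
    fix f :: "'a \<Rightarrow> real" and A :: "'a set"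
    assume f: "f \<in> borel_measurable lebesgue" "Lp_norm \<infinity> v1 f < \<infinity>" and A [measurable]: "A \<in> sets lebesgue"
    let ?L = "Lp_norm \<infinity> v1 f"
    have L: "AE x in lebesgue. ennreal \<bar>f x\<bar> * ennreal (v1 x) \<le> ?L"
      using AE_le_ess_sup_on[of UNIV "\<lambda>x. ennreal \<bar>f x\<bar> * ennreal (v1 x)" lebesgue]
      by (simp add: Lp_norm_def wnorm_infinity)
    show "wnorm lebesgue p2 A (\<lambda>x. ennreal (v2 x)) (\<lambda>x. ennreal \<bar>f x\<bar>)
        \<le> ?L * unorm lebesgue p2 A (\<lambda>x. ennreal (u x))"
    \<comment> \<open>Norm 0 is treated apart because the factor pulled out by
      \<open>unorm_cmult_le\<close> must not vanish.\<close>
    proof (cases "?L = 0")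
      case True
      then have "AE x in lebesgue. f x = 0"
        using Lp_norm_eq_0_iff[OF _ v(1) f(1), of \<infinity>] by simp
      then have "wnorm lebesgue p2 A (\<lambda>x. ennreal (v2 x)) (\<lambda>x. ennreal \<bar>f x\<bar>) = 0"
        by (intro wnorm_zero p2, eventually_elim) simp
      then show ?thesis by simp
    next
      case False
      have "wnorm lebesgue p2 A (\<lambda>x. ennreal (v2 x)) (\<lambda>x. ennreal \<bar>f x\<bar>)
          \<le> unorm lebesgue p2 A (\<lambda>x. ?L * ennreal (u x))"
        unfolding wnorm_eq using L by (intro unorm_mono p2, eventually_elim) (simp add: mult_right_mono)
      also have "\<dots> \<le> ?L * unorm lebesgue p2 A (\<lambda>x. ennreal (u x))"
        using False f(2) by (intro unorm_cmult_le p2) auto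
      finally show ?thesis .
    qed
  next
    fix A :: "'a set" and c
    assume "c < unorm lebesgue p2 A (\<lambda>x. ennreal (u x))"
    then show "\<exists>f\<in>borel_measurable lebesgue. Lp_norm \<infinity> v1 f \<le> 1 \<and>
        c \<le> wnorm lebesgue p2 A (\<lambda>x. ennreal (v2 x)) (\<lambda>x. ennreal \<bar>f x\<bar>)"
      using L V[of A] by (intro bexI[of _ "\<lambda>x. 1 / v1 x"]) auto
  qed (use p2 in auto)
qed

lemma wnorm_eq_unorm_finite:
  fixes v1 v2 :: "'a::euclidean_space \<Rightarrow> real"
  assumes q: "0 < q" and v: "v1 \<in> Wset" "v2 \<in> Wset"
  shows "wnorm lebesgue (ereal q) A (\<lambda>x. ennreal (v2 x)) (\<lambda>x. ennreal \<bar>f x\<bar>) =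
    unorm lebesgue (ereal q) A (\<lambda>x. ennreal \<bar>f x\<bar> * ennreal (v1 x) * ennreal (v1 x powr (- 1) * v2 x powr (1 / q)))"
proof -
  have "AE x in lebesgue. enn_powr (ennreal \<bar>f x\<bar>) q * ennreal (v2 x) * indicator A x =
      enn_powr (ennreal \<bar>f x\<bar> * ennreal (v1 x) * ennreal (v1 x powr (- 1) * v2 x powr (1 / q))) q * indicator A x"
    using WsetD(2)[OF v(1)] WsetD(2)[OF v(2)]
  proof eventually_elim
    case (elim x)
    have "ennreal (v1 x) * ennreal (v1 x powr (- 1) * v2 x powr (1 / q)) = ennreal (v2 x powr (1 / q))"
      using elim by (simp add: powr_minus_divide flip: ennreal_mult)
    then show ?case
      using elim q by (simp add: mult.assoc enn_powr_mult enn_powr_ennreal powr_powr)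
  qed
  then show ?thesis
    unfolding wnorm_ereal unorm_ereal
    by (rule arg_cong[where f = "\<lambda>y. enn_powr y (1 / q)", OF nn_integral_cong_AE])
qed

text \<open>In the essential supremum the weight stands to the first power, whence v_2 here and
  v_2^(1/q) for finite exponents.\<close>

lemma wnorm_eq_unorm_infinity:
  fixes v1 v2 :: "'a::euclidean_space \<Rightarrow> real"
  assumes v: "v1 \<in> Wset" "v2 \<in> Wset"
  shows "wnorm lebesgue \<infinity> A (\<lambda>x. ennreal (v2 x)) (\<lambda>x. ennreal \<bar>f x\<bar>) =
    unorm lebesgue \<infinity> A (\<lambda>x. ennreal \<bar>f x\<bar> * ennreal (v1 x) * ennreal (v1 x powr (- 1) * v2 x))"
proof -
  have eq: "AE x in lebesgue. ennreal \<bar>f x\<bar> * ennreal (v1 x) * ennreal (v1 x powr (- 1) * v2 x) = ennreal \<bar>f x\<bar> * ennreal (v2 x)"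
    using WsetD(2)[OF v(1)] WsetD(2)[OF v(2)]
    by eventually_elim (simp add: powr_minus_divide mult.assoc flip: ennreal_mult)
  have "unorm lebesgue \<infinity> A (\<lambda>x. ennreal \<bar>f x\<bar> * ennreal (v2 x)) =
    unorm lebesgue \<infinity> A (\<lambda>x. ennreal \<bar>f x\<bar> * ennreal (v1 x) * ennreal (v1 x powr (- 1) * v2 x))"
    using eq by (intro antisym unorm_mono; (simp; fail)?; eventually_elim) auto
  then show ?thesis by (simp add: wnorm_infinity unorm_infinity)
qed

text \<open>Four results cover the nine cases: p_1 \<le> \<theta> < \<infinity> gives (i) and (vi),
  \<theta> < p_1 < \<infinity> gives (ii) and (vii), \<theta> = \<infinity> gives (iii), (iv) and
  (viii), and the extremal function 1/v_1 gives (v) and (ix).\<close>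

theorem theorem3p2:
  fixes p1 p2 \<theta> :: ereal
    and v1 v2 :: "'a::euclidean_space \<Rightarrow> real"
  assumes "0 < p1" and "0 < p2" and "0 < \<theta>"
    and "v1 \<in> Wset" and "v2 \<in> Wset"
  shows
   \<comment> \<open>(i)\<close>
   "(\<forall>q1 q2 th. p1 = ereal q1 \<and> p2 = ereal q2 \<and> \<theta> = ereal th \<and> q2 < q1 \<and> q1 \<le> th \<longrightarrow>
      unif_equiv (\<lambda>\<omega>. \<omega> \<in> cOmega \<theta>) (\<lambda>\<omega>. Id_norm p1 v1 p2 \<theta> \<omega> v2)
        (\<lambda>\<omega>. SUP t\<in>{0<..}. unorm lebesgue \<theta> {0<..<t} (\<lambda>s. ennreal (\<omega> s)) *
            unorm lebesgue (ereal (q1 * q2 / (q1 - q2))) (cball0 t)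
              (\<lambda>x. ennreal (v1 x powr (- 1 / q1) * v2 x powr (1 / q2)))))
   \<and>
   \<comment> \<open>(ii)\<close>
   (\<forall>q1 q2 th. p1 = ereal q1 \<and> p2 = ereal q2 \<and> \<theta> = ereal th \<and> q2 < q1 \<and> th < q1 \<longrightarrow>
      unif_equiv (\<lambda>\<omega>. \<omega> \<in> cOmega \<theta>) (\<lambda>\<omega>. Id_norm p1 v1 p2 \<theta> \<omega> v2)
        (\<lambda>\<omega>. wnorm lebesgue (ereal (th * q1 / (q1 - th))) {0<..} (\<lambda>t. ennreal (\<omega> t powr th))
            (\<lambda>t. enn_powr (unorm lebesgue \<theta> {0<..<t} (\<lambda>s. ennreal (\<omega> s))) (th / q1) *
                 unorm lebesgue (ereal (q1 * q2 / (q1 - q2))) (cball0 t)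
                   (\<lambda>x. ennreal (v1 x powr (- 1 / q1) * v2 x powr (1 / q2))))))
   \<and>
   \<comment> \<open>(iii)\<close>
   (\<forall>q1 q2. p1 = ereal q1 \<and> p2 = ereal q2 \<and> \<theta> = \<infinity> \<and> q2 < q1 \<longrightarrow>
      unif_equiv (\<lambda>\<omega>. \<omega> \<in> cOmega \<theta>) (\<lambda>\<omega>. Id_norm p1 v1 p2 \<theta> \<omega> v2)
        (\<lambda>\<omega>. SUP t\<in>{0<..}. unorm lebesgue \<theta> {0<..<t} (\<lambda>s. ennreal (\<omega> s)) *
            unorm lebesgue (ereal (q1 * q2 / (q1 - q2))) (cball0 t)
              (\<lambda>x. ennreal (v1 x powr (- 1 / q1) * v2 x powr (1 / q2)))))
   \<and>
   \<comment> \<open>(iv)\<close>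
   (\<forall>q2. p1 = \<infinity> \<and> \<theta> = \<infinity> \<and> p2 = ereal q2 \<longrightarrow>
      unif_equiv (\<lambda>\<omega>. \<omega> \<in> cOmega \<theta>) (\<lambda>\<omega>. Id_norm p1 v1 p2 \<theta> \<omega> v2)
        (\<lambda>\<omega>. SUP t\<in>{0<..}. unorm lebesgue \<theta> {0<..<t} (\<lambda>s. ennreal (\<omega> s)) *
            unorm lebesgue p2 (cball0 t)
              (\<lambda>x. ennreal (v1 x powr (- 1) * v2 x powr (1 / q2)))))
   \<and>
   \<comment> \<open>(v)\<close>
   (\<forall>q2 th. p1 = \<infinity> \<and> p2 = ereal q2 \<and> \<theta> = ereal th \<longrightarrow>
      unif_equiv (\<lambda>\<omega>. \<omega> \<in> cOmega \<theta>) (\<lambda>\<omega>. Id_norm p1 v1 p2 \<theta> \<omega> v2)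
        (\<lambda>\<omega>. unorm lebesgue \<theta> {0<..}
            (\<lambda>t. ennreal (\<omega> t) *
                 unorm lebesgue p2 (cball0 t)
                   (\<lambda>x. ennreal (v1 x powr (- 1) * v2 x powr (1 / q2))))))
   \<and>
   \<comment> \<open>(vi)\<close>
   (\<forall>q th. p1 = ereal q \<and> p2 = ereal q \<and> \<theta> = ereal th \<and> q \<le> th \<longrightarrow>
      unif_equiv (\<lambda>\<omega>. \<omega> \<in> cOmega \<theta>) (\<lambda>\<omega>. Id_norm p1 v1 p2 \<theta> \<omega> v2)
        (\<lambda>\<omega>. SUP t\<in>{0<..}. unorm lebesgue \<theta> {0<..<t} (\<lambda>s. ennreal (\<omega> s)) *
            unorm lebesgue \<infinity> (cball0 t)
              (\<lambda>x. ennreal (v1 x powr (- 1 / q) * v2 x powr (1 / q)))))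
   \<and>
   \<comment> \<open>(vii)\<close>
   (\<forall>q th. p1 = ereal q \<and> p2 = ereal q \<and> \<theta> = ereal th \<and> th < q \<longrightarrow>
      unif_equiv (\<lambda>\<omega>. \<omega> \<in> cOmega \<theta>) (\<lambda>\<omega>. Id_norm p1 v1 p2 \<theta> \<omega> v2)
        (\<lambda>\<omega>. wnorm lebesgue (ereal (th * q / (q - th))) {0<..} (\<lambda>t. ennreal (\<omega> t powr th))
            (\<lambda>t. enn_powr (unorm lebesgue \<theta> {0<..<t} (\<lambda>s. ennreal (\<omega> s))) (th / q) *
                 unorm lebesgue \<infinity> (cball0 t)
                   (\<lambda>x. ennreal (v1 x powr (- 1 / q) * v2 x powr (1 / q))))))
   \<and>
   \<comment> \<open>(viii)\<close>
   (\<forall>q. p1 = ereal q \<and> p2 = ereal q \<and> \<theta> = \<infinity> \<longrightarrow>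
      unif_equiv (\<lambda>\<omega>. \<omega> \<in> cOmega \<theta>) (\<lambda>\<omega>. Id_norm p1 v1 p2 \<theta> \<omega> v2)
        (\<lambda>\<omega>. SUP t\<in>{0<..}. unorm lebesgue \<theta> {0<..<t} (\<lambda>s. ennreal (\<omega> s)) *
            unorm lebesgue \<infinity> (cball0 t)
              (\<lambda>x. ennreal (v1 x powr (- 1 / q) * v2 x powr (1 / q)))))
   \<and>
   \<comment> \<open>(ix)\<close>
   (\<forall>th. p1 = \<infinity> \<and> p2 = \<infinity> \<and> \<theta> = ereal th \<longrightarrow>
      unif_equiv (\<lambda>\<omega>. \<omega> \<in> cOmega \<theta>) (\<lambda>\<omega>. Id_norm p1 v1 p2 \<theta> \<omega> v2)
        (\<lambda>\<omega>. unorm lebesgue \<theta> {0<..}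
            (\<lambda>t. ennreal (\<omega> t) *
                 unorm lebesgue \<infinity> (cball0 t)
                   (\<lambda>x. ennreal (v1 x powr (- 1) * v2 x)))))"
proof (intro conjI allI impI, goal_cases)
  case (1 q1 q2 th)
  then have p: "p1 = ereal q1" "p2 = ereal q2" "\<theta> = ereal th" and q: "q2 < q1" "0 < q2" "q1 \<le> th"
    using assms by auto
  interpret sharp_Holder_finite q1 q2 "ereal (q1 * q2 / (q1 - q2))" v1 v2 "\<lambda>x. v1 x powr (- 1 / q1) * v2 x powr (1 / q2)"
    by (intro sharp_Holder_less q assms)
  show ?case unfolding p by (rule Id_norm_le_exponent[OF q(3)])
next
  case (2 q1 q2 th)
  then have p: "p1 = ereal q1" "p2 = ereal q2" "\<theta> = ereal th" and q: "q2 < q1" "0 < q2" "0 < th" "th < q1"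
    using assms by auto
  interpret sharp_Holder_finite q1 q2 "ereal (q1 * q2 / (q1 - q2))" v1 v2 "\<lambda>x. v1 x powr (- 1 / q1) * v2 x powr (1 / q2)"
    by (intro sharp_Holder_less q assms)
  show ?case unfolding p by (rule Id_norm_gt_exponent[OF q(3,4)])
next
  case (3 q1 q2)
  then have p: "p1 = ereal q1" "p2 = ereal q2" "\<theta> = \<infinity>" and q: "q2 < q1" "0 < q2"
    using assms by auto
  interpret sharp_Holder_finite q1 q2 "ereal (q1 * q2 / (q1 - q2))" v1 v2 "\<lambda>x. v1 x powr (- 1 / q1) * v2 x powr (1 / q2)"
    by (intro sharp_Holder_less q assms)
  show ?case unfolding p by (rule Id_norm_infinity)
next
  case (4 q2)
  then have p: "p1 = \<infinity>" "p2 = ereal q2" "\<theta> = \<infinity>" and q: "0 < q2"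
    using assms by auto
  note [measurable] = WsetD(1)[OF assms(4)] WsetD(1)[OF assms(5)]
  \<comment> \<open>The blanks are positivity of p_2 and measurability of the quotient weight,
    discharged at each use.\<close>
  note hyps = _ assms(4,5) _ wnorm_eq_unorm_finite[OF q assms(4,5)]
  interpret sharp_Holder \<infinity> "ereal q2" "ereal q2" v1 v2 "\<lambda>x. v1 x powr (- 1) * v2 x powr (1 / q2)"
    by (rule sharp_Holder_infinity[OF hyps]) (use q in simp_all)
  show ?case unfolding p by (rule Id_norm_infinity)
next
  case (5 q2 th)
  then have p: "p1 = \<infinity>" "p2 = ereal q2" "\<theta> = ereal th" and q: "0 < q2" "0 < th"
    using assms by auto
  note [measurable] = WsetD(1)[OF assms(4)] WsetD(1)[OF assms(5)]
  note hyps = _ assms(4,5) _ wnorm_eq_unorm_finite[OF q(1) assms(4,5)]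
  interpret sharp_Holder \<infinity> "ereal q2" "ereal q2" v1 v2 "\<lambda>x. v1 x powr (- 1) * v2 x powr (1 / q2)"
    by (rule sharp_Holder_infinity[OF hyps]) (use q in simp_all)
  show ?case unfolding p
    by (rule Id_norm_attained[OF q(2) _ Lp_norm_inverse_weight[OF hyps] unorm_le_wnorm_inverse_weight[OF hyps]])
      (use q in simp_all)
next
  case (6 q th)
  then have p: "p1 = ereal q" "p2 = ereal q" "\<theta> = ereal th" and q: "0 < q" "q \<le> th"
    using assms by auto
  interpret sharp_Holder_finite q q \<infinity> v1 v2 "\<lambda>x. v1 x powr (- 1 / q) * v2 x powr (1 / q)"
    by (intro sharp_Holder_equal q assms)
  show ?case unfolding p by (rule Id_norm_le_exponent[OF q(2)])
next
  case (7 q th)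
  then have p: "p1 = ereal q" "p2 = ereal q" "\<theta> = ereal th" and q: "0 < q" "0 < th" "th < q"
    using assms by auto
  interpret sharp_Holder_finite q q \<infinity> v1 v2 "\<lambda>x. v1 x powr (- 1 / q) * v2 x powr (1 / q)"
    by (intro sharp_Holder_equal q assms)
  show ?case unfolding p by (rule Id_norm_gt_exponent[OF q(2,3)])
next
  case (8 q)
  then have p: "p1 = ereal q" "p2 = ereal q" "\<theta> = \<infinity>" and q: "0 < q"
    using assms by auto
  interpret sharp_Holder_finite q q \<infinity> v1 v2 "\<lambda>x. v1 x powr (- 1 / q) * v2 x powr (1 / q)"
    by (intro sharp_Holder_equal q assms)
  show ?case unfolding p by (rule Id_norm_infinity)
next
  case (9 th)
  then have p: "p1 = \<infinity>" "p2 = \<infinity>" "\<theta> = ereal th" and q: "0 < th"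
    using assms by auto
  note [measurable] = WsetD(1)[OF assms(4)] WsetD(1)[OF assms(5)]
  note hyps = _ assms(4,5) _ wnorm_eq_unorm_infinity[OF assms(4,5)]
  interpret sharp_Holder \<infinity> \<infinity> \<infinity> v1 v2 "\<lambda>x. v1 x powr (- 1) * v2 x"
    by (rule sharp_Holder_infinity[OF hyps]) simp_all
  show ?case unfolding p
    by (rule Id_norm_attained[OF q _ Lp_norm_inverse_weight[OF hyps] unorm_le_wnorm_inverse_weight[OF hyps]])
      simp_all
qed

end
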